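(* Assume: (1) $\alpha_i>0$ for $i=1,2,3,4$ and $\tau_j>0$ for $j=1,2$; (2) $h\in C^0(\mathbb{R}^m;\mathbb{R}^m)$; (3) $\sigma$ is Lipschitz continuous and acts componentwise; (4) $\sigma(0)=0$; (5) $\mathcal{L}\ge 0$ and $\mathcal{L}$ is continuous in its first argument. Let $\{(x_s,y_s)\}_{s=1}^S\subset\mathbb{R}^d\times\mathbb{R}^m$ be any given set of training data ($S\geq 1$). Then minimisers of $\mathcal{E}_n$ and $\mathcal{E}_\infty$ exist in $\Theta^{(n)}$ (for every $n\in\mathbb{N}$) and $\Theta$ respectively. Furthermore, let $\theta^{(n)}\in\Theta^{(n)}$, $n\in\mathbb{N}$, be any sequence of minimisers of $\mathcal{E}_n$. Then \[ \min_{\Theta^{(n)}}\mathcal{E}_n=\mathcal{E}_n(\theta^{(n)})\to\min_{\Theta}\mathcal{E}_\infty\qquad\text{as } n\to\infty, \] the sequence $\{\theta^{(n)}\}_{n\in\mathbb{N}}$ is relatively compact (every subsequence has a further subsequence converging, with respect to $d$, to some $\theta\in\Theta$), and any limit point of $\{\theta^{(n)}\}_{n\in\mathbb{N}}$ is a minimiser of $\mathcal{E}_\infty$.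
   Context: $\mathbb{N}=\{1,2,\dots\}$. Fix $d,m,S\in\mathbb{N}$, training data $\{(x_s,y_s)\}_{s=1}^S\subset\mathbb{R}^d\times\mathbb{R}^m$, functions $\sigma:\mathbb{R}^d\to\mathbb{R}^d$, $h:\mathbb{R}^m\to\mathbb{R}^m$, $\mathcal{L}:\mathbb{R}^m\times\mathbb{R}^m\to\mathbb{R}$, weights $\alpha_1,\dots,\alpha_4$ and $\tau_1,\tau_2$, and norms $\|\cdot\|$ on the finite-dimensional spaces $\mathbb{R}^d,\mathbb{R}^{d\times d},\mathbb{R}^{m\times d},\mathbb{R}^m$. "$\sigma$ acts componentwise" means $\sigma(x)=(\tilde\sigma(x_1),\dots,\tilde\sigma(x_d))^\top$ for some $\tilde\sigma:\mathbb{R}\to\mathbb{R}$. Parameter spaces. For $n\in\mathbb{N}$ let $\mu_n=\frac1n\sum_{i=0}^{n-1}\delta_{i/n}$; a function $K^{(n)}$ on $\{i/n\}_{i=0}^{n-1}$ is identified with the tuple $K^{(n)}_i=K^{(n)}(i/n)$, $i=0,\dots,n-1$. Set $\Theta^{(n)}=L^2(\mu_n;\mathbb{R}^{d\times d})\times L^2(\mu_n;\mathbb{R}^d)\times\mathbb{R}^{m\times d}\times\mathbb{R}^m$ and $\Theta=H^1([0,1];\mathbb{R}^{d\times d})\times H^1([0,1];\mathbb{R}^d)\times\mathbb{R}^{m\times d}\times\mathbb{R}^m$. $H^1$ functions are identified with their continuous representatives. Discrete functional. $X_i^{(n)}=X_i^{(n)}[x;K^{(n)},b^{(n)}]$ is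 defined by $X_0^{(n)}=x$ and $X_{i+1}^{(n)}=X_i^{(n)}+\frac1n\sigma(K_i^{(n)}X_i^{(n)}+b_i^{(n)})$, $i=0,\dots,n-1$. Then $E_n(K^{(n)},b^{(n)},W,c;x,y)=\mathcal{L}(h(WX_n^{(n)}[x;K^{(n)},b^{(n)}]+c),y)$, $R_n^{(1)}(K^{(n)})=n\sum_{i=1}^{n-1}\|K_i^{(n)}-K_{i-1}^{(n)}\|^2+\tau_1\|K_0^{(n)}\|^2$, $R_n^{(2)}(b^{(n)})=n\sum_{i=1}^{n-1}\|b_i^{(n)}-b_{i-1}^{(n)}\|^2+\tau_2\|b_0^{(n)}\|^2$, $R^{(3)}(W)=\|W\|^2$, $R^{(4)}(c)=\|c\|^2$, and $\mathcal{E}_n(K^{(n)},b^{(n)},W,c)=\sum_{s=1}^S E_n(K^{(n)},b^{(n)},W,c;x_s,y_s)+\alpha_1R_n^{(1)}(K^{(n)})+\alpha_2R_n^{(2)}(b^{(n)})+\alpha_3R^{(3)}(W)+\alpha_4R^{(4)}(c)$. Continuum functional. $X(\cdot;x,K,b):[0,1]\to\mathbb{R}^d$ solves $\dot X(t)=\sigma(K(t)X(t)+b(t))$, $X(0)=x$. Then $E_\infty(K,b,W,c;x,y)=\mathcal{L}(h(WX(1;x,K,b)+c),y)$, $R_\infty^{(1)}(K)=\|\dot K\|_{L^2}^2+\tau_1\|K(0)\|^2$, $R_\infty^{(2)}(b)=\|\dot b\|_{L^2}^2+\tau_2\|b(0)\|^2$, and $\mathcal{E}_\infty(K,b,W,c)=\sum_{s=1}^S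 E_\infty(K,b,W,c;x_s,y_s)+\alpha_1R_\infty^{(1)}(K)+\alpha_2R_\infty^{(2)}(b)+\alpha_3R^{(3)}(W)+\alpha_4R^{(4)}(c)$. Convergence. For $\theta^{(n)}=(K^{(n)},b^{(n)},W^{(n)},c^{(n)})\in\Theta^{(n)}$ and $\theta=(K,b,W,c)\in\Theta$, $d(\theta^{(n)},\theta)=\|\tilde K^{(n)}-K\|_{L^2}+\|\tilde b^{(n)}-b\|_{L^2}+\|W^{(n)}-W\|+\|c^{(n)}-c\|$, where $\tilde K^{(n)}(t)=K^{(n)}_{i-1}$ for $t\in(\frac{i-1}n,\frac in)$, $i=1,\dots,n$, and similarly $\tilde b^{(n)}$. $\theta^{(n)}\to\theta$ means $d(\theta^{(n)},\theta)\to0$; limit points are limits along subsequences in this sense. *)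

theory Defs
  imports "HOL-Analysis.Analysis"
begin

definition is_norm :: "('a::real_vector \<Rightarrow> real) \<Rightarrow> bool" where
  "is_norm N \<longleftrightarrow>
     (\<forall>x. 0 \<le> N x) \<and> (\<forall>x. N x = 0 \<longleftrightarrow> x = 0) \<and>
     (\<forall>c x. N (c *\<^sub>R x) = \<bar>c\<bar> * N x) \<and>
     (\<forall>x y. N (x + y) \<le> N x + N y)"

text \<open>Membership in \<open>L\<^sup>2\<close> does not depend on the norm of the finite-dimensional target space, so it
  is stated with the library norm; the value of the \<open>L\<^sup>2\<close> norm is taken with respect to a given
  norm \<open>N\<close>.\<close>

definition L2 :: "(real \<Rightarrow> 'a::euclidean_space) set" where
  "L2 = {f \<in> borel_measurable (lebesgue_on {0..1}).
           integrable (lebesgue_on {0..1}) (\<lambda>t. (norm (f t))\<^sup>2)}"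

definition L2_norm :: "('a::euclidean_space \<Rightarrow> real) \<Rightarrow> (real \<Rightarrow> 'a) \<Rightarrow> real" where
  "L2_norm N f = sqrt (integral\<^sup>L (lebesgue_on {0..1}) (\<lambda>t. (N (f t))\<^sup>2))"

text \<open>Weak derivatives on \<open>(0,1)\<close>, tested against \<open>\<phi> \<in> C\<^sup>1\<^sub>c(0,1)\<close> as in Brezis, \<^emph>\<open>Functional Analysis,
  Sobolev Spaces and Partial Differential Equations\<close>, Section 8.2.\<close>

definition is_weak_deriv :: "(real \<Rightarrow> 'a::euclidean_space) \<Rightarrow> (real \<Rightarrow> 'a) \<Rightarrow> bool" where
  "is_weak_deriv f g \<longleftrightarrow>
     (\<forall>\<phi> \<phi>'. (\<forall>t. (\<phi> has_real_derivative \<phi>' t) (at t)) \<and> continuous_on UNIV \<phi>' \<and>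
             closure {t. \<phi> t \<noteq> 0} \<subseteq> {0<..<1} \<longrightarrow>
        integral\<^sup>L (lebesgue_on {0..1}) (\<lambda>t. \<phi>' t *\<^sub>R f t) =
        - integral\<^sup>L (lebesgue_on {0..1}) (\<lambda>t. \<phi> t *\<^sub>R g t))"

text \<open>Elements of \<open>H\<^sup>1([0,1])\<close> are continuous representatives; \<open>extensional\<close> makes them functions on
  \<open>[0,1]\<close> only.\<close>

definition H1 :: "(real \<Rightarrow> 'a::euclidean_space) set" where
  "H1 = {f \<in> L2. f \<in> extensional {0..1} \<and> continuous_on {0..1} f \<and>
                 (\<exists>g \<in> L2. is_weak_deriv f g)}"

text \<open>Determined only up to null sets, which is all that \<^const>\<open>L2_norm\<close> sees.\<close>

definition weak_deriv :: "(real \<Rightarrow> 'a::euclidean_space) \<Rightarrow> real \<Rightarrow> 'a" where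
  "weak_deriv f = (SOME g. g \<in> L2 \<and> is_weak_deriv f g)"

type_synonym ('d, 'm) disc_param =
  "(nat \<Rightarrow> real^'d^'d) \<times> (nat \<Rightarrow> real^'d) \<times> (real^'d^'m) \<times> (real^'m)"

type_synonym ('d, 'm) cont_param =
  "(real \<Rightarrow> real^'d^'d) \<times> (real \<Rightarrow> real^'d) \<times> (real^'d^'m) \<times> (real^'m)"

text \<open>\<open>L\<^sup>2(\<mu>\<^sub>n; V)\<close> is the space of all \<open>n\<close>-tuples in \<open>V\<close>, indexed by \<open>0, \<dots>, n - 1\<close>.\<close>

definition Theta_disc :: "nat \<Rightarrow> ('d::finite, 'm::finite) disc_param set" where
  "Theta_disc n = ({..<n} \<rightarrow>\<^sub>E UNIV) \<times> ({..<n} \<rightarrow>\<^sub>E UNIV) \<times> UNIV \<times> UNIV"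

definition Theta :: "('d::finite, 'm::finite) cont_param set" where
  "Theta = H1 \<times> H1 \<times> UNIV \<times> UNIV"

definition acts_componentwise :: "(real^'d \<Rightarrow> real^'d) \<Rightarrow> bool" where
  "acts_componentwise \<sigma> \<longleftrightarrow> (\<exists>s :: real \<Rightarrow> real. \<forall>x. \<sigma> x = (\<chi> i. s (x $ i)))"

primrec disc_state ::
  "(real^'d \<Rightarrow> real^'d) \<Rightarrow> nat \<Rightarrow> (nat \<Rightarrow> real^'d^'d) \<Rightarrow> (nat \<Rightarrow> real^'d) \<Rightarrow> real^'d \<Rightarrow> nat \<Rightarrow> real^'d"
where
  "disc_state \<sigma> n K b x 0 = x"
| "disc_state \<sigma> n K b x (Suc i) =
     disc_state \<sigma> n K b x i + (1 / real n) *\<^sub>R \<sigma> (K i *v disc_state \<sigma> n K b x i + b i)"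

definition disc_reg :: "('a::real_vector \<Rightarrow> real) \<Rightarrow> real \<Rightarrow> nat \<Rightarrow> (nat \<Rightarrow> 'a) \<Rightarrow> real" where
  "disc_reg N \<tau> n u = real n * (\<Sum>i=1..<n. (N (u i - u (i - 1)))\<^sup>2) + \<tau> * (N (u 0))\<^sup>2"

definition disc_energy ::
  "(real^'d \<Rightarrow> real^'d) \<Rightarrow> (real^'m \<Rightarrow> real^'m) \<Rightarrow> (real^'m \<Rightarrow> real^'m \<Rightarrow> real) \<Rightarrow>
   (real^'d^'d \<Rightarrow> real) \<Rightarrow> (real^'d \<Rightarrow> real) \<Rightarrow> (real^'d^'m \<Rightarrow> real) \<Rightarrow> (real^'m \<Rightarrow> real) \<Rightarrow>
   (nat \<Rightarrow> real) \<Rightarrow> (nat \<Rightarrow> real) \<Rightarrow> nat \<Rightarrow> (nat \<Rightarrow> real^'d) \<Rightarrow> (nat \<Rightarrow> real^'m) \<Rightarrow>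
   nat \<Rightarrow> ('d, 'm) disc_param \<Rightarrow> real"
where
  "disc_energy \<sigma> h \<L> N\<^sub>K N\<^sub>b N\<^sub>W N\<^sub>c \<alpha> \<tau> S x y n = (\<lambda>(K, b, W, c).
     (\<Sum>s=1..S. \<L> (h (W *v disc_state \<sigma> n K b (x s) n + c)) (y s))
     + \<alpha> 1 * disc_reg N\<^sub>K (\<tau> 1) n K + \<alpha> 2 * disc_reg N\<^sub>b (\<tau> 2) n b
     + \<alpha> 3 * (N\<^sub>W W)\<^sup>2 + \<alpha> 4 * (N\<^sub>c c)\<^sup>2)"

definition solves_ode ::
  "(real^'d \<Rightarrow> real^'d) \<Rightarrow> (real \<Rightarrow> real^'d^'d) \<Rightarrow> (real \<Rightarrow> real^'d) \<Rightarrow> real^'d \<Rightarrow>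
   (real \<Rightarrow> real^'d) \<Rightarrow> bool"
where
  "solves_ode \<sigma> K b x X \<longleftrightarrow> X 0 = x \<and>
     (\<forall>t\<in>{0..1}. (X has_vector_derivative \<sigma> (K t *v X t + b t)) (at t within {0..1}))"

text \<open>On \<open>[0,1]\<close> the solution exists and is unique for Lipschitz \<open>\<sigma>\<close> and continuous \<open>K\<close>, \<open>b\<close>.\<close>

definition cont_state ::
  "(real^'d \<Rightarrow> real^'d) \<Rightarrow> (real \<Rightarrow> real^'d^'d) \<Rightarrow> (real \<Rightarrow> real^'d) \<Rightarrow> real^'d \<Rightarrow> real \<Rightarrow> real^'d"
where
  "cont_state \<sigma> K b x = (SOME X. solves_ode \<sigma> K b x X)"

definition cont_reg :: "('a::euclidean_space \<Rightarrow> real) \<Rightarrow> real \<Rightarrow> (real \<Rightarrow> 'a) \<Rightarrow> real" where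
  "cont_reg N \<tau> u = (L2_norm N (weak_deriv u))\<^sup>2 + \<tau> * (N (u 0))\<^sup>2"

definition cont_energy ::
  "(real^'d \<Rightarrow> real^'d) \<Rightarrow> (real^'m \<Rightarrow> real^'m) \<Rightarrow> (real^'m \<Rightarrow> real^'m \<Rightarrow> real) \<Rightarrow>
   (real^'d^'d \<Rightarrow> real) \<Rightarrow> (real^'d \<Rightarrow> real) \<Rightarrow> (real^'d^'m \<Rightarrow> real) \<Rightarrow> (real^'m \<Rightarrow> real) \<Rightarrow>
   (nat \<Rightarrow> real) \<Rightarrow> (nat \<Rightarrow> real) \<Rightarrow> nat \<Rightarrow> (nat \<Rightarrow> real^'d) \<Rightarrow> (nat \<Rightarrow> real^'m) \<Rightarrow>
   ('d, 'm) cont_param \<Rightarrow> real"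
where
  "cont_energy \<sigma> h \<L> N\<^sub>K N\<^sub>b N\<^sub>W N\<^sub>c \<alpha> \<tau> S x y = (\<lambda>(K, b, W, c).
     (\<Sum>s=1..S. \<L> (h (W *v cont_state \<sigma> K b (x s) 1 + c)) (y s))
     + \<alpha> 1 * cont_reg N\<^sub>K (\<tau> 1) K + \<alpha> 2 * cont_reg N\<^sub>b (\<tau> 2) b
     + \<alpha> 3 * (N\<^sub>W W)\<^sup>2 + \<alpha> 4 * (N\<^sub>c c)\<^sup>2)"

text \<open>For \<open>t\<close> in the open interval \<open>((i - 1)/n, i/n)\<close> the index below is \<open>i - 1\<close>; the values at the
  finitely many grid points do not matter.\<close>

definition pw_const :: "nat \<Rightarrow> (nat \<Rightarrow> 'a) \<Rightarrow> real \<Rightarrow> 'a" where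
  "pw_const n u t = u (nat \<lfloor>real n * t\<rfloor>)"

definition param_dist ::
  "(real^'d^'d \<Rightarrow> real) \<Rightarrow> (real^'d \<Rightarrow> real) \<Rightarrow> (real^'d^'m \<Rightarrow> real) \<Rightarrow> (real^'m \<Rightarrow> real) \<Rightarrow>
   nat \<Rightarrow> ('d::finite, 'm::finite) disc_param \<Rightarrow> ('d, 'm) cont_param \<Rightarrow> real"
where
  "param_dist N\<^sub>K N\<^sub>b N\<^sub>W N\<^sub>c n = (\<lambda>(K\<^sub>n, b\<^sub>n, W\<^sub>n, c\<^sub>n) (K, b, W, c).
     L2_norm N\<^sub>K (\<lambda>t. pw_const n K\<^sub>n t - K t) + L2_norm N\<^sub>b (\<lambda>t. pw_const n b\<^sub>n t - b t)
     + N\<^sub>W (W\<^sub>n - W) + N\<^sub>c (c\<^sub>n - c))"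

end

theory Submission
  imports Defs "HOL-Complex_Analysis.Great_Picard"
begin

text \<open>This is a \<open>\<Gamma>\<close>-convergence argument. The energies of the discrete minimisers are bounded by the
  energy of the zero parameters, so the regularisers make their step functions bounded and, up to an
  error \<open>1/n\<close>, \<open>1/2\<close>-Hoelder with a uniform constant; an Arzela--Ascoli argument extracts a pointwise limit
  \<open>(K, b, W, c)\<close>. The difference quotients of \<open>K\<close> and \<open>b\<close> on every uniform grid inherit the energy bound,
  which characterises \<open>H\<^sup>1\<close> and gives the liminf inequality, while the Euler states converge to the
  solution of the differential equation. Conversely, sampling an \<open>H\<^sup>1\<close> function on the grid does not
  increase its energy (Jensen), which gives recovery sequences. Existence of a continuum minimiser and of
  solutions of the differential equation are by-products of these limits.\<close>

section \<open>Norms on finite-dimensional spaces\<close>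

text \<open>The four norms are arbitrary, so the energies need not come from an inner product. Hence
  the detour through difference quotients: on a fixed grid of \<open>m\<close> cells they involve
  finitely many points, so pointwise convergence is enough for the limit in \<open>n\<close>, and
  \<open>m\<close> grows only afterwards. Orthogonality is then used for the Euclidean norm, and
  Fatou's lemma for \<open>N\<close>, which keeps the constant in the energy bound sharp;
  equivalence of norms alone would lose a factor. \<open>H1\<close> is defined by weak derivatives,
  and its energy by an arbitrary choice of one. The estimates are made for primitives instead, which
  requires the translation in both directions and almost everywhere uniqueness of the derivative.
  Step functions jump, so their equicontinuity holds only up to an error that vanishes with
  \<open>1/n\<close>. Limits are constructed pointwise, whereas \<open>D\<close> sees
  \<open>K\<close> and \<open>b\<close> only in \<open>L2\<close>: uniqueness of limits identifies
  any given limit point with a constructed one, which is already known to be a minimiser.\<close>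

lemma
  assumes "is_norm N"
  shows is_norm_nonneg: "0 \<le> N x"
    and is_norm_eq_0_iff: "N x = 0 \<longleftrightarrow> x = 0"
    and is_norm_scaleR: "N (c *\<^sub>R x) = \<bar>c\<bar> * N x"
    and is_norm_triangle: "N (x + y) \<le> N x + N y"
  using assms unfolding is_norm_def by auto

lemma is_norm_minus: "is_norm N \<Longrightarrow> N (- x) = N x"
  using is_norm_scaleR[of N "-1" x] by simp

lemma is_norm_diff_commute: "is_norm N \<Longrightarrow> N (x - y) = N (y - x)"
  using is_norm_minus[of N "x - y"] by simp

lemma is_norm_zero: "is_norm N \<Longrightarrow> N 0 = 0"
  by (simp add: is_norm_eq_0_iff)

lemma is_norm_sum:
  assumes "is_norm N"
  shows "N (\<Sum>i\<in>I. f i) \<le> (\<Sum>i\<in>I. N (f i))"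
proof (induction I rule: infinite_finite_induct)
  case (insert i I)
  then show ?case
    using is_norm_triangle[OF assms, of "f i" "\<Sum>i\<in>I. f i"] by simp
qed (simp_all add: is_norm_zero[OF assms])

lemma is_norm_abs_diff_le:
  assumes "is_norm N"
  shows "\<bar>N x - N y\<bar> \<le> N (x - y)"
  using is_norm_triangle[OF assms, of "x - y" y] is_norm_triangle[OF assms, of "y - x" x]
    is_norm_diff_commute[OF assms, of x y] by simp

lemma is_norm_le_norm:
  fixes N :: "'a::euclidean_space \<Rightarrow> real"
  assumes "is_norm N"
  obtains C where "C > 0" "\<And>x. N x \<le> C * norm x"
proof
  let ?C = "(\<Sum>i\<in>Basis. N i) + 1"
  show "?C > 0"
    using is_norm_nonneg[OF assms] by (smt (verit) sum_nonneg)
  fix x :: 'a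
  have "N x = N (\<Sum>i\<in>Basis. (x \<bullet> i) *\<^sub>R i)"
    by (simp add: euclidean_representation)
  also have "\<dots> \<le> (\<Sum>i\<in>Basis. \<bar>x \<bullet> i\<bar> * N i)"
    using is_norm_sum[OF assms, of "\<lambda>i. (x \<bullet> i) *\<^sub>R i" Basis] by (simp add: is_norm_scaleR[OF assms])
  also have "\<dots> \<le> (\<Sum>i\<in>Basis. norm x * N i)"
    by (intro sum_mono mult_right_mono Basis_le_norm is_norm_nonneg[OF assms])
  also have "\<dots> \<le> ?C * norm x"
    by (simp add: sum_distrib_left algebra_simps)
  finally show "N x \<le> ?C * norm x" .
qed

lemma continuous_on_is_norm:
  fixes N :: "'a::euclidean_space \<Rightarrow> real"
  assumes "is_norm N"
  shows "continuous_on A N"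
proof -
  obtain C where C: "C > 0" "\<And>x. N x \<le> C * norm x"
    using is_norm_le_norm[OF assms] by blast
  have "C-lipschitz_on A N"
    using C is_norm_abs_diff_le[OF assms]
    by (intro lipschitz_onI) (auto simp: dist_norm intro: order_trans)
  then show ?thesis
    by (rule lipschitz_on_continuous_on)
qed

lemma tendsto_is_norm:
  fixes N :: "'a::euclidean_space \<Rightarrow> real"
  assumes "is_norm N" "(f \<longlongrightarrow> l) F"
  shows "((\<lambda>x. N (f x)) \<longlongrightarrow> N l) F"
  using continuous_on_tendsto_compose[OF continuous_on_is_norm[OF assms(1), of UNIV] assms(2)] by simp

text \<open>The minimum of \<open>N\<close> on the compact unit sphere is positive, and its
  reciprocal is the constant. Together with \<open>is_norm_le_norm\<close> this lets the Euclidean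
  norm serve for compactness, measurability and orthogonality while the energies are measured by
  \<open>N\<close>.\<close>

lemma norm_le_is_norm:
  fixes N :: "'a::euclidean_space \<Rightarrow> real"
  assumes "is_norm N"
  obtains C where "C > 0" "\<And>x. norm x \<le> C * N x"
proof -
  have "compact (sphere 0 1 :: 'a set)" "sphere 0 1 \<noteq> ({} :: 'a set)"
    by simp_all
  then obtain x0 :: 'a where x0: "x0 \<in> sphere 0 1" "\<And>x. x \<in> sphere 0 1 \<Longrightarrow> N x0 \<le> N x"
    using continuous_attains_inf[OF _ _ continuous_on_is_norm[OF assms, of "sphere 0 1"]] by metis
  have "x0 \<noteq> 0"
    using x0(1) by auto
  then have pos: "N x0 > 0"
    using is_norm_nonneg[OF assms] is_norm_eq_0_iff[OF assms] by (metis less_eq_real_def)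
  show thesis
  proof
    show "1 / N x0 > 0" using pos by simp
    fix x :: 'a
    show "norm x \<le> 1 / N x0 * N x"
    proof (cases "x = 0")
      case False
      then have "N x0 \<le> N ((1 / norm x) *\<^sub>R x)"
        by (intro x0(2)) simp
      also have "\<dots> = N x / norm x"
        by (simp add: is_norm_scaleR[OF assms])
      finally show ?thesis
        using pos False by (simp add: field_simps)
    qed (simp add: is_norm_zero[OF assms])
  qed
qed

text \<open>The epigraph of a norm is a closed convex cone, so it contains the integral of
  \<open>t \<mapsto> (g t, N (g t))\<close>.\<close>

lemma is_norm_integral_le:
  fixes N :: "'a::euclidean_space \<Rightarrow> real" and g :: "real \<Rightarrow> 'a"
  assumes N: "is_norm N" and g: "g integrable_on A" and Ng: "(\<lambda>t. N (g t)) integrable_on A"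
  shows "N (integral A g) \<le> integral A (\<lambda>t. N (g t))"
proof (rule ccontr)
  let ?C = "{(v, r). N v \<le> r}"
  assume "\<not> ?thesis"
  then have notin: "(integral A g, integral A (\<lambda>t. N (g t))) \<notin> ?C"
    by simp
  have "convex ?C"
  proof (rule convexI)
    fix p q :: "'a \<times> real" and a b :: real
    assume *: "p \<in> ?C" "q \<in> ?C" "0 \<le> a" "0 \<le> b" "a + b = 1"
    have "N (a *\<^sub>R fst p + b *\<^sub>R fst q) \<le> a * N (fst p) + b * N (fst q)"
      using is_norm_triangle[OF N, of "a *\<^sub>R fst p" "b *\<^sub>R fst q"] *
      by (simp add: is_norm_scaleR[OF N])
    also have "\<dots> \<le> a * snd p + b * snd q"
      using * by (intro add_mono mult_left_mono) auto
    finally show "a *\<^sub>R p + b *\<^sub>R q \<in> ?C"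
      by (simp add: case_prod_beta)
  qed
  moreover have "closed ?C"
    unfolding case_prod_beta
    by (intro closed_Collect_le continuous_on_compose2[OF continuous_on_is_norm[OF N, of UNIV]]
        continuous_intros) auto
  ultimately obtain a b where ab: "inner a (integral A g, integral A (\<lambda>t. N (g t))) < b"
    "\<And>z. z \<in> ?C \<Longrightarrow> inner a z > b"
    using separating_hyperplane_closed_point[OF _ _ notin] by blast
  have "b < 0"
    using ab(2)[of 0] by (simp add: zero_prod_def is_norm_zero[OF N] inner_prod_def)
  \<comment> \<open>The epigraph is closed under nonnegative scaling, so the negative bound
    \<open>b\<close> improves to 0: a point with negative product could be scaled onto the
    separating hyperplane.\<close>
  have nonneg: "inner a z \<ge> 0" if "z \<in> ?C" for z
  proof (rule ccontr)
    assume neg: "\<not> ?thesis"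
    define c where "c = b / inner a z"
    have "c \<ge> 0" "c * inner a z = b"
      using neg \<open>b < 0\<close> by (auto simp: c_def divide_nonpos_neg)
    moreover from this have "c *\<^sub>R z \<in> ?C"
      using that by (simp add: case_prod_beta is_norm_scaleR[OF N] mult_left_mono)
    ultimately show False
      using ab(2)[of "c *\<^sub>R z"] by simp
  qed
  obtain a1 a2 where a: "a = (a1, a2)"
    by fastforce
  have "((\<lambda>t. a1 \<bullet> g t) has_integral (a1 \<bullet> integral A g)) A"
    using has_integral_linear[OF integrable_integral[OF g] bounded_linear_inner_right[of a1]]
    by (simp add: o_def)
  then have "((\<lambda>t. a1 \<bullet> g t + a2 * N (g t)) has_integral
      (a1 \<bullet> integral A g + a2 * integral A (\<lambda>t. N (g t)))) A"
    by (intro has_integral_add has_integral_mult_right integrable_integral Ng)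
  then have "0 \<le> a1 \<bullet> integral A g + a2 * integral A (\<lambda>t. N (g t))"
  proof (rule has_integral_nonneg)
    show "0 \<le> a1 \<bullet> g t + a2 * N (g t)" for t
      using nonneg[of "(g t, N (g t))"] by (simp add: a inner_Pair)
  qed
  also have "\<dots> < 0"
    using ab(1) \<open>b < 0\<close> by (simp add: a inner_Pair)
  finally show False by simp
qed

text \<open>Cauchy-Schwarz against the constant 1, read off from the nonnegative integral of
  \<open>(f - c)^2\<close> with \<open>c\<close> the mean of \<open>f\<close>.\<close>

lemma square_integral_le:
  fixes f :: "real \<Rightarrow> real"
  assumes "s \<le> t" and f: "f integrable_on {s..t}" and f2: "(\<lambda>x. (f x)\<^sup>2) integrable_on {s..t}"
  shows "(integral {s..t} f)\<^sup>2 \<le> (t - s) * integral {s..t} (\<lambda>x. (f x)\<^sup>2)"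
proof (cases "s = t")
  case False
  then have "s < t" using assms by simp
  define I where "I = integral {s..t} f"
  define c where "c = I / (t - s)"
  have "((\<lambda>x. (f x)\<^sup>2 - 2 * c * f x + c\<^sup>2) has_integral
      (integral {s..t} (\<lambda>x. (f x)\<^sup>2) - 2 * c * I + c\<^sup>2 * (t - s))) {s..t}"
    using has_integral_const_real[of "c\<^sup>2" s t] \<open>s < t\<close> unfolding I_def
    by (intro has_integral_add has_integral_diff has_integral_mult_right integrable_integral f f2)
      (simp add: mult.commute)
  then have "0 \<le> integral {s..t} (\<lambda>x. (f x)\<^sup>2) - 2 * c * I + c\<^sup>2 * (t - s)"
  proof (rule has_integral_nonneg)
    show "0 \<le> (f r)\<^sup>2 - 2 * c * f r + c\<^sup>2" for r
      using zero_le_power2[of "f r - c"] by (simp add: power2_eq_square algebra_simps)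
  qed
  also have "\<dots> = integral {s..t} (\<lambda>x. (f x)\<^sup>2) - I\<^sup>2 / (t - s)"
  proof -
    have "c * (t - s) = I"
      using \<open>s < t\<close> unfolding c_def by simp
    then have "c\<^sup>2 * (t - s) = c * I"
      by (simp add: power2_eq_square)
    then show ?thesis
      by (simp add: c_def power2_eq_square)
  qed
  finally show ?thesis
    using \<open>s < t\<close> unfolding I_def by (simp add: field_simps)
qed simp

lemma sum_square_le_card:
  fixes f :: "nat \<Rightarrow> real"
  shows "(\<Sum>i\<in>I. f i)\<^sup>2 \<le> real (card I) * (\<Sum>i\<in>I. (f i)\<^sup>2)"
  using Cauchy_Schwarz_ineq_sum[of "\<lambda>_. 1" f I] by simp

section \<open>Step functions and asymptotic equicontinuity\<close>

lemma pw_const_comp: "F (pw_const n u t) = pw_const n (\<lambda>i. F (u i)) t"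
  by (simp add: pw_const_def)

lemma pw_const_eq:
  assumes "n > 0" "real i / real n \<le> t" "t < real (Suc i) / real n"
  shows "pw_const n u t = u i"
proof -
  have "\<lfloor>real n * t\<rfloor> = int i"
    using assms by (intro floor_unique) (auto simp: field_simps)
  then show ?thesis
    by (simp add: pw_const_def)
qed

text \<open>Initial grid segments are treated, not only the unit interval, because values of
  \<open>u\<close> at dyadic points and Euler states both arise as such partial sums.\<close>

lemma has_integral_pw_const:
  fixes u :: "nat \<Rightarrow> 'a::euclidean_space"
  assumes "n > 0"
  shows "(pw_const n u has_integral (1 / real n) *\<^sub>R (\<Sum>i<j. u i)) {0..real j / real n}"
proof (induction j)
  case (Suc j)
  let ?a = "real j / real n" and ?b = "real (Suc j) / real n"
  have "((\<lambda>_. u j) has_integral (?b - ?a) *\<^sub>R u j) {?a..?b}"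
    using has_integral_const_real[of "u j" ?a ?b] assms by (simp add: divide_right_mono)
  then have "(pw_const n u has_integral (?b - ?a) *\<^sub>R u j) {?a..?b}"
  \<comment> \<open>At the right end point the step function already has the value of the next
    cell.\<close>
  proof (rule has_integral_spike_finite[rotated 2])
    show "finite {?b}" by simp
    show "pw_const n u t = u j" if "t \<in> {?a..?b} - {?b}" for t
      using that assms by (intro pw_const_eq) auto
  qed
  moreover have "?b - ?a = 1 / real n"
    by (simp add: diff_divide_distrib[symmetric])
  ultimately have "(pw_const n u has_integral (1 / real n) *\<^sub>R u j) {?a..?b}"
    by simp
  then have "(pw_const n u has_integral (1 / real n) *\<^sub>R (\<Sum>i<j. u i) + (1 / real n) *\<^sub>R u j) {0..?b}"
    using Suc by (intro has_integral_combine[of 0 ?a ?b]) (auto simp: divide_right_mono)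
  then show ?case
    by (simp add: scaleR_add_right)
qed (use has_integral_refl(2)[of "pw_const n u" 0] in simp)

lemma has_integral_pw_const_unit:
  fixes u :: "nat \<Rightarrow> 'a::euclidean_space"
  assumes "n > 0"
  shows "(pw_const n u has_integral (1 / real n) *\<^sub>R (\<Sum>i<n. u i)) {0..1}"
  using has_integral_pw_const[OF assms, of u n] assms by simp

lemma absolutely_integrable_pw_const:
  fixes u :: "nat \<Rightarrow> 'a::euclidean_space"
  assumes "n > 0"
  shows "pw_const n u absolutely_integrable_on {0..1}"
proof (rule absolutely_integrable_onI)
  show "pw_const n u integrable_on {0..1}"
    using has_integral_pw_const_unit[OF assms] by blast
  show "(\<lambda>t. norm (pw_const n u t)) integrable_on {0..1}"
    using has_integral_pw_const_unit[OF assms, of "\<lambda>i. norm (u i)"]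
    unfolding pw_const_comp[of norm] by blast
qed

lemma integrable_pw_const:
  fixes u :: "nat \<Rightarrow> 'a::euclidean_space"
  assumes "n > 0"
  shows "integrable (lebesgue_on {0..1}) (pw_const n u)"
  using absolutely_integrable_pw_const[OF assms] by (rule absolutely_integrable_imp_integrable) simp

lemma measurable_pw_const:
  fixes u :: "nat \<Rightarrow> 'a::euclidean_space"
  assumes "n > 0"
  shows "pw_const n u \<in> borel_measurable (lebesgue_on {0..1})"
  using integrable_pw_const[OF assms] by (rule borel_measurable_integrable)

lemma integral_pw_const:
  fixes u :: "nat \<Rightarrow> 'a::euclidean_space"
  assumes "n > 0"
  shows "integral\<^sup>L (lebesgue_on {0..1}) (pw_const n u) = (1 / real n) *\<^sub>R (\<Sum>i<n. u i)"
  using has_integral_integral_lebesgue_on[OF integrable_pw_const[OF assms, of u]]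
    has_integral_pw_const_unit[OF assms, of u] by (simp add: has_integral_unique)

text \<open>A coarse cell \<open>j\<close> consists of the \<open>M\<close> fine cells
  \<open>i\<close> with \<open>i div M = j\<close>. This puts two step functions on a common
  grid.\<close>

lemma pw_const_refine:
  assumes "M > 0" "t \<ge> 0"
  shows "pw_const n u t = pw_const (n * M) (\<lambda>i. u (i div M)) t"
proof -
  have "\<lfloor>real n * t\<rfloor> = \<lfloor>real (n * M) * t / real_of_int (int M)\<rfloor>"
    using assms by simp
  also have "\<dots> = \<lfloor>real (n * M) * t\<rfloor> div int M"
    by (rule floor_divide_real_eq_div) simp
  finally have "\<lfloor>real n * t\<rfloor> = \<lfloor>real (n * M) * t\<rfloor> div int M" .
  then have "nat \<lfloor>real n * t\<rfloor> = nat \<lfloor>real (n * M) * t\<rfloor> div M"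
    using assms by (simp add: nat_div_distrib)
  then show ?thesis
    by (simp add: pw_const_def)
qed

text \<open>Compactness for sequences that need not be continuous but become equicontinuous in the
  limit, such as step functions on finer and finer grids.\<close>

lemma asymptotically_equicontinuous_subseq:
  fixes f :: "nat \<Rightarrow> real \<Rightarrow> 'a::euclidean_space"
  assumes bounded: "\<And>k t. t \<in> {0..1} \<Longrightarrow> norm (f k t) \<le> B"
    and equi: "\<And>e. e > 0 \<Longrightarrow> \<exists>\<delta>>0. \<exists>k0. \<forall>k\<ge>k0. \<forall>s\<in>{0..1}. \<forall>t\<in>{0..1}.
        \<bar>s - t\<bar> < \<delta> \<longrightarrow> norm (f k s - f k t) < e"
  obtains q g where "strict_mono q" "continuous_on {0..1} g"
    "\<And>t. t \<in> {0..1} \<Longrightarrow> (\<lambda>k. f (q k) t) \<longlonglongrightarrow> g t"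
proof -
  \<comment> \<open>Diagonal selection works on a countable set; the rationals are dense, and
    equicontinuity carries the convergence from them to every \<open>t\<close>.\<close>
  obtain q where q: "strict_mono (q :: nat \<Rightarrow> nat)"
    and conv: "\<And>t. t \<in> {0..1} \<inter> \<rat> \<Longrightarrow> \<exists>l. (\<lambda>k. f (q k) t) \<longlonglongrightarrow> l"
    by (rule function_convergent_subsequence[of "{0..1} \<inter> \<rat>" f B])
      (use bounded countable_rat in auto)
  have q_ge: "k \<le> q k" for k
    using q by (simp add: seq_suble)
  have "convergent (\<lambda>k. f (q k) t)" if t: "t \<in> {0..1}" for t
  proof -
    have "Cauchy (\<lambda>k. f (q k) t)"
    proof (rule metric_CauchyI)
      fix e :: real assume "e > 0"
      then have "e / 3 > 0" by simp
      then obtain \<delta> k0 where \<delta>: "\<delta> > 0" and k0: "\<And>k s t. k \<ge> k0 \<Longrightarrow> s \<in> {0..1} \<Longrightarrow> t \<in> {0..1}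
          \<Longrightarrow> \<bar>s - t\<bar> < \<delta> \<Longrightarrow> norm (f k s - f k t) < e / 3"
        using equi[of "e / 3"] by blast
      have "\<exists>p\<in>{0..1} \<inter> \<rat>. \<bar>p - t\<bar> < \<delta>"
      proof (cases "t = 0")
        case False
        then have "max 0 (t - \<delta>) < t" using \<delta> t by auto
        then obtain p where "p \<in> \<rat>" "max 0 (t - \<delta>) < p" "p < t"
          using Rats_dense_in_real by blast
        then show ?thesis using t by (intro bexI[of _ p]) auto
      qed (use \<delta> in \<open>auto intro!: bexI[of _ 0]\<close>)
      then obtain p where p: "p \<in> {0..1}" "p \<in> \<rat>" "\<bar>p - t\<bar> < \<delta>"
        by blast
      have "Cauchy (\<lambda>k. f (q k) p)"
        using conv[of p] p by (auto intro: LIMSEQ_imp_Cauchy)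
      then obtain M where M: "\<And>i j. i \<ge> M \<Longrightarrow> j \<ge> M \<Longrightarrow> dist (f (q i) p) (f (q j) p) < e / 3"
        using \<open>e > 0\<close> unfolding Cauchy_def by (metis divide_pos_pos zero_less_numeral)
      show "\<exists>M. \<forall>i\<ge>M. \<forall>j\<ge>M. dist (f (q i) t) (f (q j) t) < e"
      proof (intro exI allI impI)
        fix i j assume ij: "i \<ge> max M k0" "j \<ge> max M k0"
        have "norm (f (q i) p - f (q i) t) < e / 3" "norm (f (q j) p - f (q j) t) < e / 3"
          using k0[of "q i" p t] k0[of "q j" p t] ij q_ge[of i] q_ge[of j] p t by auto
        moreover have "norm (f (q i) p - f (q j) p) < e / 3"
          using M[of i j] ij by (simp add: dist_norm)
        ultimately show "dist (f (q i) t) (f (q j) t) < e"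
          by norm
      qed
    qed
    then show ?thesis
      by (simp add: Cauchy_convergent_iff)
  qed
  then obtain g where g: "\<And>t. t \<in> {0..1} \<Longrightarrow> (\<lambda>k. f (q k) t) \<longlonglongrightarrow> g t"
    unfolding convergent_def by metis
  have "continuous_on {0..1} g"
  proof (rule continuous_onI)
    fix t e :: real assume t: "t \<in> {0..1}" and "e > 0"
    then obtain \<delta> k0 where \<delta>: "\<delta> > 0" and k0: "\<And>k s t. k \<ge> k0 \<Longrightarrow> s \<in> {0..1} \<Longrightarrow> t \<in> {0..1}
        \<Longrightarrow> \<bar>s - t\<bar> < \<delta> \<Longrightarrow> norm (f k s - f k t) < e"
      using equi[of e] by blast
    have "dist (g s) (g t) \<le> e" if s: "s \<in> {0..1}" "dist s t < \<delta>" for s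
    proof -
      have "(\<lambda>k. norm (f (q k) s - f (q k) t)) \<longlonglongrightarrow> norm (g s - g t)"
        using g s t by (intro tendsto_intros) auto
      moreover have "norm (f (q k) s - f (q k) t) \<le> e" if "k \<ge> k0" for k
        using k0[of "q k" s t] q_ge[of k] that s t by (simp add: dist_real_def)
      ultimately show ?thesis
        unfolding dist_norm by (intro LIMSEQ_le_const2) auto
    qed
    then show "\<exists>d>0. \<forall>s\<in>{0..1}. dist s t < d \<longrightarrow> dist (g s) (g t) \<le> e"
      using \<delta> by blast
  qed
  with q g show thesis
    using that by blast
qed

section \<open>Square-integrable functions and weak derivatives\<close>

lemma L2_measurable: "f \<in> L2 \<Longrightarrow> f \<in> borel_measurable (lebesgue_on {0..1})"
  by (simp add: L2_def)

lemma L2_absolutely_integrable: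
  assumes "f \<in> L2"
  shows "f absolutely_integrable_on {0..1}"
proof (rule measurable_bounded_by_integrable_imp_absolutely_integrable)
  show "(\<lambda>t. 1 + (norm (f t))\<^sup>2) integrable_on {0..1}"
    using assms by (intro integrable_add integrable_on_lebesgue_on) (auto simp: L2_def)
  show "norm (f t) \<le> 1 + (norm (f t))\<^sup>2" for t
    using zero_le_power2[of "norm (f t) - 1"] norm_ge_zero[of "f t"]
    unfolding power2_diff by (simp del: norm_ge_zero)
qed (use assms in \<open>auto simp: L2_def\<close>)

lemma absolutely_integrable_is_norm_square:
  assumes "f \<in> L2" "is_norm N"
  shows "(\<lambda>t. (N (f t))\<^sup>2) absolutely_integrable_on {0..1}"
proof -
  obtain C where C: "C > 0" "\<And>x. N x \<le> C * norm x"
    using is_norm_le_norm[OF assms(2)] by blast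
  have [measurable]: "N \<in> borel_measurable borel"
    by (intro borel_measurable_continuous_onI continuous_on_is_norm assms)
  have [measurable]: "f \<in> borel_measurable (lebesgue_on {0..1})"
    using assms(1) by (rule L2_measurable)
  show ?thesis
  proof (rule measurable_bounded_by_integrable_imp_absolutely_integrable)
    show "(\<lambda>t. C\<^sup>2 * (norm (f t))\<^sup>2) integrable_on {0..1}"
      using assms by (intro integrable_on_lebesgue_on) (auto simp: L2_def)
    show "norm ((N (f t))\<^sup>2) \<le> C\<^sup>2 * (norm (f t))\<^sup>2" for t
      using C(2)[of "f t"] is_norm_nonneg[OF assms(2), of "f t"]
      by (simp add: power_mult_distrib[symmetric] power_mono)
  qed auto
qed

lemma absolutely_integrable_is_norm:
  assumes "f \<in> L2" "is_norm N"
  shows "(\<lambda>t. N (f t)) absolutely_integrable_on {0..1}"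
proof -
  obtain C where C: "C > 0" "\<And>x. N x \<le> C * norm x"
    using is_norm_le_norm[OF assms(2)] by blast
  have [measurable]: "N \<in> borel_measurable borel"
    by (intro borel_measurable_continuous_onI continuous_on_is_norm assms)
  have [measurable]: "f \<in> borel_measurable (lebesgue_on {0..1})"
    using assms(1) by (rule L2_measurable)
  show ?thesis
  proof (rule measurable_bounded_by_integrable_imp_absolutely_integrable)
    show "(\<lambda>t. C * norm (f t)) integrable_on {0..1}"
      using L2_absolutely_integrable[OF assms(1)]
      by (intro integrable_on_mult_right) (simp add: absolutely_integrable_on_def)
    show "norm (N (f t)) \<le> C * norm (f t)" for t
      using C(2)[of "f t"] is_norm_nonneg[OF assms(2), of "f t"] by simp
  qed auto
qed

text \<open>The bridge from the Bochner integral of the definitions to the gauge integral in which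
  the estimates are made.\<close>

lemma L2_norm_square:
  assumes "f \<in> L2" "is_norm N"
  shows "(L2_norm N f)\<^sup>2 = integral {0..1} (\<lambda>t. (N (f t))\<^sup>2)"
proof -
  have "integrable (lebesgue_on {0..1}) (\<lambda>t. (N (f t))\<^sup>2)"
    by (rule absolutely_integrable_imp_integrable[OF absolutely_integrable_is_norm_square[OF assms]]) simp
  then have "integral\<^sup>L (lebesgue_on {0..1}) (\<lambda>t. (N (f t))\<^sup>2) = integral {0..1} (\<lambda>t. (N (f t))\<^sup>2)"
    by (simp add: lebesgue_integral_eq_integral)
  then show ?thesis
    unfolding L2_norm_def by (metis integral_nonneg_AE AE_I2 real_sqrt_pow2 zero_le_power2)
qed

section \<open>Primitives as the working form of weak derivatives\<close>

definition is_primitive :: "(real \<Rightarrow> 'a::euclidean_space) \<Rightarrow> (real \<Rightarrow> 'a) \<Rightarrow> bool" where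
  "is_primitive u g \<longleftrightarrow> (\<forall>s t. 0 \<le> s \<longrightarrow> s \<le> t \<longrightarrow> t \<le> 1 \<longrightarrow> u t - u s = integral {s..t} g)"

lemma is_primitiveD: "is_primitive u g \<Longrightarrow> 0 \<le> s \<Longrightarrow> s \<le> t \<Longrightarrow> t \<le> 1 \<Longrightarrow> u t - u s = integral {s..t} g"
  by (simp add: is_primitive_def)

lemma integral_eq_diff:
  fixes g :: "real \<Rightarrow> 'a::euclidean_space"
  assumes "g integrable_on {0..1}" "0 \<le> s" "s \<le> t" "t \<le> 1"
  shows "integral {s..t} g = integral {0..t} g - integral {0..s} g"
  using Henstock_Kurzweil_Integration.integral_combine[of 0 s t g] integrable_on_subinterval[OF assms(1), of 0 t] assms
  by (auto simp: algebra_simps)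

lemma is_primitiveI:
  assumes "g integrable_on {0..1}" "\<And>t. 0 \<le> t \<Longrightarrow> t \<le> 1 \<Longrightarrow> u t = u 0 + integral {0..t} g"
  shows "is_primitive u g"
  unfolding is_primitive_def
proof (intro allI impI)
  fix s t :: real assume "0 \<le> s" "s \<le> t" "t \<le> 1"
  then show "u t - u s = integral {s..t} g"
    using assms(2)[of s] assms(2)[of t] integral_eq_diff[OF assms(1), of s t] by simp
qed

text \<open>Squaring removes the kink of the positive part. Combinations of shifted copies give
  explicit cutoffs that are exactly \<open>C^1\<close>, the class of test functions of
  \<open>is_weak_deriv\<close>.\<close>

lemma has_real_derivative_max_0_square:
  "((\<lambda>x. (max 0 x)\<^sup>2) has_real_derivative 2 * max 0 x) (at (x::real))"
proof (cases x "0 :: real" rule: linorder_cases)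
  case less
  have "((\<lambda>x::real. 0) has_real_derivative 0) (at x)" by simp
  then have "((\<lambda>x. (max 0 x)\<^sup>2) has_real_derivative 0) (at x)"
    by (rule has_field_derivative_transform_within_open[of _ _ _ "{..<0}"]) (use less in auto)
  then show ?thesis using less by simp
next
  case greater
  have "((\<lambda>x::real. x\<^sup>2) has_real_derivative 2 * x) (at x)"
    by (auto intro!: derivative_eq_intros)
  then have "((\<lambda>x. (max 0 x)\<^sup>2) has_real_derivative 2 * x) (at x)"
    by (rule has_field_derivative_transform_within_open[of _ _ _ "{0<..}"]) (use greater in auto)
  then show ?thesis using greater by simp
next
  case equal
  have "((\<lambda>h. (max 0 h)\<^sup>2 / h) \<longlongrightarrow> (0::real)) (at 0)"
  proof (rule Lim_null_comparison)
    have "\<bar>(max 0 h)\<^sup>2 / h\<bar> \<le> \<bar>h\<bar>" for h :: real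
      by (cases "h > 0") (auto simp: max_def power2_eq_square)
    then show "\<forall>\<^sub>F h in at 0. norm ((max 0 h)\<^sup>2 / h) \<le> \<bar>h :: real\<bar>"
      by (intro always_eventually) simp
    show "((\<lambda>h :: real. \<bar>h\<bar>) \<longlongrightarrow> 0) (at 0)"
      using tendsto_rabs[OF tendsto_ident_at[of "0::real" UNIV]] by simp
  qed
  then show ?thesis
    using equal by (simp add: DERIV_def)
qed

text \<open>A \<open>C\<^sup>1\<close> approximation of the Heaviside function, whose derivative is a tent on \<open>[0,1]\<close>.\<close>

definition smooth_step :: "real \<Rightarrow> real" where
  "smooth_step x = 2 * ((max 0 x)\<^sup>2 - 2 * (max 0 (x - 1/2))\<^sup>2 + (max 0 (x - 1))\<^sup>2)"

definition tent :: "real \<Rightarrow> real" where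
  "tent x = 4 * (max 0 x - 2 * max 0 (x - 1/2) + max 0 (x - 1))"

lemma smooth_step_eq_0: "x \<le> 0 \<Longrightarrow> smooth_step x = 0"
  by (simp add: smooth_step_def)

lemma smooth_step_eq_1: "1 \<le> x \<Longrightarrow> smooth_step x = 1"
  by (simp add: smooth_step_def power2_eq_square algebra_simps)

lemma tent_nonneg: "0 \<le> tent x"
  by (auto simp: tent_def max_def)

lemma tent_eq_0: "x \<le> 0 \<or> 1 \<le> x \<Longrightarrow> tent x = 0"
  by (auto simp: tent_def max_def)

lemma has_real_derivative_smooth_step: "(smooth_step has_real_derivative tent x) (at x)"
proof -
  have shift: "((\<lambda>x. (max 0 (x - c))\<^sup>2) has_real_derivative 2 * max 0 (x - c)) (at x)" for c :: real
  proof -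
    have "((\<lambda>x. x - c) has_real_derivative 1) (at x)"
      by (auto intro!: derivative_eq_intros)
    from DERIV_chain2[OF has_real_derivative_max_0_square this] show ?thesis
      by simp
  qed
  show ?thesis
    unfolding smooth_step_def[abs_def] tent_def
    by (rule derivative_eq_intros shift shift[of 0, simplified] refl | simp)+
qed

lemma smooth_step_bounds: "0 \<le> smooth_step x" "smooth_step x \<le> 1"
proof -
  have mono: "smooth_step a \<le> smooth_step b" if "a \<le> b" for a b
    by (rule DERIV_nonneg_imp_nondecreasing[OF that])
      (use has_real_derivative_smooth_step tent_nonneg in blast)
  show "0 \<le> smooth_step x"
    using mono[of "min 0 x" x] smooth_step_eq_0[of "min 0 x"] by simp
  show "smooth_step x \<le> 1"
    using mono[of x "max 1 x"] smooth_step_eq_1[of "max 1 x"] by simp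
qed

lemma continuous_on_tent: "continuous_on A tent"
  unfolding tent_def[abs_def] by (intro continuous_intros)

lemma has_real_derivative_smooth_step_scaled:
  "((\<lambda>r. smooth_step (c * (r - s))) has_real_derivative c * tent (c * (r - s))) (at r within A)"
proof -
  have "((\<lambda>r. c * (r - s)) has_real_derivative c) (at r within A)"
    by (auto intro!: derivative_eq_intros)
  from DERIV_chain2[OF has_real_derivative_smooth_step this] show ?thesis
    by (simp add: mult.commute)
qed

text \<open>An approximate identity supported to the right of \<open>s\<close>, in
  \<open>{s..s + 1/n}\<close>. It is the derivative of \<open>smooth_step (n * (r - s))\<close>, so
  its mass is an increment of that function and equals 1 as soon as the support fits into the unit
  interval; this is where \<open>s < 1\<close> enters.\<close>

lemma tent_kernel_limit:
  fixes u :: "real \<Rightarrow> 'a::euclidean_space"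
  assumes u: "continuous_on {0..1} u" and s: "0 \<le> s" "s < 1"
  shows "(\<lambda>n. integral {0..1} (\<lambda>r. (real n * tent (real n * (r - s))) *\<^sub>R u r)) \<longlonglongrightarrow> u s"
proof (rule LIMSEQ_I)
  fix e :: real assume "e > 0"
  then obtain \<delta> where \<delta>: "\<delta> > 0" "\<And>r. r \<in> {0..1} \<Longrightarrow> \<bar>r - s\<bar> < \<delta> \<Longrightarrow> norm (u r - u s) < e / 2"
    using u s unfolding continuous_on_iff dist_norm
    by (metis atLeastAtMost_iff half_gt_zero less_eq_real_def real_norm_def)
  \<comment> \<open>Two demands on \<open>1/n\<close>: below \<open>\<delta>\<close> the kernel sees
    only values of \<open>u\<close> close to \<open>u s\<close>, and below \<open>1 - s\<close> it
    has full mass in the unit interval.\<close>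
  obtain m where "inverse (real (Suc m)) < min \<delta> (1 - s)"
    using reals_Archimedean[of "min \<delta> (1 - s)"] \<delta>(1) s by auto
  then obtain n0 :: nat where n0: "n0 > 0" "1 / real n0 < min \<delta> (1 - s)"
    by (metis inverse_eq_divide zero_less_Suc)
  show "\<exists>n0. \<forall>n\<ge>n0. norm (integral {0..1} (\<lambda>r. (real n * tent (real n * (r - s))) *\<^sub>R u r) - u s) < e"
  proof (intro exI allI impI)
    fix n assume n: "n \<ge> n0"
    then have "n > 0" using n0 by simp
    have "1 / real n \<le> 1 / real n0"
      using n n0 by (simp add: frac_le)
    then have n': "1 / real n < \<delta>" "1 / real n < 1 - s"
      using n0(2) by auto
    let ?k = "\<lambda>r. real n * tent (real n * (r - s))"
    have cont: "continuous_on {0..1} ?k"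
      by (intro continuous_intros continuous_on_compose2[OF continuous_on_tent[of UNIV]]) auto
    have "(?k has_integral smooth_step (real n * (1 - s)) - smooth_step (real n * (0 - s))) {0..1}"
      by (rule fundamental_theorem_of_calculus)
        (auto simp flip: has_real_derivative_iff_has_vector_derivative
          intro: has_real_derivative_smooth_step_scaled)
    moreover have "smooth_step (real n * (1 - s)) = 1" "smooth_step (real n * (0 - s)) = 0"
      using n' \<open>n > 0\<close> s by (auto intro!: smooth_step_eq_1 smooth_step_eq_0 simp: field_simps)
    ultimately have k1: "(?k has_integral 1) {0..1}"
      by simp
    have "((\<lambda>r. ?k r *\<^sub>R u r) has_integral integral {0..1} (\<lambda>r. ?k r *\<^sub>R u r)) {0..1}"
      by (intro integrable_integral integrable_continuous_real continuous_intros cont u)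
    moreover have "((\<lambda>r. ?k r *\<^sub>R u s) has_integral u s) {0..1}"
      using has_integral_scaleR_left[OF k1, of "u s"] by simp
    ultimately have d: "((\<lambda>r. ?k r *\<^sub>R u r - ?k r *\<^sub>R u s) has_integral
        (integral {0..1} (\<lambda>r. ?k r *\<^sub>R u r) - u s)) {0..1}"
      by (rule has_integral_diff)
    have "norm (?k r *\<^sub>R u r - ?k r *\<^sub>R u s) \<le> ?k r * (e / 2)" if "r \<in> {0..1}" for r
    proof (cases "0 < real n * (r - s) \<and> real n * (r - s) < 1")
      case True
      then have "\<bar>r - s\<bar> < 1 / real n"
        using \<open>n > 0\<close> by (auto simp: field_simps zero_less_mult_iff)
      then have "norm (u r - u s) \<le> e / 2"
        using \<delta>(2)[OF that] n' by simp
      then show ?thesis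
        using tent_nonneg \<open>n > 0\<close>
        by (auto simp: scaleR_diff_right[symmetric] abs_mult intro!: mult_left_mono)
    next
      case False
      then have "?k r = 0"
        using tent_eq_0[of "real n * (r - s)"] by auto
      then show ?thesis unfolding \<open>?k r = 0\<close> by simp
    qed
    then have "norm (integral {0..1} (\<lambda>r. ?k r *\<^sub>R u r - ?k r *\<^sub>R u s)) \<le> integral {0..1} (\<lambda>r. ?k r * (e / 2))"
      using d has_integral_mult_left[OF k1, of "e / 2"] by (intro integral_norm_bound_integral) auto
    then have "norm (integral {0..1} (\<lambda>r. ?k r *\<^sub>R u r) - u s) \<le> 1 * (e / 2)"
      unfolding integral_unique[OF d] integral_unique[OF has_integral_mult_left[OF k1, of "e / 2"]] .
    then show "norm (integral {0..1} (\<lambda>r. ?k r *\<^sub>R u r) - u s) < e"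
      using \<open>e > 0\<close> by simp
  qed
qed

lemma absolutely_integrable_continuous_scaleR:
  fixes \<phi> :: "real \<Rightarrow> real" and g :: "real \<Rightarrow> 'a::euclidean_space"
  assumes "continuous_on {0..1} \<phi>" "g absolutely_integrable_on {0..1}"
  shows "(\<lambda>r. \<phi> r *\<^sub>R g r) absolutely_integrable_on {0..1}"
proof (rule absolutely_integrable_bounded_measurable_product[where h = scaleR])
  show "bilinear (scaleR :: real \<Rightarrow> 'a \<Rightarrow> 'a)"
    using bilinear_conv_bounded_bilinear bounded_bilinear_scaleR by blast
  show "\<phi> \<in> borel_measurable (lebesgue_on {0..1})"
    by (intro continuous_imp_measurable_on_sets_lebesgue assms) simp
  show "bounded (\<phi> ` {0..1})"
    by (intro compact_imp_bounded compact_continuous_image assms) simp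
qed (use assms in auto)

text \<open>The test functions are \<open>C^1\<close> approximations of the indicator of
  \<open>{s<..t}\<close>, namely differences of two smooth steps. Their derivatives are differences
  of tent kernels, so one side of the weak formulation tends to \<open>u s - u t\<close>, while the
  other tends by dominated convergence to minus the integral of \<open>g\<close> over
  \<open>{s..t}\<close>.\<close>

lemma weak_deriv_imp_is_primitive:
  fixes u :: "real \<Rightarrow> 'a::euclidean_space"
  assumes u: "continuous_on {0..1} u" and g: "g absolutely_integrable_on {0..1}"
    and weak: "is_weak_deriv u g"
  shows "is_primitive u g"
proof -
  have gi: "g integrable_on {0..1}" "(\<lambda>r. norm (g r)) integrable_on {0..1}"
    using g by (simp_all add: absolutely_integrable_on_def)
  have inner: "u t - u s = integral {s..t} g" if st: "0 < s" "s < t" "t < 1" for s t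
  proof -
    define \<phi> where "\<phi> = (\<lambda>n r. smooth_step (real n * (r - s)) - smooth_step (real n * (r - t)))"
    define \<phi>' where
      "\<phi>' = (\<lambda>n r. real n * tent (real n * (r - s)) - real n * tent (real n * (r - t)))"
    have c\<phi>': "continuous_on A (\<phi>' n)" for n A
      unfolding \<phi>'_def
      by (intro continuous_intros continuous_on_compose2[OF continuous_on_tent[of UNIV]]) auto
    have d\<phi>: "(\<phi> n has_real_derivative \<phi>' n r) (at r)" for n r
      unfolding \<phi>_def \<phi>'_def by (intro DERIV_diff has_real_derivative_smooth_step_scaled)
    have c\<phi>: "continuous_on A (\<phi> n)" for n A
      using d\<phi> by (intro DERIV_continuous_on) (blast intro: has_field_derivative_at_within)
    have b\<phi>: "\<bar>\<phi> n r\<bar> \<le> 1" for n r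
      using smooth_step_bounds[of "real n * (r - s)"] smooth_step_bounds[of "real n * (r - t)"]
      unfolding \<phi>_def by (simp add: abs_le_iff)
    have \<phi>g: "(\<lambda>r. \<phi> n r *\<^sub>R g r) absolutely_integrable_on {0..1}" for n
      by (intro absolutely_integrable_continuous_scaleR c\<phi> g)
    \<comment> \<open>The support of the test function lies in \<open>{s..t + 1/n}\<close> and is
      inside the open unit interval only for large \<open>n\<close>.\<close>
    have ev: "\<forall>\<^sub>F n in sequentially. integral {0..1} (\<lambda>r. \<phi>' n r *\<^sub>R u r) =
        - integral {0..1} (\<lambda>r. \<phi> n r *\<^sub>R g r)"
    proof -
      obtain m where m: "inverse (real (Suc m)) < 1 - t"
        using reals_Archimedean[of "1 - t"] st by auto
      have "integral {0..1} (\<lambda>r. \<phi>' n r *\<^sub>R u r) = - integral {0..1} (\<lambda>r. \<phi> n r *\<^sub>R g r)"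
        if n: "n \<ge> Suc m" for n
      proof -
        have "inverse (real n) \<le> inverse (real (Suc m))"
          using n by (simp add: le_imp_inverse_le)
        then have n1: "t + 1 / real n < 1"
          using m by (simp add: inverse_eq_divide)
        have "{r. \<phi> n r \<noteq> 0} \<subseteq> {s..t + 1 / real n}"
        proof
          fix r assume r: "r \<in> {r. \<phi> n r \<noteq> 0}"
          have "s \<le> r"
          proof (rule ccontr)
            assume "\<not> s \<le> r"
            then have "real n * (r - s) \<le> 0" "real n * (r - t) \<le> 0"
              using st by (auto simp: mult_nonneg_nonpos)
            then show False
              using r by (simp add: \<phi>_def smooth_step_eq_0)
          qed
          moreover have "r \<le> t + 1 / real n"
          proof (rule ccontr)
            assume "\<not> r \<le> t + 1 / real n"
            then have "1 \<le> real n * (r - t)"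
              using n by (simp add: field_simps)
            moreover have "real n * (r - t) \<le> real n * (r - s)"
              using st by (intro mult_left_mono) auto
            ultimately show False
              using r by (simp add: \<phi>_def smooth_step_eq_1)
          qed
          ultimately show "r \<in> {s..t + 1 / real n}" by simp
        qed
        then have "closure {r. \<phi> n r \<noteq> 0} \<subseteq> {s..t + 1 / real n}"
          by (rule closure_minimal) simp
        also have "\<dots> \<subseteq> {0<..<1}"
          using st n1 by auto
        finally have "integral\<^sup>L (lebesgue_on {0..1}) (\<lambda>t. \<phi>' n t *\<^sub>R u t) =
            - integral\<^sup>L (lebesgue_on {0..1}) (\<lambda>t. \<phi> n t *\<^sub>R g t)"
          using weak d\<phi> c\<phi>' unfolding is_weak_deriv_def by blast
        moreover have \<phi>u: "(\<lambda>t. \<phi>' n t *\<^sub>R u t) absolutely_integrable_on {0..1}"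
          by (intro absolutely_integrable_continuous_real continuous_intros c\<phi>' u)
        ultimately show ?thesis
          using absolutely_integrable_imp_integrable[OF \<phi>g[of n]]
            absolutely_integrable_imp_integrable[OF \<phi>u]
          by (simp add: lebesgue_integral_eq_integral)
      qed
      then show ?thesis
        unfolding eventually_sequentially by blast
    qed
    have "(\<lambda>n. integral {0..1} (\<lambda>r. (real n * tent (real n * (r - s))) *\<^sub>R u r) -
        integral {0..1} (\<lambda>r. (real n * tent (real n * (r - t))) *\<^sub>R u r)) \<longlonglongrightarrow> u s - u t"
      using st by (intro tendsto_diff tent_kernel_limit u) auto
    moreover have "integral {0..1} (\<lambda>r. (real n * tent (real n * (r - s))) *\<^sub>R u r) -
        integral {0..1} (\<lambda>r. (real n * tent (real n * (r - t))) *\<^sub>R u r) =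
        integral {0..1} (\<lambda>r. \<phi>' n r *\<^sub>R u r)" for n
      unfolding \<phi>'_def scaleR_diff_left
      by (intro Henstock_Kurzweil_Integration.integral_diff[symmetric] integrable_continuous_real
          continuous_intros continuous_on_compose2[OF continuous_on_tent[of UNIV]] u) auto
    ultimately have "(\<lambda>n. integral {0..1} (\<lambda>r. \<phi>' n r *\<^sub>R u r)) \<longlonglongrightarrow> u s - u t"
      by simp
    then have lim1: "(\<lambda>n. - integral {0..1} (\<lambda>r. \<phi> n r *\<^sub>R g r)) \<longlonglongrightarrow> u s - u t"
      by (rule Lim_transform_eventually[OF _ ev])
    have lim2: "(\<lambda>n. integral {0..1} (\<lambda>r. \<phi> n r *\<^sub>R g r)) \<longlonglongrightarrow>
        integral {0..1} (\<lambda>r. if r \<in> {s<..t} then g r else 0)"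
    proof (rule dominated_convergence(2))
      show "(\<lambda>r. \<phi> n r *\<^sub>R g r) integrable_on {0..1}" for n
        using \<phi>g by (simp add: absolutely_integrable_on_def)
      show "norm (\<phi> n r *\<^sub>R g r) \<le> norm (g r)" for n r
        using b\<phi>[of n r] by (simp add: mult_left_le_one_le)
      show "(\<lambda>n. \<phi> n r *\<^sub>R g r) \<longlonglongrightarrow> (if r \<in> {s<..t} then g r else 0)" for r
      proof -
        \<comment> \<open>At \<open>r = a\<close> all members are \<open>smooth_step 0 = 0\<close>,
          so the limit is the indicator of an interval open on the left; the single point is
          discarded after the limit.\<close>
        have heaviside: "(\<lambda>n. smooth_step (real n * (r - a))) \<longlonglongrightarrow> (if a < r then 1 else 0)" for a
        proof (cases "a < r")
          case True
          obtain m where m: "1 / (r - a) < real m"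
            using reals_Archimedean2 by blast
          have "smooth_step (real n * (r - a)) = 1" if "n \<ge> m" for n
          proof (rule smooth_step_eq_1)
            have "1 < real m * (r - a)"
              using m True by (simp add: field_simps)
            also have "\<dots> \<le> real n * (r - a)"
              using that True by (intro mult_right_mono) auto
            finally show "1 \<le> real n * (r - a)" by simp
          qed
          then have "\<forall>\<^sub>F n in sequentially. smooth_step (real n * (r - a)) = 1"
            unfolding eventually_sequentially by blast
          then show ?thesis
            using True by (simp add: tendsto_eventually)
        next
          case False
          then have "smooth_step (real n * (r - a)) = 0" for n
            by (intro smooth_step_eq_0) (simp add: mult_nonneg_nonpos)
          then show ?thesis using False by simp
        qed
        have "(\<lambda>n. \<phi> n r *\<^sub>R g r) \<longlonglongrightarrow> ((if s < r then 1 else 0) - (if t < r then 1 else 0)) *\<^sub>R g r"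
          unfolding \<phi>_def by (intro tendsto_intros heaviside)
        then show ?thesis
          using st by (auto split: if_splits)
      qed
    qed (use gi in auto)
    have "integral {0..1} (\<lambda>r. if r \<in> {s<..t} then g r else 0) =
        integral {0..1} (\<lambda>r. if r \<in> {s..t} then g r else 0)"
      by (rule integral_spike[of "{s}"]) auto
    also have "\<dots> = integral {s..t} g"
      using st integral_restrict_Int[of "{0..1}" "{s..t}" g] by (simp add: Int_absorb1)
    finally have "(\<lambda>n. - integral {0..1} (\<lambda>r. \<phi> n r *\<^sub>R g r)) \<longlonglongrightarrow> - integral {s..t} g"
      using tendsto_minus[OF lim2] by simp
    from LIMSEQ_unique[OF lim1 this] show ?thesis
      by (metis minus_diff_eq neg_equal_iff_equal)
  qed
  define F where "F = (\<lambda>t. u t - integral {0..t} g)"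
  have cF: "continuous_on {0..1} F"
    unfolding F_def by (intro continuous_intros u indefinite_integral_continuous_1 gi)
  have F12: "F t = F (1/2)" if "t \<in> {0<..<1}" for t
  proof (cases t "1/2 :: real" rule: linorder_cases)
    case less
    then show ?thesis
      using inner[of t "1/2"] integral_eq_diff[OF gi(1), of t "1/2"] that
      by (simp add: F_def algebra_simps)
  next
    case greater
    then show ?thesis
      using inner[of "1/2" t] integral_eq_diff[OF gi(1), of "1/2" t] that
      by (simp add: F_def algebra_simps)
  next
    case equal
    then show ?thesis by (rule arg_cong)
  qed
  \<comment> \<open>Compactly supported tests reach only interior points; continuity of
    \<open>F\<close> extends the identity to 0 and 1.\<close>
  have F: "F t = F (1/2)" if "t \<in> {0..1}" for t
  proof (rule continuous_constant_on_closure[OF _ F12])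
    show "continuous_on (closure {0<..<1}) F" "t \<in> closure {0<..<1}"
      using cF that by simp_all
  qed
  show ?thesis
  proof (rule is_primitiveI[OF gi(1)])
    fix t :: real assume "0 \<le> t" "t \<le> 1"
    then have "F t = F 0"
      using F[of t] F[of 0] by simp
    then show "u t = u 0 + integral {0..t} g"
      by (simp add: F_def algebra_simps)
  qed
qed

lemma is_primitive_continuous_on:
  assumes "g integrable_on {0..1}" "is_primitive u g"
  shows "continuous_on {0..1} u"
proof -
  have "continuous_on {0..1} (\<lambda>t. u 0 + integral {0..t} g)"
    by (intro continuous_intros indefinite_integral_continuous_1 assms)
  moreover have "u t = u 0 + integral {0..t} g" if "t \<in> {0..1}" for t
    using is_primitiveD[OF assms(2), of 0 t] that by (simp add: algebra_simps)
  ultimately show ?thesis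
    using continuous_on_cong[of "{0..1}" "{0..1}" u] by metis
qed

text \<open>With \<open>G t = \<integral>\<^sub>0\<^sup>t \<bar>g\<bar>\<close>, the increments of \<open>\<phi> u - \<integral> (\<phi>' u + \<phi> g)\<close> over \<open>[s,t]\<close> are bounded by
  \<open>2 C (t - s) (G t - G s)\<close>, so this function has derivative zero.\<close>

lemma is_primitive_imp_weak_deriv:
  fixes u :: "real \<Rightarrow> 'a::euclidean_space"
  assumes g: "g absolutely_integrable_on {0..1}" and prim: "is_primitive u g"
  shows "is_weak_deriv u g"
  unfolding is_weak_deriv_def
proof (intro allI impI)
  fix \<phi> \<phi>' :: "real \<Rightarrow> real"
  assume *: "(\<forall>t. (\<phi> has_real_derivative \<phi>' t) (at t)) \<and> continuous_on UNIV \<phi>' \<and>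
    closure {t. \<phi> t \<noteq> 0} \<subseteq> {0<..<1}"
  have d\<phi>: "(\<phi> has_real_derivative \<phi>' t) (at t)" for t
    using * by blast
  have c\<phi>': "continuous_on A \<phi>'" for A
    using * continuous_on_subset[OF _ subset_UNIV] by blast
  have c\<phi>: "continuous_on A \<phi>" for A
    using d\<phi> by (intro DERIV_continuous_on) (blast intro: has_field_derivative_at_within)
  have "{t. \<phi> t \<noteq> 0} \<subseteq> {0<..<1}"
    using * closure_subset[of "{t. \<phi> t \<noteq> 0}"] by (metis order_trans)
  then have \<phi>01: "\<phi> 0 = 0" "\<phi> 1 = 0"
    by auto
  have gi: "g integrable_on {0..1}" "(\<lambda>r. norm (g r)) integrable_on {0..1}"
    using g by (simp_all add: absolutely_integrable_on_def)
  have cu: "continuous_on {0..1} u"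
    using is_primitive_continuous_on[OF gi(1) prim] .
  have \<phi>g: "(\<lambda>r. \<phi> r *\<^sub>R g r) absolutely_integrable_on {0..1}"
    by (intro absolutely_integrable_continuous_scaleR c\<phi> g)
  have \<phi>u: "(\<lambda>r. \<phi>' r *\<^sub>R u r) absolutely_integrable_on {0..1}"
    by (intro absolutely_integrable_continuous_real continuous_intros c\<phi>' cu)
  have ints: "(\<lambda>r. \<phi>' r *\<^sub>R u r + \<phi> r *\<^sub>R g r) integrable_on {0..1}"
    using \<phi>g \<phi>u by (intro integrable_add) (auto simp: absolutely_integrable_on_def)
  define F where "F = (\<lambda>t. \<phi> t *\<^sub>R u t - integral {0..t} (\<lambda>r. \<phi>' r *\<^sub>R u r + \<phi> r *\<^sub>R g r))"
  define G where "G = (\<lambda>t. integral {0..t} (\<lambda>r. norm (g r)))"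
  have "bounded (\<phi>' ` {0..1})"
    by (intro compact_imp_bounded compact_continuous_image c\<phi>') simp
  then obtain C where C: "C > 0" "\<And>r. r \<in> {0..1} \<Longrightarrow> \<bar>\<phi>' r\<bar> \<le> C"
    by (auto simp: bounded_pos)
  have inc: "norm (F t - F s) \<le> 2 * C * (t - s) * (G t - G s)" if st: "0 \<le> s" "s \<le> t" "t \<le> 1" for s t
  proof -
    have sub: "{s..t} \<subseteq> {0..1}" using st by auto
    have gst: "(g has_integral integral {s..t} g) {s..t}"
      using integrable_on_subinterval[OF gi(1) sub] by (rule integrable_integral)
    have G: "((\<lambda>r. norm (g r)) has_integral (G t - G s)) {s..t}"
      using integrable_integral[OF integrable_on_subinterval[OF gi(2) sub]] integral_eq_diff[OF gi(2) st]
      by (simp add: G_def)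
    have \<phi>st: "(\<phi>' has_integral \<phi> t - \<phi> s) {s..t}"
      using st by (intro fundamental_theorem_of_calculus)
        (auto simp flip: has_real_derivative_iff_has_vector_derivative
          intro: has_field_derivative_at_within d\<phi>)
    have ist: "((\<lambda>r. \<phi>' r *\<^sub>R u r + \<phi> r *\<^sub>R g r) has_integral
        integral {s..t} (\<lambda>r. \<phi>' r *\<^sub>R u r + \<phi> r *\<^sub>R g r)) {s..t}"
      using integrable_on_subinterval[OF ints sub] by (rule integrable_integral)
    \<comment> \<open>With \<open>u\<close> frozen at \<open>t\<close> and \<open>\<phi>\<close>
      frozen at \<open>s\<close> the product increment is exact:
      \<open>(\<phi> t - \<phi> s) u(t) + \<phi> s (u(t) - u(s))\<close> is the increment of
      \<open>\<phi> u\<close>. The integrand is the error of freezing.\<close>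
    have "((\<lambda>r. \<phi>' r *\<^sub>R u t + \<phi> s *\<^sub>R g r - (\<phi>' r *\<^sub>R u r + \<phi> r *\<^sub>R g r)) has_integral
        ((\<phi> t - \<phi> s) *\<^sub>R u t + \<phi> s *\<^sub>R integral {s..t} g -
          integral {s..t} (\<lambda>r. \<phi>' r *\<^sub>R u r + \<phi> r *\<^sub>R g r))) {s..t}"
      by (intro has_integral_diff has_integral_add has_integral_scaleR_left has_integral_cmul \<phi>st gst ist)
    also have "(\<phi> t - \<phi> s) *\<^sub>R u t + \<phi> s *\<^sub>R integral {s..t} g -
          integral {s..t} (\<lambda>r. \<phi>' r *\<^sub>R u r + \<phi> r *\<^sub>R g r) = F t - F s"
      unfolding is_primitiveD[OF prim st, symmetric] integral_eq_diff[OF ints st] F_def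
      by (simp add: algebra_simps)
    finally have F: "((\<lambda>r. \<phi>' r *\<^sub>R u t + \<phi> s *\<^sub>R g r - (\<phi>' r *\<^sub>R u r + \<phi> r *\<^sub>R g r)) has_integral
        (F t - F s)) {s..t}" .
    have "((\<lambda>r. C * (G t - G s) + C * (t - s) * norm (g r)) has_integral
        ((t - s) *\<^sub>R (C * (G t - G s)) + C * (t - s) * (G t - G s))) {s..t}"
      using st has_integral_const_real[of "C * (G t - G s)" s t]
      by (intro has_integral_add has_integral_mult_right G) auto
    then have B: "((\<lambda>r. C * (G t - G s) + C * (t - s) * norm (g r)) has_integral
        (2 * C * (t - s) * (G t - G s))) {s..t}"
      by (simp add: algebra_simps)
    have "norm (\<phi>' r *\<^sub>R u t + \<phi> s *\<^sub>R g r - (\<phi>' r *\<^sub>R u r + \<phi> r *\<^sub>R g r)) \<le>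
        C * (G t - G s) + C * (t - s) * norm (g r)" if r: "r \<in> {s..t}" for r
    proof -
      have r01: "0 \<le> r" "r \<le> t" "t \<le> 1" "r \<in> {0..1}" "s \<le> r" "r \<le> 1"
        using r st by auto
      have "norm (u t - u r) = norm (integral {r..t} g)"
        using is_primitiveD[OF prim r01(1-3)] by simp
      also have "\<dots> \<le> integral {r..t} (\<lambda>r. norm (g r))"
        using r01 integrable_on_subinterval[OF gi(1), of r t] integrable_on_subinterval[OF gi(2), of r t]
        by (intro integral_norm_bound_integral) auto
      also have "\<dots> = G t - G r"
        using integral_eq_diff[OF gi(2) r01(1-3)] by (simp add: G_def)
      also have "\<dots> \<le> G t - G s"
      proof -
        have "0 \<le> integral {s..r} (\<lambda>r. norm (g r))"
          using r01 st integrable_on_subinterval[OF gi(2), of s r] by (intro integral_nonneg) auto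
        then show ?thesis
          using integral_eq_diff[OF gi(2) st(1) r01(5,6)] by (simp add: G_def)
      qed
      finally have "norm (u t - u r) \<le> G t - G s" .
      then have 1: "norm (\<phi>' r *\<^sub>R (u t - u r)) \<le> C * (G t - G s)"
        using C(2)[OF r01(4)] C(1) by (simp add: mult_mono)
      have "\<bar>\<phi> r - \<phi> s\<bar> \<le> C * \<bar>r - s\<bar>"
        using field_differentiable_bound[of "{0..1}" \<phi> \<phi>' C r s] r01 st C
          has_field_derivative_at_within[OF d\<phi>] by simp
      also have "\<dots> \<le> C * (t - s)"
        using C r01 by (intro mult_left_mono) auto
      finally have 2: "norm ((\<phi> s - \<phi> r) *\<^sub>R g r) \<le> C * (t - s) * norm (g r)"
        by (auto simp: abs_minus_commute intro: mult_right_mono)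
      have "\<phi>' r *\<^sub>R u t + \<phi> s *\<^sub>R g r - (\<phi>' r *\<^sub>R u r + \<phi> r *\<^sub>R g r) =
          \<phi>' r *\<^sub>R (u t - u r) + (\<phi> s - \<phi> r) *\<^sub>R g r"
        by (simp add: algebra_simps)
      then show ?thesis
        using 1 2 norm_triangle_mono by metis
    qed
    then have "norm (integral {s..t} (\<lambda>r. \<phi>' r *\<^sub>R u t + \<phi> s *\<^sub>R g r - (\<phi>' r *\<^sub>R u r + \<phi> r *\<^sub>R g r))) \<le>
        integral {s..t} (\<lambda>r. C * (G t - G s) + C * (t - s) * norm (g r))"
      using F B by (intro integral_norm_bound_integral) auto
    then show ?thesis
      using integral_unique[OF F] integral_unique[OF B] by simp
  qed
  have cG: "continuous_on {0..1} G"
    unfolding G_def by (intro indefinite_integral_continuous_1 gi)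
  \<comment> \<open>As \<open>g\<close> is merely integrable, the summands of \<open>F\<close> need
    not be differentiable at \<open>t\<close>. The derivative of \<open>F\<close> comes from the
    increment bound: continuity of \<open>G\<close> makes the factor \<open>G s - G t\<close> small,
    so the increments are of smaller order than \<open>s - t\<close>.\<close>
  have "(F has_derivative (\<lambda>_. 0)) (at t within {0..1})" if t: "t \<in> {0..1}" for t
    unfolding has_derivative_within_alt
  proof (intro conjI allI impI)
    fix e :: real assume "e > 0"
    then have "e / (2 * C) > 0" using C by simp
    then obtain \<delta> where \<delta>: "\<delta> > 0" "\<And>s. s \<in> {0..1} \<Longrightarrow> \<bar>s - t\<bar> < \<delta> \<Longrightarrow> \<bar>G s - G t\<bar> < e / (2 * C)"
      using cG t unfolding continuous_on_iff dist_real_def by metis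
    have "norm (F s - F t) \<le> e * norm (s - t)" if s: "s \<in> {0..1}" "norm (s - t) < \<delta>" for s
    proof -
      have "norm (F s - F t) \<le> 2 * C * \<bar>s - t\<bar> * \<bar>G s - G t\<bar>"
      proof (cases "s \<le> t")
        case True
        have "norm (F s - F t) = norm (F t - F s)" by (rule norm_minus_commute)
        also have "\<dots> \<le> 2 * C * (t - s) * (G t - G s)"
          using inc[of s t] True s t by simp
        also have "\<dots> \<le> 2 * C * (t - s) * \<bar>G t - G s\<bar>"
          using True C by (intro mult_left_mono) auto
        finally show ?thesis
          using True by (simp add: abs_minus_commute)
      next
        case False
        then have "norm (F s - F t) \<le> 2 * C * (s - t) * (G s - G t)"
          using inc[of t s] s t by simp
        also have "\<dots> \<le> 2 * C * (s - t) * \<bar>G s - G t\<bar>"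
          using False C by (intro mult_left_mono) auto
        finally show ?thesis
          using False by simp
      qed
      also have "\<dots> \<le> 2 * C * \<bar>s - t\<bar> * (e / (2 * C))"
        using \<delta>(2)[of s] s C by (intro mult_left_mono) auto
      also have "\<dots> = e * norm (s - t)"
        using C by simp
      finally show ?thesis .
    qed
    then show "\<exists>d>0. \<forall>s\<in>{0..1}. norm (s - t) < d \<longrightarrow> norm (F s - F t - 0) \<le> e * norm (s - t)"
      using \<delta>(1) by auto
  qed simp
  then obtain c where "\<And>t. t \<in> {0..1} \<Longrightarrow> F t = c"
    using has_derivative_zero_constant[of "{0..1}" F] by auto
  then have "F 1 = F 0"
    by simp
  then have "integral {0..1} (\<lambda>r. \<phi>' r *\<^sub>R u r + \<phi> r *\<^sub>R g r) = 0"
    by (simp add: F_def \<phi>01)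
  moreover have "integral {0..1} (\<lambda>r. \<phi>' r *\<^sub>R u r + \<phi> r *\<^sub>R g r) =
      integral {0..1} (\<lambda>r. \<phi>' r *\<^sub>R u r) + integral {0..1} (\<lambda>r. \<phi> r *\<^sub>R g r)"
    using \<phi>g \<phi>u by (intro Henstock_Kurzweil_Integration.integral_add) (auto simp: absolutely_integrable_on_def)
  ultimately show "integral\<^sup>L (lebesgue_on {0..1}) (\<lambda>t. \<phi>' t *\<^sub>R u t) =
      - integral\<^sup>L (lebesgue_on {0..1}) (\<lambda>t. \<phi> t *\<^sub>R g t)"
    using absolutely_integrable_imp_integrable[OF \<phi>g] absolutely_integrable_imp_integrable[OF \<phi>u]
    by (simp add: lebesgue_integral_eq_integral eq_neg_iff_add_eq_0)
qed

section \<open>Difference quotients and absolutely continuous functions\<close>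

text \<open>The difference of the two derivatives has zero integral over every subinterval, and by
  Lebesgue differentiation its averages over \<open>{t..t + h}\<close> tend to its value outside a
  null set. The averages lie to the right of \<open>t\<close>, so the point 1 is added to that set.
  The lemma makes the energy independent of the choice hidden in \<open>weak_deriv\<close>.\<close>

lemma is_primitive_unique:
  fixes g1 g2 :: "real \<Rightarrow> 'a::euclidean_space"
  assumes g: "g1 integrable_on {0..1}" "g2 integrable_on {0..1}"
    and prim: "is_primitive u g1" "is_primitive u g2"
  shows "negligible {t \<in> {0..1}. g1 t \<noteq> g2 t}"
proof -
  define f where "f = (\<lambda>t. if t \<in> {0..1} then g1 t - g2 t else 0)"
  have "f integrable_on UNIV"
    unfolding f_def integrable_restrict_UNIV using g by (rule integrable_diff)
  then have "f integrable_on cbox a b" for a b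
    by (rule integrable_on_subcbox) simp
  then obtain Z where Z: "negligible Z"
    and lim: "\<And>x e. x \<notin> Z \<Longrightarrow> 0 < e \<Longrightarrow> \<exists>d>0. \<forall>h. 0 < h \<and> h < d \<longrightarrow>
      norm (integral (cbox x (x + h *\<^sub>R One)) f /\<^sub>R h ^ DIM(real) - f x) < e"
    using integrable_ccontinuous_explicit by blast
  have "g1 t = g2 t" if t: "t \<in> {0..1}" "t \<notin> Z" "t \<noteq> 1" for t
  proof (rule ccontr)
    assume "g1 t \<noteq> g2 t"
    then have "norm (f t) > 0" using t by (simp add: f_def)
    then obtain d where d: "d > 0" "\<And>h. 0 < h \<Longrightarrow> h < d \<Longrightarrow>
        norm (integral {t..t + h} f /\<^sub>R h - f t) < norm (f t)"
      using lim[OF t(2), of "norm (f t)"] by auto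
    define h where "h = min (d / 2) (1 - t)"
    have h: "0 < h" "h < d" "t + h \<le> 1"
      using d t by (auto simp: h_def)
    have sub: "{t..t + h} \<subseteq> {0..1}" using h t by auto
    have "integral {t..t + h} f = integral {t..t + h} (\<lambda>t. g1 t - g2 t)"
      using sub by (intro Henstock_Kurzweil_Integration.integral_cong) (auto simp: f_def)
    also have "\<dots> = integral {t..t + h} g1 - integral {t..t + h} g2"
      using integrable_on_subinterval[OF g(1) sub] integrable_on_subinterval[OF g(2) sub]
      by (rule Henstock_Kurzweil_Integration.integral_diff)
    also have "\<dots> = 0"
      using is_primitiveD[OF prim(1), of t "t + h"] is_primitiveD[OF prim(2), of t "t + h"] h t by simp
    finally show False
      using d(2)[OF h(1,2)] by simp
  qed
  then have "{t \<in> {0..1}. g1 t \<noteq> g2 t} \<subseteq> insert 1 Z"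
    by blast
  then show ?thesis
    using Z negligible_insert negligible_subset by blast
qed

definition diff_quot :: "(real \<Rightarrow> 'a::real_vector) \<Rightarrow> nat \<Rightarrow> nat \<Rightarrow> 'a" where
  "diff_quot u m j = real m *\<^sub>R (u (real (Suc j) / real m) - u (real j / real m))"

lemma sum_integral_grid:
  fixes f :: "real \<Rightarrow> real"
  assumes "f integrable_on {0..1}" "m > 0" "k \<le> m"
  shows "(\<Sum>j<k. integral {real j / real m..real (Suc j) / real m} f) = integral {0..real k / real m} f"
  using assms(3)
proof (induction k)
  case (Suc k)
  have "integral {0..real k / real m} f + integral {real k / real m..real (Suc k) / real m} f =
      integral {0..real (Suc k) / real m} f"
    using Suc.prems assms
    by (intro Henstock_Kurzweil_Integration.integral_combine integrable_on_subinterval[OF assms(1)])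
      (auto simp: divide_right_mono)
  then show ?case using Suc by simp
qed simp

text \<open>On each cell, of length \<open>1/m\<close>, \<open>is_norm_integral_le\<close> followed
  by \<open>square_integral_le\<close> is Jensen's inequality for the convex function
  \<open>N^2\<close>. The left side is the energy of the piecewise affine interpolant of
  \<open>u\<close>.\<close>

lemma sum_diff_quot_le:
  assumes g: "g \<in> L2" and prim: "is_primitive u g" and N: "is_norm N" and "m > 0"
  shows "(\<Sum>j<m. (N (diff_quot u m j))\<^sup>2) / real m \<le> integral {0..1} (\<lambda>t. (N (g t))\<^sup>2)"
proof -
  have ints: "g integrable_on {0..1}" "(\<lambda>t. N (g t)) integrable_on {0..1}" "(\<lambda>t. (N (g t))\<^sup>2) integrable_on {0..1}"
    using L2_absolutely_integrable[OF g] absolutely_integrable_is_norm[OF g N]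
      absolutely_integrable_is_norm_square[OF g N] by (simp_all add: absolutely_integrable_on_def)
  have "(N (diff_quot u m j))\<^sup>2 / real m \<le>
      integral {real j / real m..real (Suc j) / real m} (\<lambda>t. (N (g t))\<^sup>2)" if "j < m" for j
  proof -
    let ?s = "real j / real m" and ?t = "real (Suc j) / real m"
    have st: "0 \<le> ?s" "?s \<le> ?t" "?t \<le> 1"
      using that by (auto simp: divide_right_mono)
    have sub: "{?s..?t} \<subseteq> {0..1}" using st by auto
    have len: "?t - ?s = 1 / real m"
      by (simp add: diff_divide_distrib[symmetric])
    have "N (u ?t - u ?s) \<le> integral {?s..?t} (\<lambda>t. N (g t))"
      unfolding is_primitiveD[OF prim st]
      by (intro is_norm_integral_le[OF N] integrable_on_subinterval[OF _ sub] ints)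
    then have "(N (u ?t - u ?s))\<^sup>2 \<le> (integral {?s..?t} (\<lambda>t. N (g t)))\<^sup>2"
      by (intro power_mono is_norm_nonneg[OF N])
    also have "\<dots> \<le> (?t - ?s) * integral {?s..?t} (\<lambda>t. (N (g t))\<^sup>2)"
      by (intro square_integral_le st integrable_on_subinterval[OF _ sub] ints)
    finally have "real m * (N (u ?t - u ?s))\<^sup>2 \<le> integral {?s..?t} (\<lambda>t. (N (g t))\<^sup>2)"
      unfolding len using \<open>m > 0\<close> by (simp add: field_simps)
    then show ?thesis
      using \<open>m > 0\<close>
      by (simp add: diff_quot_def is_norm_scaleR[OF N] power_mult_distrib power2_eq_square mult.left_commute)
  qed
  then have "(\<Sum>j<m. (N (diff_quot u m j))\<^sup>2) / real m \<le>
      (\<Sum>j<m. integral {real j / real m..real (Suc j) / real m} (\<lambda>t. (N (g t))\<^sup>2))"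
    unfolding sum_divide_distrib by (intro sum_mono) auto
  also have "\<dots> = integral {0..1} (\<lambda>t. (N (g t))\<^sup>2)"
    using sum_integral_grid[OF ints(3) \<open>m > 0\<close> order_refl] \<open>m > 0\<close> by simp
  finally show ?thesis .
qed

text \<open>The variance identity. It needs an inner product, so the martingale argument is run in
  the Euclidean norm and not in \<open>N\<close>.\<close>

lemma sum_norm_diff_mean_square:
  fixes p :: "nat \<Rightarrow> 'a::real_inner"
  assumes "(\<Sum>i\<in>I. p i) = real (card I) *\<^sub>R a"
  shows "(\<Sum>i\<in>I. (norm (p i - a))\<^sup>2) = (\<Sum>i\<in>I. (norm (p i))\<^sup>2) - real (card I) * (norm a)\<^sup>2"
proof -
  have "(\<Sum>i\<in>I. (norm (p i - a))\<^sup>2) = (\<Sum>i\<in>I. (norm (p i))\<^sup>2 - 2 * (p i \<bullet> a) + (norm a)\<^sup>2)"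
    by (intro sum.cong refl) (simp add: power2_norm_eq_inner inner_diff inner_commute)
  also have "\<dots> = (\<Sum>i\<in>I. (norm (p i))\<^sup>2) - 2 * ((\<Sum>i\<in>I. p i) \<bullet> a) + real (card I) * (norm a)\<^sup>2"
    by (simp add: sum.distrib sum_subtractf inner_sum_left sum_distrib_left)
  also have "\<dots> = (\<Sum>i\<in>I. (norm (p i))\<^sup>2) - real (card I) * (norm a)\<^sup>2"
    unfolding assms by (simp add: power2_norm_eq_inner)
  finally show ?thesis .
qed

lemma sum_diff_quot_refine:
  assumes "m > 0" "M > 0"
  shows "(\<Sum>i=j * M..<j * M + M. diff_quot u (m * M) i) = real M *\<^sub>R diff_quot u m j"
proof -
  have "(\<Sum>i=j * M..<j * M + M. diff_quot u (m * M) i) = real (m * M) *\<^sub>R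
      (\<Sum>i=j * M..<j * M + M. u (real (Suc i) / real (m * M)) - u (real i / real (m * M)))"
    unfolding diff_quot_def scaleR_sum_right ..
  also have "\<dots> = real (m * M) *\<^sub>R (u (real (j * M + M) / real (m * M)) - u (real (j * M) / real (m * M)))"
    by (subst sum_Suc_diff'[of "j * M" "j * M + M" "\<lambda>i. u (real i / real (m * M))"]) simp_all
  also have "real (j * M + M) / real (m * M) = real (Suc j) / real m"
    using assms by (simp add: field_simps)
  also have "real (j * M) / real (m * M) = real j / real m"
    using assms by simp
  finally show ?thesis
    by (simp add: diff_quot_def mult.commute)
qed

text \<open>The difference quotients on a grid are the averages of those on any finer grid, hence
  orthogonal to the increment under refinement.\<close>

lemma has_integral_diff_quot_refine:
  fixes u :: "real \<Rightarrow> 'a::euclidean_space"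
  assumes "m > 0" "M > 0"
  shows "((\<lambda>t. (norm (pw_const (m * M) (diff_quot u (m * M)) t - pw_const m (diff_quot u m) t))\<^sup>2)
      has_integral ((\<Sum>i<m * M. (norm (diff_quot u (m * M) i))\<^sup>2) / real (m * M) -
        (\<Sum>j<m. (norm (diff_quot u m j))\<^sup>2) / real m)) {0..1}"
proof -
  let ?p = "diff_quot u (m * M)" and ?a = "diff_quot u m"
  have "(\<Sum>i<m * M. (norm (?p i - ?a (i div M)))\<^sup>2) =
      (\<Sum>j<m. \<Sum>i=j * M..<j * M + M. (norm (?p i - ?a (i div M)))\<^sup>2)"
    by (rule sum.nat_group[symmetric])
  also have "\<dots> = (\<Sum>j<m. \<Sum>i=j * M..<j * M + M. (norm (?p i - ?a j))\<^sup>2)"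
  proof (intro sum.cong refl)
    fix j i assume "i \<in> {j * M..<j * M + M}"
    then have "i div M = j"
      by (intro div_nat_eqI) (auto simp: mult.commute)
    then show "(norm (?p i - ?a (i div M)))\<^sup>2 = (norm (?p i - ?a j))\<^sup>2" by simp
  qed
  also have "\<dots> = (\<Sum>j<m. (\<Sum>i=j * M..<j * M + M. (norm (?p i))\<^sup>2) - real M * (norm (?a j))\<^sup>2)"
    using sum_norm_diff_mean_square[of ?p "{_ * M..<_ * M + M}"] sum_diff_quot_refine[OF assms, of u]
    by (intro sum.cong refl) simp
  also have "\<dots> = (\<Sum>i<m * M. (norm (?p i))\<^sup>2) - real M * (\<Sum>j<m. (norm (?a j))\<^sup>2)"
    by (simp add: sum_subtractf sum.nat_group sum_distrib_left)
  finally have eq: "(\<Sum>i<m * M. (norm (?p i - ?a (i div M)))\<^sup>2) =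
      (\<Sum>i<m * M. (norm (?p i))\<^sup>2) - real M * (\<Sum>j<m. (norm (?a j))\<^sup>2)" .
  have "(pw_const (m * M) (\<lambda>i. (norm (?p i - ?a (i div M)))\<^sup>2) has_integral
      (1 / real (m * M)) *\<^sub>R (\<Sum>i<m * M. (norm (?p i - ?a (i div M)))\<^sup>2)) {0..1}"
    using assms by (intro has_integral_pw_const_unit) simp
  also have "(1 / real (m * M)) *\<^sub>R (\<Sum>i<m * M. (norm (?p i - ?a (i div M)))\<^sup>2) =
      (\<Sum>i<m * M. (norm (?p i))\<^sup>2) / real (m * M) - (\<Sum>j<m. (norm (?a j))\<^sup>2) / real m"
    unfolding eq using assms by (simp add: diff_divide_distrib)
  finally show ?thesis
  proof (rule has_integral_eq[rotated])
    fix t :: real assume "t \<in> {0..1}"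
    then have "pw_const m ?a t = pw_const (m * M) (\<lambda>i. ?a (i div M)) t"
      using assms by (intro pw_const_refine) auto
    then show "pw_const (m * M) (\<lambda>i. (norm (?p i - ?a (i div M)))\<^sup>2) t =
        (norm (pw_const (m * M) ?p t - pw_const m ?a t))\<^sup>2"
      by (simp add: pw_const_def)
  qed
qed

text \<open>Nonnegative extended integrals allow Fatou's lemma to be applied before \<open>f\<close>
  is known to be integrable; the bound it yields then gives integrability. Applied below to squared
  Euclidean norms, to squares of \<open>N\<close>, and to \<open>L1\<close> distances.\<close>

lemma Fatou_integrable:
  fixes s :: "nat \<Rightarrow> 'a \<Rightarrow> real"
  assumes s: "\<And>i. integrable M (s i)" "\<And>i x. 0 \<le> s i x" "\<And>i. integral\<^sup>L M (s i) \<le> A"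
    and f: "f \<in> borel_measurable M" "\<And>x. 0 \<le> f x" and lim: "AE x in M. (\<lambda>i. s i x) \<longlonglongrightarrow> f x"
  shows "integrable M f" "integral\<^sup>L M f \<le> A"
proof -
  have [measurable]: "s i \<in> borel_measurable M" for i
    using s(1) by (rule borel_measurable_integrable)
  have "0 \<le> A"
    using order_trans[OF Bochner_Integration.integral_nonneg s(3)] s(2) by blast
  have "(\<integral>\<^sup>+x. ennreal (f x) \<partial>M) = (\<integral>\<^sup>+x. liminf (\<lambda>i. ennreal (s i x)) \<partial>M)"
  proof (rule nn_integral_cong_AE)
    show "AE x in M. ennreal (f x) = liminf (\<lambda>i. ennreal (s i x))"
      using lim
    proof eventually_elim
      case (elim x)
      then have "(\<lambda>i. ennreal (s i x)) \<longlonglongrightarrow> ennreal (f x)"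
        by (rule tendsto_ennrealI)
      then show ?case
        by (simp add: lim_imp_Liminf)
    qed
  qed
  also have "\<dots> \<le> liminf (\<lambda>i. \<integral>\<^sup>+x. ennreal (s i x) \<partial>M)"
    by (rule nn_integral_liminf) measurable
  also have "\<dots> = liminf (\<lambda>i. ennreal (integral\<^sup>L M (s i)))"
    using s(1,2) by (simp add: nn_integral_eq_integral)
  also have "\<dots> \<le> liminf (\<lambda>_ :: nat. ennreal A)"
    using s(3) by (intro Liminf_mono always_eventually allI ennreal_leI)
  also have "\<dots> = ennreal A"
    by (simp add: Liminf_const)
  finally have le: "(\<integral>\<^sup>+x. ennreal (f x) \<partial>M) \<le> ennreal A" .
  show int: "integrable M f"
    using f le by (intro integrableI_nonneg) (auto intro: le_less_trans)
  show "integral\<^sup>L M f \<le> A"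
    using le f(2) \<open>0 \<le> A\<close> nn_integral_eq_integral[OF int] by simp
qed

text \<open>A theorem of F. Riesz. Along dyadic grids the difference quotients form a bounded martingale in
  \<open>L\<^sup>2\<close>, and its limit is the derivative.\<close>

lemma bounded_diff_quot_imp_primitive:
  fixes u :: "real \<Rightarrow> 'a::euclidean_space"
  assumes N: "is_norm N" and u: "continuous_on {0..1} u"
    and bound: "\<And>m. m > 0 \<Longrightarrow> (\<Sum>j<m. (N (diff_quot u m j))\<^sup>2) / real m \<le> A"
  obtains g where "g \<in> L2" "is_primitive u g" "integral {0..1} (\<lambda>t. (N (g t))\<^sup>2) \<le> A"
proof -
  let ?L = "lebesgue_on {0..1::real}"
  define G where "G = (\<lambda>k. pw_const (2 ^ k) (diff_quot u (2 ^ k)))"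
  define e where "e = (\<lambda>k. (\<Sum>j<2 ^ k. (norm (diff_quot u (2 ^ k) j))\<^sup>2) / real (2 ^ k))"
  have [measurable]: "G k \<in> borel_measurable ?L" for k
    unfolding G_def by (rule measurable_pw_const) simp
  have intG: "integrable ?L (G k)" for k
    unfolding G_def by (rule integrable_pw_const) simp
  have absG: "G k absolutely_integrable_on {0..1}" for k
    unfolding G_def by (rule absolutely_integrable_pw_const) simp
  have int_F: "integrable ?L (\<lambda>t. F (G k t))"
    "integral\<^sup>L ?L (\<lambda>t. F (G k t)) = (\<Sum>j<2 ^ k. F (diff_quot u (2 ^ k) j)) / real (2 ^ k)"
    for k and F :: "'a \<Rightarrow> real"
    unfolding G_def pw_const_comp[of F]
    by (simp_all add: integrable_pw_const integral_pw_const)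
  \<comment> \<open>Pythagoras: the squared \<open>L2\<close> distance of two levels is the gain in
    Euclidean energy. Since \<open>e\<close> increases and is bounded, the sequence \<open>G\<close>
    is Cauchy.\<close>
  have int_diff: "((\<lambda>t. (norm (G l t - G k t))\<^sup>2) has_integral (e l - e k)) {0..1}" if "k \<le> l" for k l
    using has_integral_diff_quot_refine[of "2 ^ k" "2 ^ (l - k)" u] that
    by (simp add: G_def e_def power_add[symmetric])
  obtain C where C: "C > 0" "\<And>x. norm x \<le> C * N x"
    using norm_le_is_norm[OF N] by blast
  have e_bound: "e k \<le> C\<^sup>2 * A" for k
  proof -
    have "e k \<le> (\<Sum>j<2 ^ k. C\<^sup>2 * (N (diff_quot u (2 ^ k) j))\<^sup>2) / real (2 ^ k)"
      unfolding e_def power_mult_distrib[symmetric]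
      using C by (intro divide_right_mono sum_mono power_mono) auto
    also have "\<dots> = C\<^sup>2 * ((\<Sum>j<2 ^ k. (N (diff_quot u (2 ^ k) j))\<^sup>2) / real (2 ^ k))"
      by (simp add: sum_distrib_left)
    also have "\<dots> \<le> C\<^sup>2 * A"
      by (intro mult_left_mono bound) auto
    finally show ?thesis .
  qed
  have "incseq e"
    unfolding incseq_def using has_integral_nonneg[OF int_diff] by force
  then have "convergent e"
    using e_bound by (metis incseq_convergent convergent_def)
  then have Ce: "Cauchy e"
    by (rule convergent_Cauchy)
  have L1: "integral\<^sup>L ?L (\<lambda>t. norm (G l t - G k t)) \<le> sqrt \<bar>e l - e k\<bar>" for k l
  proof -
    have *: "integral\<^sup>L ?L (\<lambda>t. norm (G l t - G k t)) \<le> sqrt \<bar>e l - e k\<bar>" if "k \<le> l" for k l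
    proof -
      have int: "integrable ?L (\<lambda>t. norm (G l t - G k t))"
        by (intro integrable_norm Bochner_Integration.integrable_diff intG)
      then have I: "(\<lambda>t. norm (G l t - G k t)) integrable_on {0..1}"
        by (rule integrable_on_lebesgue_on) simp
      have "(integral {0..1} (\<lambda>t. norm (G l t - G k t)))\<^sup>2 \<le>
          (1 - 0) * integral {0..1} (\<lambda>t. (norm (G l t - G k t))\<^sup>2)"
        by (rule square_integral_le) (use I int_diff[OF that] in auto)
      also have "\<dots> = \<bar>e l - e k\<bar>"
        using integral_unique[OF int_diff[OF that]] has_integral_nonneg[OF int_diff[OF that]] by simp
      finally show ?thesis
        using int by (simp add: real_le_rsqrt lebesgue_integral_eq_integral)
    qed
    show ?thesis
    proof (cases "k \<le> l")
      case False
      then show ?thesis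
        using *[of l k] by (simp add: norm_minus_commute abs_minus_commute)
    qed (rule *)
  qed
  have L1_Cauchy: "\<exists>K. \<forall>i\<ge>K. \<forall>j\<ge>K. integral\<^sup>L ?L (\<lambda>t. norm (G i t - G j t)) < \<epsilon>" if "\<epsilon> > 0" for \<epsilon>
  proof -
    have "\<epsilon>\<^sup>2 > 0" using that by simp
    then obtain K where K: "\<And>i j. i \<ge> K \<Longrightarrow> j \<ge> K \<Longrightarrow> \<bar>e i - e j\<bar> < \<epsilon>\<^sup>2"
      using Ce unfolding Cauchy_def dist_real_def by blast
    have "integral\<^sup>L ?L (\<lambda>t. norm (G i t - G j t)) < \<epsilon>" if "i \<ge> K" "j \<ge> K" for i j
    proof -
      have "sqrt \<bar>e i - e j\<bar> < sqrt (\<epsilon>\<^sup>2)"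
        using K[OF that] by (rule real_sqrt_less_mono)
      then show ?thesis
        using L1[of i j] \<open>\<epsilon> > 0\<close> by simp
    qed
    then show ?thesis by blast
  qed
  \<comment> \<open>Almost everywhere convergence is extracted from the \<open>L1\<close> Cauchy
    property, which follows from the \<open>L2\<close> one by Cauchy-Schwarz.\<close>
  obtain r where r: "strict_mono r" "AE t in ?L. Cauchy (\<lambda>i. G (r i) t)"
    using cauchy_L1_AE_cauchy_subseq[of ?L G, OF intG L1_Cauchy] by blast
  define g where "g = (\<lambda>t. lim (\<lambda>i. G (r i) t))"
  have g_meas [measurable]: "g \<in> borel_measurable ?L"
    unfolding g_def by (rule borel_measurable_lim_metric) measurable
  have lim: "AE t in ?L. (\<lambda>i. G (r i) t) \<longlonglongrightarrow> g t"
    using r(2) by eventually_elim (simp add: g_def Cauchy_convergent_iff convergent_LIMSEQ_iff)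
  have N_meas [measurable]: "N \<in> borel_measurable borel"
    by (intro borel_measurable_continuous_onI continuous_on_is_norm N)
  have "integrable ?L (\<lambda>t. (norm (g t))\<^sup>2)"
  proof (rule Fatou_integrable(1))
    show "integrable ?L (\<lambda>t. (norm (G (r i) t))\<^sup>2)" for i
      by (rule int_F)
    show "integral\<^sup>L ?L (\<lambda>t. (norm (G (r i) t))\<^sup>2) \<le> C\<^sup>2 * A" for i
      using int_F(2)[of "\<lambda>v. (norm v)\<^sup>2" "r i"] e_bound[of "r i"] by (simp add: e_def)
    show "AE t in ?L. (\<lambda>i. (norm (G (r i) t))\<^sup>2) \<longlonglongrightarrow> (norm (g t))\<^sup>2"
      using lim by eventually_elim (intro tendsto_intros)
  qed (auto intro: N_meas g_meas)
  then have gL2: "g \<in> L2"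
    by (simp add: L2_def g_meas)
  have "integral\<^sup>L ?L (\<lambda>t. (N (g t))\<^sup>2) \<le> A"
  \<comment> \<open>Fatou's lemma is applied to \<open>N\<close> itself: passing through the
    Euclidean bound would cost the factor from the equivalence of norms, and \<open>A\<close> has to
    be reached exactly.\<close>
  proof (rule Fatou_integrable(2))
    show "integrable ?L (\<lambda>t. (N (G (r i) t))\<^sup>2)" for i
      by (rule int_F)
    show "integral\<^sup>L ?L (\<lambda>t. (N (G (r i) t))\<^sup>2) \<le> A" for i
      using int_F(2)[of "\<lambda>v. (N v)\<^sup>2" "r i"] bound[of "2 ^ r i"] by simp
    show "AE t in ?L. (\<lambda>i. (N (G (r i) t))\<^sup>2) \<longlonglongrightarrow> (N (g t))\<^sup>2"
      using lim by eventually_elim (rule tendsto_power[OF tendsto_is_norm[OF N]])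
  qed auto
  then have energy: "integral {0..1} (\<lambda>t. (N (g t))\<^sup>2) \<le> A"
    using absolutely_integrable_imp_integrable[OF absolutely_integrable_is_norm_square[OF gL2 N]]
    by (simp add: lebesgue_integral_eq_integral)
  have absg: "g absolutely_integrable_on {0..1}"
    using gL2 by (rule L2_absolutely_integrable)
  then have gi: "g integrable_on {0..1}"
    by (simp add: absolutely_integrable_on_def)
  \<comment> \<open>The limit \<open>g\<close> was found along the subsequence \<open>r\<close>; the
    Cauchy property and Fatou's lemma give \<open>L1\<close> convergence of the full sequence
    \<open>G\<close> to it.\<close>
  define d where "d = (\<lambda>k. integral {0..1} (\<lambda>t. norm (g t - G k t)))"
  have int_gG: "(\<lambda>t. norm (g t - G k t)) integrable_on {0..1}" for k
    using set_integral_diff(1)[OF absg absG[of k]] by (simp add: absolutely_integrable_on_def)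
  have "d \<longlonglongrightarrow> 0"
  proof (rule LIMSEQ_I)
    fix \<epsilon> :: real assume "\<epsilon> > 0"
    then obtain K where K: "\<And>i j. i \<ge> K \<Longrightarrow> j \<ge> K \<Longrightarrow> integral\<^sup>L ?L (\<lambda>t. norm (G i t - G j t)) < \<epsilon> / 2"
      using L1_Cauchy[of "\<epsilon> / 2"] by auto
    have "norm (d k - 0) < \<epsilon>" if k: "k \<ge> K" for k
    proof -
      have int: "integrable ?L (\<lambda>t. norm (G (r (i + K)) t - G k t))" for i
        by (intro integrable_norm Bochner_Integration.integrable_diff intG)
      have le: "integral\<^sup>L ?L (\<lambda>t. norm (G (r (i + K)) t - G k t)) \<le> \<epsilon> / 2" for i
        using K[of "r (i + K)" k] k seq_suble[OF r(1), of "i + K"] by simp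
      have "AE t in ?L. (\<lambda>i. norm (G (r (i + K)) t - G k t)) \<longlonglongrightarrow> norm (g t - G k t)"
        using lim by eventually_elim (intro tendsto_intros LIMSEQ_ignore_initial_segment)
      from Fatou_integrable[OF int _ le _ _ this]
      have "integrable ?L (\<lambda>t. norm (g t - G k t))" "integral\<^sup>L ?L (\<lambda>t. norm (g t - G k t)) \<le> \<epsilon> / 2"
        by auto
      then have "d k \<le> \<epsilon> / 2"
        by (simp add: d_def lebesgue_integral_eq_integral)
      moreover have "d k \<ge> 0"
        unfolding d_def by (intro integral_nonneg int_gG) simp
      ultimately show ?thesis
        using \<open>\<epsilon> > 0\<close> by simp
    qed
    then show "\<exists>K. \<forall>k\<ge>K. norm (d k - 0) < \<epsilon>"
      by blast
  qed
  have "is_primitive u g"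
  proof (rule is_primitiveI[OF gi])
    fix t :: real assume t: "0 \<le> t" "t \<le> 1"
    \<comment> \<open>The last dyadic point of level \<open>k\<close> not after \<open>t\<close>. Up
      to such a point the integral of \<open>G k\<close> telescopes exactly to an increment of
      \<open>u\<close>.\<close>
    define j where "j = (\<lambda>k::nat. nat \<lfloor>2 ^ k * t\<rfloor>)"
    define \<tau> where "\<tau> = (\<lambda>k. real (j k) / 2 ^ k)"
    have j: "real (j k) = of_int \<lfloor>2 ^ k * t\<rfloor>" for k
      using t by (simp add: j_def)
    have \<tau>_le: "\<tau> k \<le> t" for k
      unfolding \<tau>_def j by (simp add: divide_le_eq mult.commute)
    have \<tau>_ge: "t - (1/2) ^ k \<le> \<tau> k" for k
    proof -
      have "2 ^ k * t \<le> real (j k) + 1"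
        unfolding j by linarith
      then have "t \<le> (real (j k) + 1) / 2 ^ k"
        by (simp add: pos_le_divide_eq mult.commute)
      then show ?thesis
        by (simp add: \<tau>_def add_divide_distrib power_one_over)
    qed
    have \<tau>0: "0 \<le> \<tau> k" for k
      by (simp add: \<tau>_def)
    have "(\<lambda>k. t - (1/2) ^ k) \<longlonglongrightarrow> t - 0"
      by (intro tendsto_diff tendsto_const LIMSEQ_realpow_zero) auto
    then have \<tau>: "\<tau> \<longlonglongrightarrow> t"
      by (intro tendsto_sandwich[of "\<lambda>k. t - (1/2) ^ k" \<tau> sequentially "\<lambda>_. t"])
        (auto intro: always_eventually \<tau>_le \<tau>_ge)
    have at: "\<tau> k \<in> {0..1}" for k
      using \<tau>_le[of k] \<tau>0[of k] t by simp
    have I: "integral {0..\<tau> k} (G k) = u (\<tau> k) - u 0" for k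
    proof -
      have "(G k has_integral (1 / real (2 ^ k)) *\<^sub>R (\<Sum>i<j k. diff_quot u (2 ^ k) i)) {0..real (j k) / real (2 ^ k)}"
        unfolding G_def by (rule has_integral_pw_const) simp
      also have "(1 / real (2 ^ k)) *\<^sub>R (\<Sum>i<j k. diff_quot u (2 ^ k) i) =
          (\<Sum>i<j k. u (real (Suc i) / 2 ^ k) - u (real i / 2 ^ k))"
        unfolding scaleR_sum_right by (intro sum.cong refl) (simp add: diff_quot_def)
      also have "\<dots> = u (\<tau> k) - u 0"
        by (subst sum_lessThan_telescope[of "\<lambda>i. u (real i / 2 ^ k)"]) (simp add: \<tau>_def)
      finally show ?thesis
        by (simp add: \<tau>_def integral_unique)
    qed
    have bound: "norm (integral {0..\<tau> k} g - (u (\<tau> k) - u 0)) \<le> d k" for k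
    proof -
      have sub: "{0..\<tau> k} \<subseteq> {0..1}" using at[of k] by auto
      have Gi: "G k integrable_on {0..1}"
        using absG[of k] by (simp add: absolutely_integrable_on_def)
      have "integral {0..\<tau> k} g - (u (\<tau> k) - u 0) = integral {0..\<tau> k} (\<lambda>t. g t - G k t)"
        unfolding I[symmetric]
        by (intro Henstock_Kurzweil_Integration.integral_diff[symmetric] integrable_on_subinterval[OF _ sub] gi Gi)
      also have "norm \<dots> \<le> integral {0..\<tau> k} (\<lambda>t. norm (g t - G k t))"
        by (intro integral_norm_bound_integral integrable_on_subinterval[OF _ sub] integrable_diff gi Gi int_gG)
          auto
      also have "\<dots> \<le> d k"
        unfolding d_def
        by (intro integral_subset_le sub integrable_on_subinterval[OF _ sub] int_gG) auto
      finally show ?thesis .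
    qed
    have "(\<lambda>k. integral {0..\<tau> k} g - (u (\<tau> k) - u 0)) \<longlonglongrightarrow> 0"
      by (rule Lim_null_comparison[OF _ \<open>d \<longlonglongrightarrow> 0\<close>]) (auto intro: always_eventually bound)
    moreover have "(\<lambda>k. integral {0..\<tau> k} g) \<longlonglongrightarrow> integral {0..t} g"
      using continuous_on_tendsto_compose[OF indefinite_integral_continuous_1[OF gi] \<tau>] at t
      by (auto simp: always_eventually)
    moreover have "(\<lambda>k. u (\<tau> k)) \<longlonglongrightarrow> u t"
      using continuous_on_tendsto_compose[OF u \<tau>] at t by (auto simp: always_eventually)
    ultimately have "integral {0..t} g - (u t - u 0) = 0"
      by (intro LIMSEQ_unique[of "\<lambda>k. integral {0..\<tau> k} g - (u (\<tau> k) - u 0)"] tendsto_intros) auto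
    then show "u t = u 0 + integral {0..t} g"
      by (simp add: algebra_simps)
  qed
  with gL2 energy show thesis
    using that by blast
qed

section \<open>Grids and sampling\<close>

text \<open>The last index is repeated, so that the step function below is meaningful at \<open>t = 1\<close> too,
  where \<^const>\<open>pw_const\<close> reads the tuple out of range.\<close>

definition grid_index :: "nat \<Rightarrow> real \<Rightarrow> nat" where
  "grid_index n t = min (nat \<lfloor>real n * t\<rfloor>) (n - 1)"

definition step_fun :: "nat \<Rightarrow> (nat \<Rightarrow> 'a) \<Rightarrow> real \<Rightarrow> 'a" where
  "step_fun n u t = u (grid_index n t)"

lemma step_fun_eq_pw_const_clamped: "step_fun n u = pw_const n (\<lambda>i. u (min i (n - 1)))"
  by (simp add: fun_eq_iff step_fun_def grid_index_def pw_const_def)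

lemma grid_index_less: "n > 0 \<Longrightarrow> grid_index n t < n"
  by (simp add: grid_index_def)

lemma grid_index_eq:
  assumes "0 \<le> t" "t < 1"
  shows "grid_index n t = nat \<lfloor>real n * t\<rfloor>"
proof (cases "n = 0")
  case False
  have "real n * t < real n"
    using assms False by simp
  then have "\<lfloor>real n * t\<rfloor> < int n"
    by (simp add: floor_less_iff)
  then show ?thesis
    using assms False by (simp add: grid_index_def nat_less_iff)
qed (simp add: grid_index_def)

lemma step_fun_eq_pw_const: "0 \<le> t \<Longrightarrow> t < 1 \<Longrightarrow> step_fun n u t = pw_const n u t"
  by (simp add: step_fun_def grid_index_eq pw_const_def)

lemma step_fun_0: "step_fun n u 0 = u 0"
  by (simp add: step_fun_def grid_index_def)

lemma nat_floor_diff_le: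
  assumes "0 \<le> s" "s \<le> t"
  shows "nat \<lfloor>real n * s\<rfloor> \<le> nat \<lfloor>real n * t\<rfloor>"
    and "real (nat \<lfloor>real n * t\<rfloor>) - real (nat \<lfloor>real n * s\<rfloor>) \<le> real n * (t - s) + 1"
proof -
  have "real n * s \<le> real n * t"
    using assms by (simp add: mult_left_mono)
  then show "nat \<lfloor>real n * s\<rfloor> \<le> nat \<lfloor>real n * t\<rfloor>"
    by (simp add: floor_mono nat_mono)
  have "real (nat \<lfloor>real n * t\<rfloor>) = of_int \<lfloor>real n * t\<rfloor>" "real (nat \<lfloor>real n * s\<rfloor>) = of_int \<lfloor>real n * s\<rfloor>"
    using assms by simp_all
  then show "real (nat \<lfloor>real n * t\<rfloor>) - real (nat \<lfloor>real n * s\<rfloor>) \<le> real n * (t - s) + 1"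
    unfolding right_diff_distrib by linarith
qed

lemma grid_index_diff_le:
  assumes "0 \<le> s" "s \<le> t"
  shows "grid_index n s \<le> grid_index n t"
    and "real (grid_index n t) - real (grid_index n s) \<le> real n * (t - s) + 1"
proof -
  show "grid_index n s \<le> grid_index n t"
    using nat_floor_diff_le(1)[OF assms, of n] by (auto simp: grid_index_def)
  have "0 \<le> real n * (t - s)"
    using assms by simp
  then show "real (grid_index n t) - real (grid_index n s) \<le> real n * (t - s) + 1"
    using nat_floor_diff_le[OF assms, of n] by (auto simp: grid_index_def min_def)
qed

text \<open>Telescoping and Cauchy-Schwarz, the factor being the number of increments between
  \<open>a\<close> and \<open>b\<close>.\<close>

lemma is_norm_increment_square_le:
  fixes u :: "nat \<Rightarrow> 'a::real_vector"
  assumes N: "is_norm N" and "a \<le> b"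
  shows "(N (u b - u a))\<^sup>2 \<le> (real b - real a) * (\<Sum>i=Suc a..<Suc b. (N (u i - u (i - 1)))\<^sup>2)"
proof -
  have "u b - u a = (\<Sum>i=Suc a..<Suc b. u i - u (i - 1))"
    using \<open>a \<le> b\<close> by (induction b rule: dec_induct) (auto simp: algebra_simps)
  then have "N (u b - u a) \<le> (\<Sum>i=Suc a..<Suc b. N (u i - u (i - 1)))"
    using is_norm_sum[OF N] by metis
  then have "(N (u b - u a))\<^sup>2 \<le> (\<Sum>i=Suc a..<Suc b. N (u i - u (i - 1)))\<^sup>2"
    by (intro power_mono is_norm_nonneg[OF N])
  also have "\<dots> \<le> real (card {Suc a..<Suc b}) * (\<Sum>i=Suc a..<Suc b. (N (u i - u (i - 1)))\<^sup>2)"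
    by (rule sum_square_le_card)
  finally show ?thesis
    using \<open>a \<le> b\<close> by (simp add: of_nat_diff)
qed

text \<open>A step function has at most \<open>n (t - s) + 1\<close> jumps between \<open>s\<close>
  and \<open>t\<close>. The sum is kept local to these jumps, so that adding over disjoint intervals
  counts no jump twice.\<close>

lemma step_fun_increment_square_le:
  fixes u :: "nat \<Rightarrow> 'a::real_vector"
  assumes N: "is_norm N" and st: "0 \<le> s" "s \<le> t"
  shows "(N (step_fun n u t - step_fun n u s))\<^sup>2 \<le> (real n * (t - s) + 1) *
    (\<Sum>i=Suc (grid_index n s)..<Suc (grid_index n t). (N (u i - u (i - 1)))\<^sup>2)"
proof -
  have "(N (step_fun n u t - step_fun n u s))\<^sup>2 \<le> (real (grid_index n t) - real (grid_index n s)) *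
      (\<Sum>i=Suc (grid_index n s)..<Suc (grid_index n t). (N (u i - u (i - 1)))\<^sup>2)"
    unfolding step_fun_def by (intro is_norm_increment_square_le N grid_index_diff_le st)
  also have "\<dots> \<le> (real n * (t - s) + 1) *
      (\<Sum>i=Suc (grid_index n s)..<Suc (grid_index n t). (N (u i - u (i - 1)))\<^sup>2)"
    by (intro mult_right_mono grid_index_diff_le st sum_nonneg) simp
  finally show ?thesis .
qed

text \<open>Split off from \<open>disc_reg\<close> because only this part can lose energy in the
  limit; the contribution of the initial value converges.\<close>

definition disc_seminorm :: "('a::real_vector \<Rightarrow> real) \<Rightarrow> nat \<Rightarrow> (nat \<Rightarrow> 'a) \<Rightarrow> real" where
  "disc_seminorm N n u = real n * (\<Sum>i=1..<n. (N (u i - u (i - 1)))\<^sup>2)"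

lemma disc_reg_eq: "disc_reg N \<tau> n u = disc_seminorm N n u + \<tau> * (N (u 0))\<^sup>2"
  by (simp add: disc_reg_def disc_seminorm_def)

lemma disc_seminorm_nonneg: "0 \<le> disc_seminorm N n u"
  by (simp add: disc_seminorm_def sum_nonneg)

text \<open>The term \<open>1 / real n\<close> pays for a single jump, which can occur over an
  arbitrarily short interval.\<close>

lemma step_fun_holder:
  fixes u :: "nat \<Rightarrow> 'a::real_vector"
  assumes N: "is_norm N" and "n > 0" and st: "0 \<le> s" "s \<le> t"
  shows "(N (step_fun n u t - step_fun n u s))\<^sup>2 \<le> (t - s + 1 / real n) * disc_seminorm N n u"
proof -
  have "(N (step_fun n u t - step_fun n u s))\<^sup>2 \<le> (real n * (t - s) + 1) *
      (\<Sum>i=Suc (grid_index n s)..<Suc (grid_index n t). (N (u i - u (i - 1)))\<^sup>2)"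
    by (rule step_fun_increment_square_le[OF N st])
  also have "\<dots> \<le> (real n * (t - s) + 1) * (\<Sum>i=1..<n. (N (u i - u (i - 1)))\<^sup>2)"
    using grid_index_less[OF \<open>n > 0\<close>, of t] st
    by (intro mult_left_mono sum_mono2) auto
  also have "\<dots> = (t - s + 1 / real n) * disc_seminorm N n u"
    using \<open>n > 0\<close> by (simp add: disc_seminorm_def field_simps)
  finally show ?thesis .
qed

text \<open>Each of the \<open>m\<close> coarse cells contributes its own block of at most
  \<open>n/m + 1\<close> jumps, and consecutive blocks concatenate to one sum over all jumps. The
  resulting factor \<open>1 + m/n\<close> tends to 1 for fixed \<open>m\<close>, so nothing is lost
  in the limit.\<close>

lemma sum_step_fun_increments_le:
  fixes u :: "nat \<Rightarrow> 'a::real_vector"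
  assumes N: "is_norm N" and "n > 0" "m > 0"
  shows "(\<Sum>j<m. (N (diff_quot (step_fun n u) m j))\<^sup>2) / real m \<le>
    (1 + real m / real n) * disc_seminorm N n u"
proof -
  let ?D = "\<lambda>i. (N (u i - u (i - 1)))\<^sup>2"
  let ?x = "\<lambda>j. grid_index n (real j / real m)"
  have "(N (step_fun n u (real (Suc j) / real m) - step_fun n u (real j / real m)))\<^sup>2 \<le>
      (real n / real m + 1) * (\<Sum>i=Suc (?x j)..<Suc (?x (Suc j)). ?D i)" for j
  proof -
    have "real (Suc j) / real m - real j / real m = 1 / real m"
      by (simp add: diff_divide_distrib[symmetric])
    then show ?thesis
      using step_fun_increment_square_le[OF N, of "real j / real m" "real (Suc j) / real m" n u]
      by (simp add: divide_right_mono)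
  qed
  then have "(\<Sum>j<m. (N (step_fun n u (real (Suc j) / real m) - step_fun n u (real j / real m)))\<^sup>2) \<le>
      (\<Sum>j<m. (real n / real m + 1) * (\<Sum>i=Suc (?x j)..<Suc (?x (Suc j)). ?D i))"
    by (intro sum_mono)
  also have "\<dots> = (real n / real m + 1) * (\<Sum>j<m. \<Sum>i=Suc (?x j)..<Suc (?x (Suc j)). ?D i)"
    by (simp only: sum_distrib_left)
  also have "(\<Sum>j<k. \<Sum>i=Suc (?x j)..<Suc (?x (Suc j)). ?D i) = (\<Sum>i=1..<Suc (?x k). ?D i)" for k
  proof (induction k)
    case (Suc k)
    have "(\<Sum>i=1..<Suc (?x k). ?D i) + (\<Sum>i=Suc (?x k)..<Suc (?x (Suc k)). ?D i) =
        (\<Sum>i=1..<Suc (?x (Suc k)). ?D i)"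
      using grid_index_diff_le(1)[of "real k / real m" "real (Suc k) / real m" n]
      by (intro sum.atLeastLessThan_concat) (auto simp: divide_right_mono)
    then show ?case using Suc by simp
  qed (simp add: grid_index_def)
  also have "(\<Sum>i=1..<Suc (?x m). ?D i) \<le> (\<Sum>i=1..<n. ?D i)"
    using grid_index_less[OF \<open>n > 0\<close>, of "real m / real m"] by (intro sum_mono2) auto
  finally have "real m * (\<Sum>j<m. (N (step_fun n u (real (Suc j) / real m) - step_fun n u (real j / real m)))\<^sup>2)
      \<le> real m * ((real n / real m + 1) * (\<Sum>i=1..<n. ?D i))"
    by (simp add: mult_left_mono)
  also have "\<dots> = (1 + real m / real n) * disc_seminorm N n u"
    using assms by (simp add: disc_seminorm_def field_simps)
  finally show ?thesis
    using assms by (simp add: diff_quot_def is_norm_scaleR[OF N] power_mult_distrib power2_eq_square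
        sum_distrib_left sum_divide_distrib mult.assoc mult.left_commute)
qed

section \<open>Sobolev functions: the liminf inequality and sampling\<close>

lemma weak_deriv_spec:
  assumes "u \<in> H1"
  shows "weak_deriv u \<in> L2" "is_weak_deriv u (weak_deriv u)"
proof -
  have "\<exists>g. g \<in> L2 \<and> is_weak_deriv u g"
    using assms by (auto simp: H1_def)
  from someI_ex[OF this] show "weak_deriv u \<in> L2" "is_weak_deriv u (weak_deriv u)"
    by (auto simp: weak_deriv_def)
qed

lemma H1_continuous_on: "u \<in> H1 \<Longrightarrow> continuous_on {0..1} u"
  by (simp add: H1_def)

lemma is_primitive_weak_deriv: "u \<in> H1 \<Longrightarrow> is_primitive u (weak_deriv u)"
  by (intro weak_deriv_imp_is_primitive H1_continuous_on L2_absolutely_integrable weak_deriv_spec)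

lemma continuous_on_imp_L2:
  assumes "continuous_on {0..1} u"
  shows "u \<in> L2"
proof -
  have "(\<lambda>t. (norm (u t))\<^sup>2) absolutely_integrable_on {0..1}"
    by (intro absolutely_integrable_continuous_real continuous_intros assms)
  then show ?thesis
    using assms by (auto simp: L2_def intro: absolutely_integrable_imp_integrable
        continuous_imp_measurable_on_sets_lebesgue)
qed

text \<open>By \<open>is_primitive_unique\<close> the chosen weak derivative agrees with
  \<open>g\<close> almost everywhere, so the energy can be computed from whichever derivative an
  argument produces.\<close>

lemma is_primitive_imp_H1:
  assumes "u \<in> extensional {0..1}" "g \<in> L2" "is_primitive u g" and N: "is_norm N"
  shows "u \<in> H1" "(L2_norm N (weak_deriv u))\<^sup>2 = integral {0..1} (\<lambda>t. (N (g t))\<^sup>2)"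
proof -
  have gi: "g integrable_on {0..1}"
    using L2_absolutely_integrable[OF assms(2)] by (simp add: absolutely_integrable_on_def)
  have "continuous_on {0..1} u"
    using is_primitive_continuous_on[OF gi assms(3)] .
  then show H: "u \<in> H1"
    using assms is_primitive_imp_weak_deriv[OF L2_absolutely_integrable[OF assms(2)] assms(3)]
    by (auto simp: H1_def continuous_on_imp_L2)
  have wi: "weak_deriv u integrable_on {0..1}"
    using L2_absolutely_integrable[OF weak_deriv_spec(1)[OF H]] by (simp add: absolutely_integrable_on_def)
  have "negligible {t \<in> {0..1}. weak_deriv u t \<noteq> g t}"
    by (rule is_primitive_unique[OF wi gi is_primitive_weak_deriv[OF H] assms(3)])
  then have "integral {0..1} (\<lambda>t. (N (weak_deriv u t))\<^sup>2) = integral {0..1} (\<lambda>t. (N (g t))\<^sup>2)"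
    by (rule integral_spike) auto
  then show "(L2_norm N (weak_deriv u))\<^sup>2 = integral {0..1} (\<lambda>t. (N (g t))\<^sup>2)"
    by (simp add: L2_norm_square[OF weak_deriv_spec(1)[OF H] N])
qed

text \<open>For fixed \<open>m\<close> the difference quotients of the step functions converge to
  those of \<open>u\<close>, because only the \<open>m + 1\<close> grid points matter, and the
  factor \<open>1 + m / n k\<close> tends to 1. So \<open>A\<close> bounds the quotients of
  \<open>u\<close> on every grid. That the seminorms converge, and do not merely have a lower limit,
  is arranged by the choice of subsequence in \<open>compactness_liminf\<close>.\<close>

lemma disc_seminorm_liminf:
  fixes u :: "real \<Rightarrow> 'a::euclidean_space"
  assumes N: "is_norm N" and u: "continuous_on {0..1} u" "u \<in> extensional {0..1}"
    and n: "\<And>k. n k > 0" "filterlim n at_top sequentially"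
    and conv: "\<And>t. t \<in> {0..1} \<Longrightarrow> (\<lambda>k. step_fun (n k) (v k) t) \<longlonglongrightarrow> u t"
    and A: "(\<lambda>k. disc_seminorm N (n k) (v k)) \<longlonglongrightarrow> A"
  shows "u \<in> H1" "(L2_norm N (weak_deriv u))\<^sup>2 \<le> A"
proof -
  have "(\<Sum>j<m. (N (diff_quot u m j))\<^sup>2) / real m \<le> A" if "m > 0" for m
  proof (rule LIMSEQ_le)
    show "(\<lambda>k. (\<Sum>j<m. (N (diff_quot (step_fun (n k) (v k)) m j))\<^sup>2) / real m) \<longlonglongrightarrow>
        (\<Sum>j<m. (N (diff_quot u m j))\<^sup>2) / real m"
    proof (intro tendsto_divide tendsto_sum tendsto_power tendsto_is_norm[OF N] tendsto_const)
      fix j assume "j \<in> {..<m}"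
      then show "(\<lambda>k. diff_quot (step_fun (n k) (v k)) m j) \<longlonglongrightarrow> diff_quot u m j"
        unfolding diff_quot_def by (intro tendsto_intros conv) auto
    qed (use that in simp)
    have "(\<lambda>k. (1 + real m / real (n k)) * disc_seminorm N (n k) (v k)) \<longlonglongrightarrow> (1 + 0) * A"
      using n(2)
      by (intro tendsto_intros A tendsto_divide_0[OF tendsto_const] filterlim_at_top_imp_at_infinity
          filterlim_compose[OF filterlim_real_sequentially])
    then show "(\<lambda>k. (1 + real m / real (n k)) * disc_seminorm N (n k) (v k)) \<longlonglongrightarrow> A"
      by simp
    show "\<exists>k0. \<forall>k\<ge>k0. (\<Sum>j<m. (N (diff_quot (step_fun (n k) (v k)) m j))\<^sup>2) / real m
        \<le> (1 + real m / real (n k)) * disc_seminorm N (n k) (v k)"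
      using sum_step_fun_increments_le[OF N n(1) that] by blast
  qed
  then obtain g where g: "g \<in> L2" "is_primitive u g" "integral {0..1} (\<lambda>t. (N (g t))\<^sup>2) \<le> A"
    using bounded_diff_quot_imp_primitive[OF N u(1)] by blast
  show "u \<in> H1" "(L2_norm N (weak_deriv u))\<^sup>2 \<le> A"
    using is_primitive_imp_H1[OF u(2) g(1,2) N] g(3) by auto
qed

definition sample :: "nat \<Rightarrow> (real \<Rightarrow> 'a) \<Rightarrow> nat \<Rightarrow> 'a" where
  "sample n u = restrict (\<lambda>i. u (real i / real n)) {..<n}"

text \<open>The sample stops at \<open>(n - 1)/n\<close>, so its increments are the first
  \<open>n - 1\<close> of the \<open>n\<close> grid increments of \<open>u\<close>; adding the last
  one gives the sum bounded by \<open>sum_diff_quot_le\<close>.\<close>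

lemma disc_seminorm_sample_le:
  assumes "u \<in> H1" "is_norm N" "n > 0"
  shows "disc_seminorm N n (sample n u) \<le> (L2_norm N (weak_deriv u))\<^sup>2"
proof -
  let ?D = "\<lambda>i. (N (u (real (Suc i) / real n) - u (real i / real n)))\<^sup>2"
  have "(\<Sum>i=1..<n. (N (sample n u i - sample n u (i - 1)))\<^sup>2) = (\<Sum>i=1..<n. ?D (i - 1))"
    by (intro sum.cong refl) (auto simp: sample_def)
  also have "\<dots> = (\<Sum>i=0..<n - 1. ?D i)"
    using sum.shift_bounds_Suc_ivl[of "\<lambda>i. ?D (i - 1)" 0 "n - 1"] \<open>n > 0\<close> by simp
  also have "\<dots> \<le> (\<Sum>i<n. ?D i)"
    by (intro sum_mono2) auto
  finally have "disc_seminorm N n (sample n u) \<le> real n * (\<Sum>i<n. ?D i)"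
    unfolding disc_seminorm_def by (intro mult_left_mono) auto
  also have "\<dots> = (\<Sum>j<n. (N (diff_quot u n j))\<^sup>2) / real n"
    using assms(3) by (simp add: diff_quot_def is_norm_scaleR[OF assms(2)] power_mult_distrib
        power2_eq_square sum_distrib_left sum_divide_distrib mult.assoc mult.left_commute)
  also have "\<dots> \<le> (L2_norm N (weak_deriv u))\<^sup>2"
    unfolding L2_norm_square[OF weak_deriv_spec(1)[OF assms(1)] assms(2)]
    by (intro sum_diff_quot_le weak_deriv_spec is_primitive_weak_deriv assms)
  finally show ?thesis .
qed

lemma step_fun_sample_tendsto:
  fixes u :: "real \<Rightarrow> 'a::euclidean_space"
  assumes u: "continuous_on {0..1} u" and t: "t \<in> {0..1}"
    and n: "\<And>k. n k > 0" "filterlim n at_top sequentially"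
  shows "(\<lambda>k. step_fun (n k) (sample (n k) u) t) \<longlonglongrightarrow> u t"
proof -
  define s where "s = (\<lambda>k. real (grid_index (n k) t) / real (n k))"
  have "step_fun (n k) (sample (n k) u) t = u (s k)" for k
    using grid_index_less[OF n(1)] by (simp add: step_fun_def sample_def s_def)
  moreover have "(\<lambda>k. u (s k)) \<longlonglongrightarrow> u t"
  proof (rule continuous_on_tendsto_compose[OF u _ t])
    \<comment> \<open>The clamped index moves the evaluation point for \<open>t = 1\<close> a full
      cell to the left, which is still within \<open>1 / n k\<close>.\<close>
    have s: "t - 1 / real (n k) \<le> s k \<and> s k \<le> t" for k
    proof -
      have f: "real (nat \<lfloor>real (n k) * t\<rfloor>) = of_int \<lfloor>real (n k) * t\<rfloor>"
        using t by simp
      have "real (grid_index (n k) t) \<le> real (n k) * t"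
        unfolding grid_index_def of_nat_min f by linarith
      moreover have "real (n k) * t \<le> real (n k)"
        using t by (simp add: mult_left_le)
      then have "real (n k) * t - 1 \<le> real (grid_index (n k) t)"
        unfolding grid_index_def of_nat_min f using n(1)[of k] by (simp add: of_nat_diff Suc_le_eq)
      ultimately show ?thesis
        using n(1)[of k] pos_le_divide_eq[of "real (n k)" t "real (grid_index (n k) t) + 1"]
        by (simp add: s_def pos_divide_le_eq mult.commute add_divide_distrib)
    qed
    have "(\<lambda>k. t - 1 / real (n k)) \<longlonglongrightarrow> t - 0"
      using n(2)
      by (intro tendsto_intros tendsto_divide_0[OF tendsto_const] filterlim_at_top_imp_at_infinity
          filterlim_compose[OF filterlim_real_sequentially])
    then show "s \<longlonglongrightarrow> t"
      using s by (intro tendsto_sandwich[of "\<lambda>k. t - 1 / real (n k)" s sequentially "\<lambda>_. t"])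
        (auto intro: always_eventually)
    show "\<forall>\<^sub>F k in sequentially. s k \<in> {0..1}"
    proof (intro always_eventually allI)
      fix k
      show "s k \<in> {0..1}"
        using s[of k] t by (auto simp: s_def)
    qed
  qed
  ultimately show ?thesis by simp
qed

section \<open>Convergence of the Euler scheme\<close>

text \<open>Compactness yields subsequences only. This recovers convergence of the whole sequence
  once all the sublimits agree, for the Euler states by uniqueness of the solution and for the
  minimal energies because they equal the infimum.\<close>

lemma LIMSEQ_subsubseq:
  fixes f :: "nat \<Rightarrow> 'a::metric_space"
  assumes "\<And>r :: nat \<Rightarrow> nat. strict_mono r \<Longrightarrow> \<exists>q. strict_mono q \<and> (\<lambda>k. f (r (q k))) \<longlonglongrightarrow> l"
  shows "f \<longlonglongrightarrow> l"
proof (rule ccontr)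
  assume "\<not> f \<longlonglongrightarrow> l"
  then obtain e where e: "e > 0" "\<And>N. \<exists>n\<ge>N. dist (f n) l \<ge> e"
    unfolding lim_sequentially by (metis not_le)
  then have "infinite {n. dist (f n) l \<ge> e}"
    unfolding infinite_nat_iff_unbounded_le by simp
  then obtain r :: "nat \<Rightarrow> nat" where r: "strict_mono r" "\<And>n. dist (f (r n)) l \<ge> e"
    using infinite_enumerate by blast
  obtain q :: "nat \<Rightarrow> nat" where "(\<lambda>k. f (r (q k))) \<longlonglongrightarrow> l"
    using assms[OF r(1)] by blast
  then obtain k where "dist (f (r (q k))) l < e"
    using e(1) unfolding lim_sequentially by blast
  with r(2)[of "q k"] show False by simp
qed

lemma bounded_bilinear_matrix_vector_mult:
  "bounded_bilinear ((*v) :: real^'n^'m \<Rightarrow> real^'n \<Rightarrow> real^'m)"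
proof -
  have "bilinear ((*v) :: real^'n^'m \<Rightarrow> real^'n \<Rightarrow> real^'m)"
    unfolding bilinear_def
    by (intro conjI allI linearI)
      (simp_all add: matrix_vector_mult_add_rdistrib matrix_vector_right_distrib
        scaleR_matrix_vector_assoc[symmetric] matrix_vector_mult_scaleR)
  then show ?thesis
    by (simp add: bilinear_conv_bounded_bilinear)
qed

lemma lipschitz_norm_le:
  assumes "C-lipschitz_on UNIV \<sigma>" "\<sigma> 0 = 0"
  shows "norm (\<sigma> v) \<le> C * norm v"
  using lipschitz_onD[OF assms(1), of v 0] assms(2) by simp

text \<open>Discrete Gronwall: \<open>norm + 1\<close> grows at each step by a factor of at most
  \<open>1 + C * \<kappa> / n\<close>, hence at most \<open>exp (C * \<kappa> / n)\<close>. The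
  summand 1 absorbs the bias, and the bound does not depend on \<open>n\<close>.\<close>

lemma disc_state_bound:
  assumes \<sigma>: "C-lipschitz_on UNIV \<sigma>" "\<sigma> 0 = 0" and "\<kappa> \<ge> 0" "n > 0"
    and K: "\<And>i z. i < n \<Longrightarrow> norm (K i *v z) \<le> \<kappa> * norm z" and b: "\<And>i. i < n \<Longrightarrow> norm (b i) \<le> \<kappa>"
    and "i \<le> n"
  shows "norm (disc_state \<sigma> n K b x i) + 1 \<le> (norm x + 1) * exp (C * \<kappa>)"
proof -
  let ?X = "disc_state \<sigma> n K b x"
  define y where "y = C * \<kappa> / real n"
  have C0: "C \<ge> 0"
    using \<sigma>(1) lipschitz_on_nonneg by blast
  have y0: "y \<ge> 0"
    using C0 \<open>\<kappa> \<ge> 0\<close> by (simp add: y_def)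
  have "norm (?X i) + 1 \<le> (norm x + 1) * exp (real i * y)"
    using \<open>i \<le> n\<close>
  proof (induction i)
    case (Suc i)
    then have i: "i < n" by simp
    have "norm (\<sigma> (K i *v ?X i + b i)) \<le> C * norm (K i *v ?X i + b i)"
      by (rule lipschitz_norm_le[OF \<sigma>])
    also have "\<dots> \<le> C * (\<kappa> * norm (?X i) + \<kappa>)"
      using norm_triangle_ineq[of "K i *v ?X i" "b i"] K[OF i, of "?X i"] b[OF i]
      by (intro mult_left_mono C0) linarith
    finally have "norm (\<sigma> (K i *v ?X i + b i)) \<le> C * \<kappa> * (norm (?X i) + 1)"
      by (simp add: algebra_simps)
    then have "(1 / real n) * norm (\<sigma> (K i *v ?X i + b i)) \<le> (1 / real n) * (C * \<kappa> * (norm (?X i) + 1))"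
      by (intro mult_left_mono) auto
    then have "norm (?X (Suc i)) + 1 \<le> (1 + y) * (norm (?X i) + 1)"
      using norm_triangle_ineq[of "?X i" "(1 / real n) *\<^sub>R \<sigma> (K i *v ?X i + b i)"]
      by (simp add: y_def algebra_simps)
    also have "\<dots> \<le> exp y * ((norm x + 1) * exp (real i * y))"
      using Suc y0 by (intro mult_mono exp_ge_add_one_self) auto
    also have "\<dots> = (norm x + 1) * exp (real (Suc i) * y)"
      by (simp add: exp_add[symmetric] algebra_simps)
    finally show ?case .
  qed simp
  also have "\<dots> \<le> (norm x + 1) * exp (C * \<kappa>)"
  proof (intro mult_left_mono)
    have "real i * y \<le> real n * y"
      using \<open>i \<le> n\<close> y0 by (intro mult_right_mono) auto
    also have "\<dots> = C * \<kappa>"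
      using \<open>n > 0\<close> by (simp add: y_def)
    finally show "exp (real i * y) \<le> exp (C * \<kappa>)" by simp
  qed simp
  finally show ?thesis .
qed

lemma disc_state_eq_sum:
  "disc_state \<sigma> n K b x j = x + (1 / real n) *\<^sub>R (\<Sum>i<j. \<sigma> (K i *v disc_state \<sigma> n K b x i + b i))"
  by (induction j) (simp_all add: scaleR_add_right)

text \<open>Gronwall in differential form: the bias cancels in the difference \<open>Z\<close>,
  whose speed is at most \<open>L * norm (Z t)\<close>, so \<open>Z t \<bullet> Z t\<close> times
  \<open>exp (- 2 * L * t)\<close> is nonincreasing and starts at 0. Uniqueness gives
  \<open>cont_state\<close>, an arbitrary choice, a definite value.\<close>

lemma solves_ode_unique:
  fixes \<sigma> :: "real^'d \<Rightarrow> real^'d"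
  assumes \<sigma>: "C-lipschitz_on UNIV \<sigma>" and K: "continuous_on {0..1} K"
    and X: "solves_ode \<sigma> K b x X" and Y: "solves_ode \<sigma> K b x Y" and t: "t \<in> {0..1}"
  shows "X t = Y t"
proof -
  interpret mv: bounded_bilinear "(*v) :: real^'d^'d \<Rightarrow> real^'d \<Rightarrow> real^'d"
    by (rule bounded_bilinear_matrix_vector_mult)
  obtain M where M: "M \<ge> 0" "\<And>(A :: real^'d^'d) z. norm (A *v z) \<le> norm A * norm z * M"
    using mv.nonneg_bounded by blast
  have "bounded (K ` {0..1})"
    by (intro compact_imp_bounded compact_continuous_image K) simp
  then obtain B where B: "\<And>t. t \<in> {0..1} \<Longrightarrow> norm (K t) \<le> B"
    by (metis bounded_iff imageI)
  have C0: "C \<ge> 0"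
    using \<sigma> lipschitz_on_nonneg by blast
  define L where "L = C * (B * M)"
  define Z where "Z = (\<lambda>t. X t - Y t)"
  define Z' where "Z' = (\<lambda>t. \<sigma> (K t *v X t + b t) - \<sigma> (K t *v Y t + b t))"
  have dZ: "(Z has_vector_derivative Z' t) (at t within {0..1})" if "t \<in> {0..1}" for t
    using X Y that unfolding solves_ode_def Z_def Z'_def by (intro has_vector_derivative_diff) auto
  have bZ: "norm (Z' t) \<le> L * norm (Z t)" if "t \<in> {0..1}" for t
  proof -
    have "norm (Z' t) \<le> C * norm ((K t *v X t + b t) - (K t *v Y t + b t))"
      unfolding Z'_def using lipschitz_onD[OF \<sigma> UNIV_I UNIV_I] by (simp only: dist_norm)
    also have "\<dots> = C * norm (K t *v Z t)"
      by (simp add: Z_def matrix_vector_mult_diff_distrib)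
    also have "\<dots> \<le> C * (B * norm (Z t) * M)"
      using M B[OF that] by (intro mult_left_mono C0 order_trans[OF M(2)] mult_right_mono) auto
    finally show ?thesis
      by (simp add: L_def algebra_simps)
  qed
  define f where "f = (\<lambda>t. (Z t \<bullet> Z t) * exp (- 2 * L * t))"
  have cZ: "continuous_on {0..1} Z"
    using dZ by (intro continuous_on_vector_derivative)
  have cf: "continuous_on {0..1} f"
    unfolding f_def by (intro continuous_intros cZ)
  have "f t \<le> f 0"
  proof (rule DERIV_nonpos_imp_decreasing_open[of 0 t f])
    show "0 \<le> t" using t by simp
    show "continuous_on {0..t} f"
      using cf by (rule continuous_on_subset) (use t in auto)
    fix s assume s: "0 < s" "s < t"
    then have s01: "s \<in> {0..1}" "s \<in> interior {0..1}" using t by auto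
    have "(Z has_vector_derivative Z' s) (at s)"
      using dZ[OF s01(1)] s01(2) by (simp only: at_within_interior)
    then have "((\<lambda>t. Z t \<bullet> Z t) has_vector_derivative (Z s \<bullet> Z' s + Z' s \<bullet> Z s)) (at s)"
      by (rule bounded_bilinear.has_vector_derivative[OF bounded_bilinear_inner])
        (use \<open>(Z has_vector_derivative Z' s) (at s)\<close> in assumption)
    then have "((\<lambda>t. Z t \<bullet> Z t) has_real_derivative 2 * (Z s \<bullet> Z' s)) (at s)"
      by (simp add: has_real_derivative_iff_has_vector_derivative inner_commute)
    then have df: "(f has_real_derivative
        2 * (Z s \<bullet> Z' s) * exp (- 2 * L * s) + (Z s \<bullet> Z s) * (exp (- 2 * L * s) * (- 2 * L))) (at s)"
      unfolding f_def by (auto intro!: derivative_eq_intros simp: algebra_simps)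
    have "Z s \<bullet> Z' s \<le> norm (Z s) * norm (Z' s)"
      by (rule norm_cauchy_schwarz)
    also have "\<dots> \<le> norm (Z s) * (L * norm (Z s))"
      by (intro mult_left_mono bZ s01) simp
    also have "\<dots> = L * (Z s \<bullet> Z s)"
      by (simp add: power2_norm_eq_inner[symmetric] power2_eq_square)
    finally have "2 * (Z s \<bullet> Z' s - L * (Z s \<bullet> Z s)) \<le> 0"
      by simp
    then have "2 * (Z s \<bullet> Z' s - L * (Z s \<bullet> Z s)) * exp (- 2 * L * s) \<le> 0"
      by (rule mult_nonpos_nonneg) simp
    then have "2 * (Z s \<bullet> Z' s) * exp (- 2 * L * s) + (Z s \<bullet> Z s) * (exp (- 2 * L * s) * (- 2 * L)) \<le> 0"
      by (simp add: algebra_simps)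
    with df show "\<exists>y. (f has_real_derivative y) (at s) \<and> y \<le> 0"
      by blast
  qed
  also have "f 0 = 0"
    using X Y by (simp add: f_def Z_def solves_ode_def)
  finally have "Z t \<bullet> Z t \<le> 0"
    by (simp add: f_def mult_le_0_iff not_le)
  then have "Z t = 0"
    by (metis inner_eq_zero_iff inner_ge_zero order_antisym)
  then show ?thesis
    by (simp add: Z_def)
qed

text \<open>The Euler polygons are equicontinuous in the limit, and every limit point satisfies the integral
  equation.\<close>

lemma disc_state_subseq_converges:
  fixes \<sigma> :: "real^'d \<Rightarrow> real^'d"
  assumes \<sigma>: "C-lipschitz_on UNIV \<sigma>" "\<sigma> 0 = 0"
    and n: "\<And>k. n k > 0" "filterlim n at_top sequentially"
    and bound: "\<And>k i. i < n k \<Longrightarrow> norm (K k i) \<le> B" "\<And>k i. i < n k \<Longrightarrow> norm (b k i) \<le> B"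
    and K: "\<And>t. t \<in> {0..1} \<Longrightarrow> (\<lambda>k. step_fun (n k) (K k) t) \<longlonglongrightarrow> K' t" "continuous_on {0..1} K'"
    and b: "\<And>t. t \<in> {0..1} \<Longrightarrow> (\<lambda>k. step_fun (n k) (b k) t) \<longlonglongrightarrow> b' t" "continuous_on {0..1} b'"
  obtains q X where "strict_mono (q :: nat \<Rightarrow> nat)" "solves_ode \<sigma> K' b' x X"
    "(\<lambda>k. disc_state \<sigma> (n (q k)) (K (q k)) (b (q k)) x (n (q k))) \<longlonglongrightarrow> X 1"
proof -
  interpret mv: bounded_bilinear "(*v) :: real^'d^'d \<Rightarrow> real^'d \<Rightarrow> real^'d"
    by (rule bounded_bilinear_matrix_vector_mult)
  obtain M where M: "M > 0" "\<And>(A :: real^'d^'d) z. norm (A *v z) \<le> norm A * norm z * M"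
    using mv.pos_bounded by blast
  have C0: "C \<ge> 0"
    using \<sigma>(1) lipschitz_on_nonneg by blast
  have B0: "B \<ge> 0"
    using bound(1)[of 0 0] n(1)[of 0] norm_ge_zero order_trans by blast
  define \<kappa> where "\<kappa> = max (B * M) B"
  have \<kappa>0: "\<kappa> \<ge> 0"
    using B0 by (simp add: \<kappa>_def)
  have K\<kappa>: "norm (K k i *v z) \<le> \<kappa> * norm z" if "i < n k" for k i z
  proof -
    have "norm (K k i *v z) \<le> norm (K k i) * norm z * M"
      by (rule M)
    also have "\<dots> \<le> B * norm z * M"
      using M(1) bound(1)[OF that] by (intro mult_right_mono) auto
    also have "\<dots> = B * M * norm z" by simp
    also have "\<dots> \<le> \<kappa> * norm z"
      unfolding \<kappa>_def by (intro mult_right_mono) auto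
    finally show ?thesis .
  qed
  have b\<kappa>: "norm (b k i) \<le> \<kappa>" if "i < n k" for k i
    using bound(2)[OF that] by (simp add: \<kappa>_def)
  define X where "X = (\<lambda>k. disc_state \<sigma> (n k) (K k) (b k) x)"
  define R where "R = (norm x + 1) * exp (C * \<kappa>)"
  have R: "norm (X k i) \<le> R" if "i \<le> n k" for k i
  proof -
    have "norm (X k i) + 1 \<le> R"
      unfolding X_def R_def by (rule disc_state_bound[OF \<sigma> \<kappa>0 n(1)]) (use K\<kappa> b\<kappa> that in auto)
    then show ?thesis by simp
  qed
  define V where "V = C * (\<kappa> * R + \<kappa>)"
  have R0: "R \<ge> 0"
    by (simp add: R_def)
  have V0: "V \<ge> 0"
    using C0 \<kappa>0 R0 by (simp add: V_def)
  \<comment> \<open>Coefficient and state carry separate indices because at \<open>t = 1\<close> the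
    clamped coefficients of index \<open>n k - 1\<close> meet the state of index
    \<open>n k\<close>.\<close>
  have V: "norm (\<sigma> (K k i *v X k j + b k i)) \<le> V" if "i < n k" "j \<le> n k" for k i j
  proof -
    have "norm (K k i *v X k j + b k i) \<le> \<kappa> * norm (X k j) + \<kappa>"
      using norm_triangle_ineq[of "K k i *v X k j" "b k i"] K\<kappa>[OF that(1), of "X k j"] b\<kappa>[OF that(1)]
      by linarith
    also have "\<dots> \<le> \<kappa> * R + \<kappa>"
      using R[OF that(2)] \<kappa>0 by (simp add: mult_left_mono)
    finally show ?thesis
      using lipschitz_norm_le[OF \<sigma>, of "K k i *v X k j + b k i"] C0
      unfolding V_def by (meson mult_left_mono order_trans)
  qed
  have idx: "nat \<lfloor>real (n k) * t\<rfloor> \<le> n k" if "t \<in> {0..1}" for k t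
  proof -
    have "real (n k) * t \<le> real (n k)"
      using that by (simp add: mult_left_le)
    then have "\<lfloor>real (n k) * t\<rfloor> \<le> int (n k)"
      by (simp add: floor_le_iff)
    then show ?thesis by simp
  qed
  \<comment> \<open>Here \<open>pw_const\<close> is the right reading at \<open>t = 1\<close>: there
    are \<open>n + 1\<close> states, and index \<open>n k\<close> is the final state whose limit is
    wanted.\<close>
  define f where "f = (\<lambda>k. pw_const (n k) (X k))"
  have incr: "norm (X k j - X k i) \<le> (real j - real i) * (V / real (n k))" if "i \<le> j" "j \<le> n k" for k i j
    using that
  proof (induction j rule: dec_induct)
    case (step j)
    have "X k (Suc j) - X k i = (X k j - X k i) + (1 / real (n k)) *\<^sub>R \<sigma> (K k j *v X k j + b k j)"
      by (simp add: X_def)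
    also have "norm \<dots> \<le> norm (X k j - X k i) + (1 / real (n k)) * norm (\<sigma> (K k j *v X k j + b k j))"
      using norm_triangle_ineq[of "X k j - X k i"] by (metis norm_scaleR abs_of_nonneg zero_le_divide_1_iff of_nat_0_le_iff)
    also have "\<dots> \<le> (real j - real i) * (V / real (n k)) + (1 / real (n k)) * V"
      using step V[of j k j] by (intro add_mono mult_left_mono) auto
    also have "\<dots> = (real (Suc j) - real i) * (V / real (n k))"
      by (simp add: algebra_simps add_divide_distrib diff_divide_distrib)
    finally show ?case .
  qed simp
  have f_incr: "norm (f k t - f k s) \<le> V * (t - s + 1 / real (n k))"
    if "s \<in> {0..1}" "t \<in> {0..1}" "s \<le> t" for k s t
  proof -
    have s0: "0 \<le> s" using that by simp
    have "norm (f k t - f k s) \<le>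
        (real (nat \<lfloor>real (n k) * t\<rfloor>) - real (nat \<lfloor>real (n k) * s\<rfloor>)) * (V / real (n k))"
      unfolding f_def pw_const_def
      by (intro incr nat_floor_diff_le idx that s0)
    also have "\<dots> \<le> (real (n k) * (t - s) + 1) * (V / real (n k))"
      using V0 by (intro mult_right_mono nat_floor_diff_le that s0) auto
    also have "\<dots> = V * (t - s + 1 / real (n k))"
      using n(1)[of k] by (simp add: field_simps)
    finally show ?thesis .
  qed
  have inv_n: "(\<lambda>k. 1 / real (n k)) \<longlonglongrightarrow> 0"
    using n(2)
    by (intro tendsto_divide_0[OF tendsto_const] filterlim_at_top_imp_at_infinity
        filterlim_compose[OF filterlim_real_sequentially])
  obtain q g where q: "strict_mono q" and g: "continuous_on {0..1} g"
    "\<And>t. t \<in> {0..1} \<Longrightarrow> (\<lambda>k. f (q k) t) \<longlonglongrightarrow> g t"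
  proof (rule asymptotically_equicontinuous_subseq[of f R])
    show "norm (f k t) \<le> R" if "t \<in> {0..1}" for k t
      unfolding f_def pw_const_def by (intro R idx that)
    fix e :: real assume "e > 0"
    define \<delta> where "\<delta> = e / (2 * (V + 1))"
    have \<delta>: "\<delta> > 0"
      using \<open>e > 0\<close> V0 by (simp add: \<delta>_def)
    obtain k0 where k0: "\<And>k. k \<ge> k0 \<Longrightarrow> 1 / real (n k) < \<delta>"
      using LIMSEQ_D[OF inv_n \<delta>] by auto
    have small: "norm (f k t - f k s) < e"
      if "k \<ge> k0" "s \<in> {0..1}" "t \<in> {0..1}" "s \<le> t" "t - s < \<delta>" for k s t
    proof -
      have "norm (f k t - f k s) \<le> V * (t - s + 1 / real (n k))"
        by (intro f_incr that)
      also have "\<dots> \<le> V * (\<delta> + \<delta>)"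
        using k0[OF that(1)] that V0 by (intro mult_left_mono) auto
      also have "\<dots> < (V + 1) * (\<delta> + \<delta>)"
        using \<delta> by (intro mult_strict_right_mono) auto
      also have "\<dots> = e"
        using V0 unfolding \<delta>_def by (simp add: field_simps add_nonneg_eq_0_iff)
      finally show ?thesis .
    qed
    show "\<exists>\<delta>>0. \<exists>k0. \<forall>k\<ge>k0. \<forall>s\<in>{0..1}. \<forall>t\<in>{0..1}. \<bar>s - t\<bar> < \<delta> \<longrightarrow> norm (f k s - f k t) < e"
    proof (intro exI[of _ \<delta>] conjI \<delta> exI[of _ k0] allI ballI impI)
      fix k s t assume *: "k \<ge> k0" "s \<in> {0..1}" "t \<in> {0..1}" "\<bar>s - t\<bar> < \<delta>"
      show "norm (f k s - f k t) < e"
        using small[of k s t] small[of k t s] * by (cases "s \<le> t") (auto simp: norm_minus_commute)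
    qed
  qed (rule that)
  \<comment> \<open>Clamping lets \<open>P\<close> be expressed by the step functions of
    \<open>K\<close> and \<open>b\<close> up to \<open>t = 1\<close>. Below index \<open>n k\<close>
    it changes nothing, so partial sums of \<open>c\<close> are those of the Euler scheme.\<close>
  define c where "c = (\<lambda>k i. \<sigma> (K k (min i (n k - 1)) *v X k i + b k (min i (n k - 1))))"
  define P where "P = (\<lambda>k. pw_const (n k) (c k))"
  define F where "F = (\<lambda>t. \<sigma> (K' t *v g t + b' t))"
  have P_eq: "P k t = \<sigma> (step_fun (n k) (K k) t *v f k t + step_fun (n k) (b k) t)" for k t
    by (simp add: P_def c_def f_def step_fun_eq_pw_const_clamped pw_const_def)
  have P_bound: "norm (P k t) \<le> V" if "t \<in> {0..1}" for k t
    unfolding P_def c_def pw_const_def using n(1)[of k] by (intro V idx that) auto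
  have \<sigma>_cont: "continuous_on UNIV \<sigma>"
    using \<sigma>(1) by (rule lipschitz_on_continuous_on)
  have q_lim: "filterlim q at_top sequentially"
    using q by (rule filterlim_subseq)
  have P_lim: "(\<lambda>k. P (q k) t) \<longlonglongrightarrow> F t" if "t \<in> {0..1}" for t
    unfolding P_eq F_def
  proof (rule continuous_on_tendsto_compose[OF \<sigma>_cont])
    show "(\<lambda>k. step_fun (n (q k)) (K (q k)) t *v f (q k) t + step_fun (n (q k)) (b (q k)) t)
        \<longlonglongrightarrow> K' t *v g t + b' t"
      using filterlim_compose[OF K(1)[OF that] q_lim] filterlim_compose[OF b(1)[OF that] q_lim] g(2)[OF that]
      by (intro tendsto_add mv.tendsto) auto
  qed auto
  have P_int: "P k integrable_on {0..1}" for k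
    unfolding P_def using has_integral_pw_const_unit[OF n(1)] by blast
  have g_eq: "g t = x + integral {0..t} F" if t: "t \<in> {0..1}" for t
  proof -
    have sub: "{0..t} \<subseteq> {0..1}" using t by auto
    have lim1: "(\<lambda>k. integral {0..t} (P (q k))) \<longlonglongrightarrow> integral {0..t} F"
    proof (rule dominated_convergence(2)[where h = "\<lambda>_. V"])
      show "P (q k) integrable_on {0..t}" for k
        using integrable_on_subinterval[OF P_int sub] .
    qed (use P_bound P_lim sub in auto)
    \<comment> \<open>Up to the last grid point \<open>j / n k\<close> not after \<open>t\<close>
      the Euler sum is exactly an integral of \<open>P\<close>. The remaining interval is at most
      \<open>1 / n k\<close> long, and \<open>P\<close> is at most \<open>V\<close> there.\<close>
    have est: "norm (x + integral {0..t} (P k) - f k t) \<le> V * (1 / real (n k))" for k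
    proof -
      define j where "j = nat \<lfloor>real (n k) * t\<rfloor>"
      have jn: "j \<le> n k" using idx[OF t] by (simp add: j_def)
      have j: "real j = of_int \<lfloor>real (n k) * t\<rfloor>"
        using t by (simp add: j_def)
      have "real j \<le> real (n k) * t" "real (n k) * t \<le> real j + 1"
        unfolding j by linarith+
      then have jt: "real j / real (n k) \<le> t" "t - real j / real (n k) \<le> 1 / real (n k)"
        using n(1)[of k] pos_le_divide_eq[of "real (n k)" t "real j + 1"]
        by (simp_all add: pos_divide_le_eq mult.commute add_divide_distrib)
      have "f k t = X k j"
        by (simp add: f_def pw_const_def j_def)
      also have "\<dots> = x + (1 / real (n k)) *\<^sub>R (\<Sum>i<j. \<sigma> (K k i *v X k i + b k i))"
        unfolding X_def by (rule disc_state_eq_sum)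
      also have "(\<Sum>i<j. \<sigma> (K k i *v X k i + b k i)) = (\<Sum>i<j. c k i)"
      proof (intro sum.cong refl)
        fix i assume "i \<in> {..<j}"
        then have "min i (n k - 1) = i" using jn by auto
        then show "\<sigma> (K k i *v X k i + b k i) = c k i" by (simp add: c_def)
      qed
      also have "(1 / real (n k)) *\<^sub>R (\<Sum>i<j. c k i) = integral {0..real j / real (n k)} (P k)"
        unfolding P_def using has_integral_pw_const[OF n(1), of k "c k" j] by (simp add: integral_unique)
      finally have "x + integral {0..t} (P k) - f k t = integral {real j / real (n k)..t} (P k)"
        using integral_eq_diff[OF P_int, of "real j / real (n k)" t k] jt t by simp
      also have "norm \<dots> \<le> V * (t - real j / real (n k))"
      proof -
        have sub': "{real j / real (n k)..t} \<subseteq> {0..1}" using t by auto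
        have "norm (integral {real j / real (n k)..t} (P k)) \<le> integral {real j / real (n k)..t} (\<lambda>_. V)"
          using P_bound[OF subsetD[OF sub']]
          by (intro integral_norm_bound_integral integrable_on_subinterval[OF P_int sub']) auto
        then show ?thesis
          using jt by (simp add: mult.commute)
      qed
      also have "\<dots> \<le> V * (1 / real (n k))"
        by (intro mult_left_mono jt V0)
      finally show ?thesis .
    qed
    have "(\<lambda>k. V * (1 / real (n (q k)))) \<longlonglongrightarrow> V * 0"
      by (intro tendsto_mult tendsto_const filterlim_compose[OF inv_n q_lim])
    then have "(\<lambda>k. x + integral {0..t} (P (q k)) - f (q k) t) \<longlonglongrightarrow> 0"
      by (intro Lim_null_comparison[OF always_eventually[OF allI[OF est]]]) simp
    moreover have "(\<lambda>k. x + integral {0..t} (P (q k)) - f (q k) t) \<longlonglongrightarrow> x + integral {0..t} F - g t"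
      by (intro tendsto_intros lim1 g(2) t)
    ultimately have "x + integral {0..t} F - g t = 0"
      by (rule LIMSEQ_unique[rotated])
    then show ?thesis by simp
  qed
  have F_cont: "continuous_on {0..1} F"
    unfolding F_def
    by (intro continuous_on_compose2[OF \<sigma>_cont] continuous_on_add mv.continuous_on K(2) b(2) g(1)) auto
  have "solves_ode \<sigma> K' b' x g"
    unfolding solves_ode_def
  proof (intro conjI ballI)
    show "g 0 = x"
      using g_eq[of 0] by simp
    fix t :: real assume t: "t \<in> {0..1}"
    have "((\<lambda>t. x + integral {0..t} F) has_vector_derivative (0 + F t)) (at t within {0..1})"
      by (intro has_vector_derivative_add has_vector_derivative_const integral_has_vector_derivative F_cont t)
    then have "(g has_vector_derivative (0 + F t)) (at t within {0..1})"
      by (rule has_vector_derivative_transform[OF t g_eq, rotated]) simp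
    then show "(g has_vector_derivative \<sigma> (K' t *v g t + b' t)) (at t within {0..1})"
      by (simp add: F_def)
  qed
  moreover have "(\<lambda>k. disc_state \<sigma> (n (q k)) (K (q k)) (b (q k)) x (n (q k))) \<longlonglongrightarrow> g 1"
    using g(2)[of 1] by (simp add: f_def X_def pw_const_def)
  ultimately show thesis
    using that q by blast
qed

text \<open>The Euler scheme for the samples of \<open>K\<close> and \<open>b\<close> has a
  subsequence converging to a solution, which is the witness that the choice operator needs. The
  grid sizes \<open>Suc k\<close> are positive and tend to infinity.\<close>

lemma solves_ode_cont_state:
  fixes \<sigma> :: "real^'d \<Rightarrow> real^'d"
  assumes \<sigma>: "C-lipschitz_on UNIV \<sigma>" "\<sigma> 0 = 0"
    and K: "continuous_on {0..1} K" and b: "continuous_on {0..1} b"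
  shows "solves_ode \<sigma> K b x (cont_state \<sigma> K b x)"
proof -
  have n: "\<And>k. Suc k > 0" "filterlim Suc at_top sequentially"
    by (simp_all add: filterlim_Suc)
  have "bounded (K ` {0..1} )" "bounded (b ` {0..1})"
    by (intro compact_imp_bounded compact_continuous_image K b compact_Icc)+
  then obtain B1 B2 where B: "\<And>t. t \<in> {0..1} \<Longrightarrow> norm (K t) \<le> B1" "\<And>t. t \<in> {0..1} \<Longrightarrow> norm (b t) \<le> B2"
    by (metis bounded_iff imageI)
  have "norm (sample (Suc k) K i) \<le> max B1 B2" "norm (sample (Suc k) b i) \<le> max B1 B2" if "i < Suc k" for k i
    using that B(1)[of "real i / real (Suc k)"] B(2)[of "real i / real (Suc k)"]
    by (auto simp: sample_def le_max_iff_disj)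
  then obtain q X where "solves_ode \<sigma> K b x X"
    by (rule disc_state_subseq_converges[OF \<sigma> n _ _ step_fun_sample_tendsto[OF K _ n] K
        step_fun_sample_tendsto[OF b _ n] b])
  then show ?thesis
    unfolding cont_state_def by (rule someI[where P = "solves_ode \<sigma> K b x"])
qed

text \<open>Every subsequence has a further one whose final states tend to \<open>X 1\<close> for
  some solution \<open>X\<close>; by uniqueness this is always the same vector.\<close>

lemma disc_state_tendsto_cont_state:
  fixes \<sigma> :: "real^'d \<Rightarrow> real^'d"
  assumes \<sigma>: "C-lipschitz_on UNIV \<sigma>" "\<sigma> 0 = 0"
    and n: "\<And>k. n k > 0" "filterlim n at_top sequentially"
    and bound: "\<And>k i. i < n k \<Longrightarrow> norm (K k i) \<le> B" "\<And>k i. i < n k \<Longrightarrow> norm (b k i) \<le> B"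
    and K: "\<And>t. t \<in> {0..1} \<Longrightarrow> (\<lambda>k. step_fun (n k) (K k) t) \<longlonglongrightarrow> K' t" "continuous_on {0..1} K'"
    and b: "\<And>t. t \<in> {0..1} \<Longrightarrow> (\<lambda>k. step_fun (n k) (b k) t) \<longlonglongrightarrow> b' t" "continuous_on {0..1} b'"
  shows "(\<lambda>k. disc_state \<sigma> (n k) (K k) (b k) x (n k)) \<longlonglongrightarrow> cont_state \<sigma> K' b' x 1"
proof (rule LIMSEQ_subsubseq)
  fix r :: "nat \<Rightarrow> nat" assume r: "strict_mono r"
  have r_lim: "filterlim r at_top sequentially"
    using r by (rule filterlim_subseq)
  obtain q X where q: "strict_mono (q :: nat \<Rightarrow> nat)" and X: "solves_ode \<sigma> K' b' x X"
    and lim: "(\<lambda>k. disc_state \<sigma> (n (r (q k))) (K (r (q k))) (b (r (q k))) x (n (r (q k)))) \<longlonglongrightarrow> X 1"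
  proof (rule disc_state_subseq_converges[of C \<sigma> "\<lambda>k. n (r k)" "\<lambda>k. K (r k)" B "\<lambda>k. b (r k)" K' b' x])
    show "filterlim (\<lambda>k. n (r k)) at_top sequentially"
      by (rule filterlim_compose[OF n(2) r_lim])
    show "(\<lambda>k. step_fun (n (r k)) (K (r k)) t) \<longlonglongrightarrow> K' t" if "t \<in> {0..1}" for t
      by (rule filterlim_compose[OF K(1)[OF that] r_lim])
    show "(\<lambda>k. step_fun (n (r k)) (b (r k)) t) \<longlonglongrightarrow> b' t" if "t \<in> {0..1}" for t
      by (rule filterlim_compose[OF b(1)[OF that] r_lim])
  qed (use \<sigma> n(1) bound K(2) b(2) that in auto)
  have "X 1 = cont_state \<sigma> K' b' x 1"
    by (rule solves_ode_unique[OF \<sigma>(1) K(2) X solves_ode_cont_state[OF \<sigma> K(2) b(2)]]) simp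
  then show "\<exists>q. strict_mono q \<and>
      (\<lambda>k. disc_state \<sigma> (n (r (q k))) (K (r (q k))) (b (r (q k))) x (n (r (q k)))) \<longlonglongrightarrow> cont_state \<sigma> K' b' x 1"
    using q lim by auto
qed

section \<open>Limits in the square norm and a priori bounds\<close>

text \<open>At \<open>t = 1\<close> the function \<open>pw_const n u\<close> reads index
  \<open>n\<close>, outside the tuple, where nothing is controlled.\<close>

lemma AE_neq_1: "AE t in lebesgue_on {0..1}. t \<noteq> (1::real)"
proof (rule AE_I')
  show "{1} \<in> null_sets (lebesgue_on {0..1::real})"
    by (simp add: null_sets_restrict_space)
qed auto

lemma pw_const_L2:
  fixes u :: "nat \<Rightarrow> 'a::euclidean_space"
  assumes "n > 0"
  shows "pw_const n u \<in> L2"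
  unfolding L2_def mem_Collect_eq pw_const_comp[of "\<lambda>v. (norm v)\<^sup>2"]
  using measurable_pw_const[OF assms] integrable_pw_const[OF assms, of "\<lambda>i. (norm (u i))\<^sup>2"]
  by simp

text \<open>Plays the part of Minkowski's inequality where two limits of one sequence are
  compared.\<close>

lemma is_norm_diff_square_le:
  assumes "is_norm N"
  shows "(N (v - w))\<^sup>2 \<le> 2 * (N (z - v))\<^sup>2 + 2 * (N (z - w))\<^sup>2"
proof -
  have "N (v - w) \<le> N (z - v) + N (z - w)"
    using is_norm_triangle[OF assms, of "v - z" "z - w"] is_norm_diff_commute[OF assms, of v z] by simp
  then have "(N (v - w))\<^sup>2 \<le> (N (z - v) + N (z - w))\<^sup>2"
    by (intro power_mono is_norm_nonneg[OF assms])
  also have "\<dots> \<le> 2 * (N (z - v))\<^sup>2 + 2 * (N (z - w))\<^sup>2"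
    using sum_squares_bound[of "N (z - v)" "N (z - w)"] by (simp add: power2_sum)
  finally show ?thesis .
qed

lemma is_norm_norm: "is_norm norm"
  by (simp add: is_norm_def norm_triangle_ineq)

lemma L2_diff:
  assumes "f \<in> L2" "g \<in> L2"
  shows "(\<lambda>t. f t - g t) \<in> L2"
proof -
  have [measurable]: "f \<in> borel_measurable (lebesgue_on {0..1})" "g \<in> borel_measurable (lebesgue_on {0..1})"
    using assms by (auto intro: L2_measurable)
  have "integrable (lebesgue_on {0..1}) (\<lambda>t. 2 * (norm (f t))\<^sup>2 + 2 * (norm (g t))\<^sup>2)"
    using assms by (auto simp: L2_def)
  then have "integrable (lebesgue_on {0..1}) (\<lambda>t. (norm (f t - g t))\<^sup>2)"
  proof (rule Bochner_Integration.integrable_bound)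
    show "AE t in lebesgue_on {0..1}. norm ((norm (f t - g t))\<^sup>2) \<le>
        norm (2 * (norm (f t))\<^sup>2 + 2 * (norm (g t))\<^sup>2)"
      using is_norm_diff_square_le[OF is_norm_norm, of "f _" "g _" 0] by (intro AE_I2) simp
  qed measurable
  then show ?thesis
    by (simp add: L2_def)
qed

text \<open>The integral of \<open>(N (u t - v t))^2\<close> is bounded by quantities tending to 0,
  and a continuous nonnegative function with zero integral vanishes. Outside the unit interval
  \<open>u\<close> and \<open>v\<close> agree as extensional functions. Membership of
  \<open>f k\<close> in \<open>L2\<close> is asked only eventually because a grid size along the
  sequence may at first be 0.\<close>

lemma L2_limit_unique:
  fixes f :: "nat \<Rightarrow> real \<Rightarrow> 'a::euclidean_space"
  assumes N: "is_norm N" and f: "\<forall>\<^sub>F k in sequentially. f k \<in> L2"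
    and u: "continuous_on {0..1} u" "u \<in> extensional {0..1}"
    and v: "continuous_on {0..1} v" "v \<in> extensional {0..1}"
    and lim: "(\<lambda>k. L2_norm N (\<lambda>t. f k t - u t)) \<longlonglongrightarrow> 0" "(\<lambda>k. L2_norm N (\<lambda>t. f k t - v t)) \<longlonglongrightarrow> 0"
  shows "u = v"
proof -
  let ?I = "integral {0..1} (\<lambda>t. (N (u t - v t))\<^sup>2)"
  have uv: "continuous_on {0..1} (\<lambda>t. (N (u t - v t))\<^sup>2)"
    by (intro continuous_intros continuous_on_compose2[OF continuous_on_is_norm[OF N, of UNIV]] u v) auto
  have uL: "u \<in> L2" "v \<in> L2"
    using u v by (auto intro: continuous_on_imp_L2)
  have "\<forall>\<^sub>F k in sequentially. ?I \<le> 2 * (L2_norm N (\<lambda>t. f k t - u t))\<^sup>2 + 2 * (L2_norm N (\<lambda>t. f k t - v t))\<^sup>2"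
    using f
  proof eventually_elim
    case (elim k)
    have L: "(\<lambda>t. f k t - u t) \<in> L2" "(\<lambda>t. f k t - v t) \<in> L2"
      using elim uL by (auto intro: L2_diff)
    have i: "(\<lambda>t. (N (f k t - u t))\<^sup>2) integrable_on {0..1}" "(\<lambda>t. (N (f k t - v t))\<^sup>2) integrable_on {0..1}"
      using absolutely_integrable_is_norm_square[OF L(1) N] absolutely_integrable_is_norm_square[OF L(2) N]
      by (simp_all add: absolutely_integrable_on_def)
    have "((\<lambda>t. 2 * (N (f k t - u t))\<^sup>2 + 2 * (N (f k t - v t))\<^sup>2) has_integral
        2 * (L2_norm N (\<lambda>t. f k t - u t))\<^sup>2 + 2 * (L2_norm N (\<lambda>t. f k t - v t))\<^sup>2) {0..1}"
      unfolding L2_norm_square[OF L(1) N] L2_norm_square[OF L(2) N]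
      by (intro has_integral_add has_integral_mult_right integrable_integral i)
    then show ?case
      by (rule has_integral_le[OF integrable_integral[OF integrable_continuous_real[OF uv]]])
        (rule is_norm_diff_square_le[OF N])
  qed
  moreover have "(\<lambda>k. 2 * (L2_norm N (\<lambda>t. f k t - u t))\<^sup>2 + 2 * (L2_norm N (\<lambda>t. f k t - v t))\<^sup>2)
      \<longlonglongrightarrow> 2 * 0\<^sup>2 + 2 * 0\<^sup>2"
    by (intro tendsto_intros lim)
  ultimately have "?I \<le> 2 * 0\<^sup>2 + 2 * 0\<^sup>2"
    by (intro tendsto_lowerbound) auto
  moreover have "?I \<ge> 0"
    by (intro integral_nonneg integrable_continuous_real uv) simp
  ultimately have "?I = 0" by simp
  then have "(N (u t - v t))\<^sup>2 = 0" if "t \<in> {0..1}" for t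
    using integral_eq_0_iff[OF uv] that by simp
  then have "u t = v t" if "t \<in> {0..1}" for t
    using that by (simp add: is_norm_eq_0_iff[OF N])
  then show ?thesis
    using u(2) v(2) by (intro extensionalityI)
qed

text \<open>Dominated convergence with a constant majorant. Bounds and convergence are transferred
  from \<open>step_fun\<close>, with which \<open>pw_const\<close> agrees on the half-open
  interval.\<close>

lemma L2_norm_pw_const_tendsto_0:
  fixes u :: "real \<Rightarrow> 'a::euclidean_space"
  assumes N: "is_norm N" and u: "continuous_on {0..1} u" and n: "\<And>k. n k > 0"
    and bound: "\<And>k i. i < n k \<Longrightarrow> norm (v k i) \<le> B"
    and conv: "\<And>t. t \<in> {0..1} \<Longrightarrow> (\<lambda>k. step_fun (n k) (v k) t) \<longlonglongrightarrow> u t"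
  shows "(\<lambda>k. L2_norm N (\<lambda>t. pw_const (n k) (v k) t - u t)) \<longlonglongrightarrow> 0"
proof -
  let ?L = "lebesgue_on {0..1::real}"
  have [measurable]: "N \<in> borel_measurable borel"
    by (intro borel_measurable_continuous_onI continuous_on_is_norm N)
  have [measurable]: "u \<in> borel_measurable ?L" "pw_const (n k) (v k) \<in> borel_measurable ?L" for k
    using u n by (auto intro: continuous_imp_measurable_on_sets_lebesgue measurable_pw_const)
  obtain C where C: "C > 0" "\<And>x. N x \<le> C * norm x"
    using is_norm_le_norm[OF N] by blast
  have "bounded (u ` {0..1})"
    by (intro compact_imp_bounded compact_continuous_image u) simp
  then obtain B' where B': "\<And>t. t \<in> {0..1} \<Longrightarrow> norm (u t) \<le> B'"
    by (metis bounded_iff imageI)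
  have "(\<lambda>k. integral\<^sup>L ?L (\<lambda>t. (N (pw_const (n k) (v k) t - u t))\<^sup>2)) \<longlonglongrightarrow> integral\<^sup>L ?L (\<lambda>t. 0)"
  proof (rule integral_dominated_convergence[where w = "\<lambda>_. (C * (B + B'))\<^sup>2"])
    show "AE t in ?L. (\<lambda>k. (N (pw_const (n k) (v k) t - u t))\<^sup>2) \<longlonglongrightarrow> 0"
      using AE_neq_1 AE_space
    proof eventually_elim
      case (elim t)
      then have "(\<lambda>k. pw_const (n k) (v k) t - u t) \<longlonglongrightarrow> u t - u t"
        using conv[of t] by (intro tendsto_intros) (simp add: step_fun_eq_pw_const)
      then have "(\<lambda>k. (N (pw_const (n k) (v k) t - u t))\<^sup>2) \<longlonglongrightarrow> (N (u t - u t))\<^sup>2"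
        by (intro tendsto_power tendsto_is_norm[OF N])
      then show ?case
        by (simp add: is_norm_zero[OF N])
    qed
    show "AE t in ?L. norm ((N (pw_const (n k) (v k) t - u t))\<^sup>2) \<le> (C * (B + B'))\<^sup>2" for k
      using AE_neq_1 AE_space
    proof eventually_elim
      case (elim t)
      then have "pw_const (n k) (v k) t = v k (grid_index (n k) t)"
        using step_fun_eq_pw_const[of t "n k" "v k"] by (simp add: step_fun_def)
      then have "norm (pw_const (n k) (v k) t - u t) \<le> B + B'"
        using bound[OF grid_index_less[OF n]] B'[of t] elim norm_triangle_ineq4
        by (metis add_mono order_trans space_lebesgue_on)
      then have "N (pw_const (n k) (v k) t - u t) \<le> C * (B + B')"
        using C by (meson mult_left_mono less_imp_le order_trans)
      then show ?case
        by (simp add: is_norm_nonneg[OF N] power_mono)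
    qed
    show "integrable ?L (\<lambda>_. (C * (B + B'))\<^sup>2)"
      by (rule absolutely_integrable_imp_integrable) auto
  qed measurable
  then show ?thesis
    unfolding L2_norm_def using tendsto_real_sqrt by fastforce
qed

lemma step_fun_asymptotically_equicontinuous:
  fixes v :: "nat \<Rightarrow> nat \<Rightarrow> 'a::euclidean_space"
  assumes N: "is_norm N" and n: "\<And>k. n k > 0" "filterlim n at_top sequentially"
    and bound: "\<And>k. disc_seminorm N (n k) (v k) \<le> B" and "e > 0"
  shows "\<exists>\<delta>>0. \<exists>k0. \<forall>k\<ge>k0. \<forall>s\<in>{0..1}. \<forall>t\<in>{0..1}.
    \<bar>s - t\<bar> < \<delta> \<longrightarrow> norm (step_fun (n k) (v k) s - step_fun (n k) (v k) t) < e"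
proof -
  obtain C where C: "C > 0" "\<And>x. norm x \<le> C * N x"
    using norm_le_is_norm[OF N] by blast
  have B0: "B \<ge> 0"
    using order_trans[OF disc_seminorm_nonneg bound] .
  \<comment> \<open>One \<open>\<delta>\<close> is for the distance of \<open>s\<close> and
    \<open>t\<close>, the other for \<open>1 / n k\<close>. With \<open>B + 1\<close> in place of
    \<open>B\<close> the quotient is defined even for \<open>B = 0\<close> and the final inequality
    is strict.\<close>
  define \<delta> where "\<delta> = e\<^sup>2 / (2 * C\<^sup>2 * (B + 1))"
  have \<delta>: "\<delta> > 0"
    using C B0 \<open>e > 0\<close> by (simp add: \<delta>_def)
  have \<delta>e: "C\<^sup>2 * ((\<delta> + \<delta>) * (B + 1)) = e\<^sup>2"
    using C B0 by (simp add: \<delta>_def field_simps add_nonneg_eq_0_iff)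
  have inv_n: "(\<lambda>k. 1 / real (n k)) \<longlonglongrightarrow> 0"
    using n(2)
    by (intro tendsto_divide_0[OF tendsto_const] filterlim_at_top_imp_at_infinity
        filterlim_compose[OF filterlim_real_sequentially])
  obtain k0 where k0: "\<And>k. k \<ge> k0 \<Longrightarrow> 1 / real (n k) < \<delta>"
    using LIMSEQ_D[OF inv_n \<delta>] by auto
  have small: "norm (step_fun (n k) (v k) t - step_fun (n k) (v k) s) < e"
    if "k \<ge> k0" "s \<in> {0..1}" "t \<in> {0..1}" "s \<le> t" "t - s < \<delta>" for k s t
  proof -
    let ?d = "step_fun (n k) (v k) t - step_fun (n k) (v k) s"
    have "(norm ?d)\<^sup>2 \<le> (C * N ?d)\<^sup>2"
      by (intro power_mono C) simp
    also have "\<dots> = C\<^sup>2 * (N ?d)\<^sup>2"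
      by (simp add: power_mult_distrib)
    also have "\<dots> \<le> C\<^sup>2 * ((t - s + 1 / real (n k)) * disc_seminorm N (n k) (v k))"
      using that by (intro mult_left_mono step_fun_holder[OF N n(1)]) auto
    also have "\<dots> \<le> C\<^sup>2 * ((\<delta> + \<delta>) * B)"
      using k0[OF that(1)] that bound[of k] \<delta> disc_seminorm_nonneg[of N "n k" "v k"]
      by (intro mult_left_mono mult_mono) auto
    also have "\<dots> < C\<^sup>2 * ((\<delta> + \<delta>) * (B + 1))"
      using C \<delta> by (intro mult_strict_left_mono) auto
    also have "\<dots> = e\<^sup>2"
      by (rule \<delta>e)
    finally show ?thesis
      using \<open>e > 0\<close> by (simp add: power2_less_imp_less)
  qed
  show ?thesis
  proof (intro exI[of _ \<delta>] conjI \<delta> exI[of _ k0] allI ballI impI)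
    fix k s t assume *: "k \<ge> k0" "s \<in> {0..1}" "t \<in> {0..1}" "\<bar>s - t\<bar> < \<delta>"
    show "norm (step_fun (n k) (v k) s - step_fun (n k) (v k) t) < e"
      using small[of k s t] small[of k t s] * by (cases "s \<le> t") (auto simp: norm_minus_commute)
  qed
qed

section \<open>Coercivity and continuity of the discrete energy\<close>

lemma is_norm_square_bound:
  fixes N :: "'a::euclidean_space \<Rightarrow> real"
  assumes "is_norm N" "a > 0"
  obtains B where "\<And>v. a * (N v)\<^sup>2 \<le> M \<Longrightarrow> norm v \<le> B"
proof -
  obtain C where C: "C > 0" "\<And>x. norm x \<le> C * N x"
    using norm_le_is_norm[OF assms(1)] by blast
  have "norm v \<le> C * sqrt (M / a)" if "a * (N v)\<^sup>2 \<le> M" for v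
  proof -
    have "(N v)\<^sup>2 \<le> M / a"
      using that \<open>a > 0\<close> by (simp add: field_simps)
    then have "N v \<le> sqrt (M / a)"
      by (rule real_le_rsqrt)
    then show ?thesis
      using C by (meson mult_left_mono less_imp_le order_trans)
  qed
  then show thesis
    using that by blast
qed

text \<open>A discrete Poincare inequality: \<open>\<tau>\<close> controls \<open>u 0\<close>, and
  at most \<open>n\<close> increments lead from there to \<open>u i\<close>, so the square of
  \<open>N (u i - u 0)\<close> is at most the seminorm. The factor \<open>n\<close> in the seminorm
  is what makes the bound uniform in \<open>n\<close>.\<close>

lemma disc_reg_bound:
  fixes N :: "'a::euclidean_space \<Rightarrow> real"
  assumes N: "is_norm N" and "a > 0" "\<tau> > 0"
  obtains B where "\<And>n u i. a * disc_reg N \<tau> n u \<le> M \<Longrightarrow> i < n \<Longrightarrow> norm (u i) \<le> B"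
    "\<And>n u. a * disc_reg N \<tau> n u \<le> M \<Longrightarrow> disc_seminorm N n u \<le> B"
proof -
  obtain C where C: "C > 0" "\<And>x. norm x \<le> C * N x"
    using norm_le_is_norm[OF N] by blast
  have 1: "disc_seminorm N n u \<le> M / a" and 2: "N (u 0) \<le> sqrt (M / (a * \<tau>))"
    if "a * disc_reg N \<tau> n u \<le> M" for n u
  proof -
    have "a * disc_seminorm N n u + a * \<tau> * (N (u 0))\<^sup>2 \<le> M"
      using that by (simp add: disc_reg_eq algebra_simps)
    moreover have "a * disc_seminorm N n u \<ge> 0" "a * \<tau> * (N (u 0))\<^sup>2 \<ge> 0"
      using assms disc_seminorm_nonneg[of N n u] by simp_all
    ultimately have "a * disc_seminorm N n u \<le> M" "a * \<tau> * (N (u 0))\<^sup>2 \<le> M"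
      by linarith+
    then show "disc_seminorm N n u \<le> M / a" "N (u 0) \<le> sqrt (M / (a * \<tau>))"
      using assms by (auto intro!: real_le_rsqrt simp: field_simps)
  qed
  have 3: "norm (u i) \<le> C * (sqrt (M / a) + sqrt (M / (a * \<tau>)))"
    if reg: "a * disc_reg N \<tau> n u \<le> M" and "i < n" for n u i
  proof -
    have "(N (u i - u 0))\<^sup>2 \<le> (real i - real 0) * (\<Sum>j=Suc 0..<Suc i. (N (u j - u (j - 1)))\<^sup>2)"
      by (rule is_norm_increment_square_le[OF N]) simp
    also have "\<dots> \<le> real n * (\<Sum>j=1..<n. (N (u j - u (j - 1)))\<^sup>2)"
      using \<open>i < n\<close> by (intro mult_mono sum_mono2 sum_nonneg) auto
    also have "\<dots> \<le> M / a"
      using 1[OF reg] by (simp add: disc_seminorm_def)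
    finally have "N (u i - u 0) \<le> sqrt (M / a)"
      by (rule real_le_rsqrt)
    then have "N (u i) \<le> sqrt (M / a) + sqrt (M / (a * \<tau>))"
      using is_norm_triangle[OF N, of "u i - u 0" "u 0"] 2[OF reg] by simp
    then show ?thesis
      using C by (meson mult_left_mono less_imp_le order_trans)
  qed
  show thesis
    using 1 3 that[of "max (M / a) (C * (sqrt (M / a) + sqrt (M / (a * \<tau>))))"]
    by (meson le_max_iff_disj)
qed

lemma disc_state_tendsto:
  fixes \<sigma> :: "real^'d \<Rightarrow> real^'d"
  assumes \<sigma>: "continuous_on UNIV \<sigma>"
    and K: "\<And>i. i < n \<Longrightarrow> (\<lambda>k. K k i) \<longlonglongrightarrow> K' i" and b: "\<And>i. i < n \<Longrightarrow> (\<lambda>k. b k i) \<longlonglongrightarrow> b' i"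
    and "j \<le> n"
  shows "(\<lambda>k. disc_state \<sigma> n (K k) (b k) x j) \<longlonglongrightarrow> disc_state \<sigma> n K' b' x j"
  using \<open>j \<le> n\<close>
proof (induction j)
  case (Suc j)
  then show ?case
    using K[of j] b[of j]
    by (auto intro!: tendsto_intros continuous_on_tendsto_compose[OF \<sigma>]
        bounded_bilinear.tendsto[OF bounded_bilinear_matrix_vector_mult])
qed simp

lemma disc_reg_tendsto:
  fixes N :: "'a::euclidean_space \<Rightarrow> real"
  assumes N: "is_norm N" and "n > 0" and u: "\<And>i. i < n \<Longrightarrow> (\<lambda>k. u k i) \<longlonglongrightarrow> u' i"
  shows "(\<lambda>k. disc_reg N \<tau> n (u k)) \<longlonglongrightarrow> disc_reg N \<tau> n u'"
  unfolding disc_reg_def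
  by (intro tendsto_add tendsto_mult tendsto_const tendsto_sum tendsto_power tendsto_is_norm[OF N]
      tendsto_diff u) (use \<open>n > 0\<close> in auto)

text \<open>The minimiser itself supplies the nonemptiness and the lower bound that the
  conditionally complete infimum of reals requires.\<close>

lemma is_arg_min_imp_eq_INF:
  fixes f :: "'a \<Rightarrow> real"
  assumes "is_arg_min f (\<lambda>\<eta>. \<eta> \<in> A) \<theta>"
  shows "f \<theta> = (INF \<eta>\<in>A. f \<eta>)"
proof -
  have *: "\<theta> \<in> A" "\<And>\<eta>. \<eta> \<in> A \<Longrightarrow> f \<theta> \<le> f \<eta>"
    using assms by (auto simp: is_arg_min_def not_less)
  show ?thesis
  proof (rule antisym)
    show "f \<theta> \<le> (INF \<eta>\<in>A. f \<eta>)"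
      using * by (intro cINF_greatest) auto
    show "(INF \<eta>\<in>A. f \<eta>) \<le> f \<theta>"
      using * by (intro cINF_lower bdd_belowI[of _ "f \<theta>"]) auto
  qed
qed

section \<open>The variational problems\<close>

lemma disc_reg_nonneg: "\<tau>' > 0 \<Longrightarrow> 0 \<le> disc_reg N \<tau>' n u"
  by (simp add: disc_reg_eq disc_seminorm_nonneg)

locale training_problem =
  fixes \<sigma> :: "real^'d \<Rightarrow> real^'d"
    and h :: "real^'m \<Rightarrow> real^'m"
    and \<L> :: "real^'m \<Rightarrow> real^'m \<Rightarrow> real"
    and N\<^sub>K :: "real^'d^'d \<Rightarrow> real"
    and N\<^sub>b :: "real^'d \<Rightarrow> real"
    and N\<^sub>W :: "real^'d^'m \<Rightarrow> real"
    and N\<^sub>c :: "real^'m \<Rightarrow> real"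
    and \<alpha> \<tau> :: "nat \<Rightarrow> real"
    and S :: nat
    and x :: "nat \<Rightarrow> real^'d"
    and y :: "nat \<Rightarrow> real^'m"
    and C :: real
  assumes norms: "is_norm N\<^sub>K" "is_norm N\<^sub>b" "is_norm N\<^sub>W" "is_norm N\<^sub>c"
    and \<alpha>_pos: "\<alpha> 1 > 0" "\<alpha> 2 > 0" "\<alpha> 3 > 0" "\<alpha> 4 > 0"
    and \<tau>_pos: "\<tau> 1 > 0" "\<tau> 2 > 0"
    and h_cont: "continuous_on UNIV h"
    and \<sigma>_lipschitz: "C-lipschitz_on UNIV \<sigma>" and \<sigma>_0: "\<sigma> 0 = 0"
    and \<L>_nonneg: "\<And>u v. \<L> u v \<ge> 0" and \<L>_cont: "\<And>v. continuous_on UNIV (\<lambda>u. \<L> u v)"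
begin

abbreviation "En \<equiv> disc_energy \<sigma> h \<L> N\<^sub>K N\<^sub>b N\<^sub>W N\<^sub>c \<alpha> \<tau> S x y"
abbreviation "Einf \<equiv> cont_energy \<sigma> h \<L> N\<^sub>K N\<^sub>b N\<^sub>W N\<^sub>c \<alpha> \<tau> S x y"
abbreviation "D \<equiv> param_dist N\<^sub>K N\<^sub>b N\<^sub>W N\<^sub>c"

lemma En_eq: "En n (K, b, W, c) = (\<Sum>s=1..S. \<L> (h (W *v disc_state \<sigma> n K b (x s) n + c)) (y s))
     + \<alpha> 1 * disc_reg N\<^sub>K (\<tau> 1) n K + \<alpha> 2 * disc_reg N\<^sub>b (\<tau> 2) n b
     + \<alpha> 3 * (N\<^sub>W W)\<^sup>2 + \<alpha> 4 * (N\<^sub>c c)\<^sup>2"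
  by (simp add: disc_energy_def)

lemma Einf_eq: "Einf (K, b, W, c) = (\<Sum>s=1..S. \<L> (h (W *v cont_state \<sigma> K b (x s) 1 + c)) (y s))
     + \<alpha> 1 * cont_reg N\<^sub>K (\<tau> 1) K + \<alpha> 2 * cont_reg N\<^sub>b (\<tau> 2) b
     + \<alpha> 3 * (N\<^sub>W W)\<^sup>2 + \<alpha> 4 * (N\<^sub>c c)\<^sup>2"
  by (simp add: cont_energy_def)

lemma loss_tendsto:
  assumes "W \<longlonglongrightarrow> W'" "X \<longlonglongrightarrow> X'" "c \<longlonglongrightarrow> c'"
  shows "(\<lambda>k. \<L> (h (W k *v X k + c k)) v) \<longlonglongrightarrow> \<L> (h (W' *v X' + c')) v"
proof (rule continuous_on_tendsto_compose[OF \<L>_cont])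
  show "(\<lambda>k. h (W k *v X k + c k)) \<longlonglongrightarrow> h (W' *v X' + c')"
    using assms
    by (intro continuous_on_tendsto_compose[OF h_cont] tendsto_add
        bounded_bilinear.tendsto[OF bounded_bilinear_matrix_vector_mult]) auto
qed auto

lemma En_terms_nonneg:
  shows "0 \<le> (\<Sum>s=1..S. \<L> (h (W *v disc_state \<sigma> n K b (x s) n + c)) (y s))"
    "0 \<le> \<alpha> 1 * disc_reg N\<^sub>K (\<tau> 1) n K" "0 \<le> \<alpha> 2 * disc_reg N\<^sub>b (\<tau> 2) n b"
    "0 \<le> \<alpha> 3 * (N\<^sub>W W)\<^sup>2" "0 \<le> \<alpha> 4 * (N\<^sub>c c)\<^sup>2"
  using \<alpha>_pos \<tau>_pos by (simp_all add: sum_nonneg \<L>_nonneg disc_reg_nonneg)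

lemma En_nonneg: "0 \<le> En n \<theta>"
proof -
  obtain K b W c where "\<theta> = (K, b, W, c)" by (cases \<theta>)
  then show ?thesis
    using En_terms_nonneg(1)[of W n K b c] En_terms_nonneg(2)[of n K] En_terms_nonneg(3)[of n b]
      En_terms_nonneg(4)[of W] En_terms_nonneg(5)[of c] by (simp only: En_eq)
qed

text \<open>All five summands are nonnegative, so each is at most \<open>M\<close>. One
  \<open>B\<close> for every \<open>n\<close> serves both the existence proof at fixed
  \<open>n\<close> and compactness as \<open>n\<close> grows.\<close>

lemma En_bound:
  obtains B where
    "\<And>n K b W c i. En n (K, b, W, c) \<le> M \<Longrightarrow> i < n \<Longrightarrow> norm (K i) \<le> B"
    "\<And>n K b W c i. En n (K, b, W, c) \<le> M \<Longrightarrow> i < n \<Longrightarrow> norm (b i) \<le> B"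
    "\<And>n K b W c. En n (K, b, W, c) \<le> M \<Longrightarrow> norm W \<le> B"
    "\<And>n K b W c. En n (K, b, W, c) \<le> M \<Longrightarrow> norm c \<le> B"
    "\<And>n K b W c. En n (K, b, W, c) \<le> M \<Longrightarrow> disc_seminorm N\<^sub>K n K \<le> B"
    "\<And>n K b W c. En n (K, b, W, c) \<le> M \<Longrightarrow> disc_seminorm N\<^sub>b n b \<le> B"
proof -
  obtain B1 where B1: "\<And>n u i. \<alpha> 1 * disc_reg N\<^sub>K (\<tau> 1) n u \<le> M \<Longrightarrow> i < n \<Longrightarrow> norm (u i) \<le> B1"
    "\<And>n u. \<alpha> 1 * disc_reg N\<^sub>K (\<tau> 1) n u \<le> M \<Longrightarrow> disc_seminorm N\<^sub>K n u \<le> B1"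
    by (rule disc_reg_bound[OF norms(1) \<alpha>_pos(1) \<tau>_pos(1), of M]) (blast intro: that)
  obtain B2 where B2: "\<And>n u i. \<alpha> 2 * disc_reg N\<^sub>b (\<tau> 2) n u \<le> M \<Longrightarrow> i < n \<Longrightarrow> norm (u i) \<le> B2"
    "\<And>n u. \<alpha> 2 * disc_reg N\<^sub>b (\<tau> 2) n u \<le> M \<Longrightarrow> disc_seminorm N\<^sub>b n u \<le> B2"
    by (rule disc_reg_bound[OF norms(2) \<alpha>_pos(2) \<tau>_pos(2), of M]) (blast intro: that)
  obtain B3 where B3: "\<And>v. \<alpha> 3 * (N\<^sub>W v)\<^sup>2 \<le> M \<Longrightarrow> norm v \<le> B3"
    by (rule is_norm_square_bound[OF norms(3) \<alpha>_pos(3), of M]) (blast intro: that)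
  obtain B4 where B4: "\<And>v. \<alpha> 4 * (N\<^sub>c v)\<^sup>2 \<le> M \<Longrightarrow> norm v \<le> B4"
    by (rule is_norm_square_bound[OF norms(4) \<alpha>_pos(4), of M]) (blast intro: that)
  define B where "B = max (max B1 B2) (max B3 B4)"
  have B: "B1 \<le> B" "B2 \<le> B" "B3 \<le> B" "B4 \<le> B"
    by (auto simp: B_def)
  have *: "\<alpha> 1 * disc_reg N\<^sub>K (\<tau> 1) n K \<le> M" "\<alpha> 2 * disc_reg N\<^sub>b (\<tau> 2) n b \<le> M"
    "\<alpha> 3 * (N\<^sub>W W)\<^sup>2 \<le> M" "\<alpha> 4 * (N\<^sub>c c)\<^sup>2 \<le> M" if "En n (K, b, W, c) \<le> M" for n K b W c
    using that En_terms_nonneg(1)[of W n K b c] En_terms_nonneg(2)[of n K] En_terms_nonneg(3)[of n b]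
      En_terms_nonneg(4)[of W] En_terms_nonneg(5)[of c]
    unfolding En_eq by linarith+
  show thesis
    by (rule that[of B]) (use * B1 B2 B3 B4 B in \<open>meson order_trans\<close>)+
qed

text \<open>The direct method in finite dimension: a minimising sequence is bounded by
  \<open>En_bound\<close>, and the energy is continuous in the finitely many entries.\<close>

lemma disc_minimiser_exists:
  assumes "n > 0"
  shows "\<exists>\<theta>. is_arg_min (En n) (\<lambda>\<eta>. \<eta> \<in> Theta_disc n) \<theta>"
proof -
  let ?T = "Theta_disc n :: ('d, 'm) disc_param set"
  define I where "I = (INF \<eta>\<in>?T. En n \<eta>)"
  have bdd: "bdd_below (En n ` ?T)"
    using En_nonneg by (intro bdd_belowI[of _ 0]) auto
  have ne: "?T \<noteq> {}"
    by (auto simp: Theta_disc_def PiE_eq_empty_iff)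
  have "\<exists>\<eta>\<in>?T. En n \<eta> < I + 1 / real (Suc k)" for k
    using cINF_less_iff[OF ne bdd, of "I + 1 / real (Suc k)"] by (simp add: I_def)
  then obtain \<eta> where \<eta>: "\<And>k. \<eta> k \<in> ?T" "\<And>k. En n (\<eta> k) < I + 1 / real (Suc k)"
    by metis
  define K where "K = (\<lambda>k. fst (\<eta> k))"
  define b where "b = (\<lambda>k. fst (snd (\<eta> k)))"
  define W where "W = (\<lambda>k. fst (snd (snd (\<eta> k))))"
  define c where "c = (\<lambda>k. snd (snd (snd (\<eta> k))))"
  have \<eta>_eq: "\<eta> k = (K k, b k, W k, c k)" for k
    by (simp add: K_def b_def W_def c_def)
  have lim_En: "(\<lambda>k. En n (\<eta> k)) \<longlonglongrightarrow> I"
  proof (rule tendsto_sandwich)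
    show "\<forall>\<^sub>F k in sequentially. I \<le> En n (\<eta> k)"
      unfolding I_def by (intro always_eventually allI cINF_lower bdd \<eta>)
    show "\<forall>\<^sub>F k in sequentially. En n (\<eta> k) \<le> I + 1 / real (Suc k)"
      using \<eta>(2) by (intro always_eventually allI less_imp_le)
    have "(\<lambda>k. I + 1 / real (Suc k)) \<longlonglongrightarrow> I + 0"
      by (intro tendsto_add tendsto_const LIMSEQ_Suc[OF lim_1_over_n])
    then show "(\<lambda>k. I + 1 / real (Suc k)) \<longlonglongrightarrow> I" by simp
  qed simp
  have le: "En n (K k, b k, W k, c k) \<le> I + 1" for k
  proof -
    have "1 / real (Suc k) \<le> 1" by simp
    then show ?thesis
      using \<eta>(2)[of k] unfolding \<eta>_eq by linarith
  qed
  obtain B where B: "\<And>n K b W c i. En n (K, b, W, c) \<le> I + 1 \<Longrightarrow> i < n \<Longrightarrow> norm (K i) \<le> B"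
    "\<And>n K b W c i. En n (K, b, W, c) \<le> I + 1 \<Longrightarrow> i < n \<Longrightarrow> norm (b i) \<le> B"
    "\<And>n K b W c. En n (K, b, W, c) \<le> I + 1 \<Longrightarrow> norm W \<le> B"
    "\<And>n K b W c. En n (K, b, W, c) \<le> I + 1 \<Longrightarrow> norm c \<le> B"
    by (rule En_bound[of "I + 1"]) (blast intro: that)
  \<comment> \<open>\<open>W\<close> and \<open>c\<close> are repeated at each index, so that one
    extraction makes all four components converge; their limits are read off at index 0, available
    since \<open>n > 0\<close>.\<close>
  define f where "f = (\<lambda>k i. (K k i, b k i, W k, c k))"
  have "norm (f k i) \<le> 4 * B" if "i \<in> {..<n}" for k i
  proof -
    have "norm (f k i) \<le> norm (K k i) + (norm (b k i) + (norm (W k) + norm (c k)))"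
      unfolding f_def by (intro order_trans[OF norm_Pair_le] add_left_mono order_refl)
    also have "\<dots> \<le> B + (B + (B + B))"
      using that by (intro add_mono B[OF le]) auto
    finally show ?thesis by simp
  qed
  then obtain q where q: "strict_mono (q :: nat \<Rightarrow> nat)"
    "\<And>i. i \<in> {..<n} \<Longrightarrow> \<exists>l. (\<lambda>k. f (q k) i) \<longlonglongrightarrow> l"
    using function_convergent_subsequence[of "{..<n}" f "4 * B"] by (metis countable_finite finite_lessThan)
  then obtain l where l: "\<And>i. i < n \<Longrightarrow> (\<lambda>k. f (q k) i) \<longlonglongrightarrow> l i"
    by (metis lessThan_iff)
  define K' where "K' = restrict (\<lambda>i. fst (l i)) {..<n}"
  define b' where "b' = restrict (\<lambda>i. fst (snd (l i))) {..<n}"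
  define W' where "W' = fst (snd (snd (l 0)))"
  define c' where "c' = snd (snd (snd (l 0)))"
  have K: "(\<lambda>k. K (q k) i) \<longlonglongrightarrow> K' i" and b: "(\<lambda>k. b (q k) i) \<longlonglongrightarrow> b' i" if "i < n" for i
    using tendsto_fst[OF l[OF that]] tendsto_fst[OF tendsto_snd[OF l[OF that]]] that
    by (simp_all add: f_def K'_def b'_def)
  have W: "(\<lambda>k. W (q k)) \<longlonglongrightarrow> W'" and c: "(\<lambda>k. c (q k)) \<longlonglongrightarrow> c'"
    using tendsto_fst[OF tendsto_snd[OF tendsto_snd[OF l[OF assms]]]]
      tendsto_snd[OF tendsto_snd[OF tendsto_snd[OF l[OF assms]]]]
    by (simp_all add: f_def W'_def c'_def)
  have "(\<lambda>k. En n (\<eta> (q k))) \<longlonglongrightarrow> En n (K', b', W', c')"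
    unfolding \<eta>_eq En_eq
    by (intro tendsto_add tendsto_mult tendsto_const tendsto_sum tendsto_power
        tendsto_is_norm[OF norms(3)] tendsto_is_norm[OF norms(4)] disc_reg_tendsto[OF norms(1) assms]
        disc_reg_tendsto[OF norms(2) assms] loss_tendsto
        disc_state_tendsto[OF lipschitz_on_continuous_on[OF \<sigma>_lipschitz]] K b W c order_refl)
  moreover have "(\<lambda>k. En n (\<eta> (q k))) \<longlonglongrightarrow> I"
    using LIMSEQ_subseq_LIMSEQ[OF lim_En q(1)] by (simp add: o_def)
  ultimately have "En n (K', b', W', c') = I"
    by (rule LIMSEQ_unique)
  moreover have "(K', b', W', c') \<in> ?T"
    by (simp add: Theta_disc_def K'_def b'_def)
  moreover have "I \<le> En n \<eta>" if "\<eta> \<in> ?T" for \<eta>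
    unfolding I_def by (intro cINF_lower bdd that)
  ultimately have "is_arg_min (En n) (\<lambda>\<eta>. \<eta> \<in> ?T) (K', b', W', c')"
    unfolding is_arg_min_def by (auto simp: not_less)
  then show ?thesis by blast
qed

text \<open>Equicoercivity and the liminf inequality along one subsequence. States, initial values,
  \<open>W\<close> and \<open>c\<close> converge, so the loss and the remaining terms pass to the
  limit exactly; only the two seminorms can drop.\<close>

lemma compactness_liminf:
  assumes n: "\<And>k. n k > 0" "filterlim n at_top sequentially" and le: "\<And>k. En (n k) (\<theta>s k) \<le> M"
  obtains q \<theta> l where "strict_mono (q :: nat \<Rightarrow> nat)" "\<theta> \<in> Theta"
    "(\<lambda>k. D (n (q k)) (\<theta>s (q k)) \<theta>) \<longlonglongrightarrow> 0" "(\<lambda>k. En (n (q k)) (\<theta>s (q k))) \<longlonglongrightarrow> l" "Einf \<theta> \<le> l"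
proof -
  define K where "K = (\<lambda>k. fst (\<theta>s k))"
  define b where "b = (\<lambda>k. fst (snd (\<theta>s k)))"
  define W where "W = (\<lambda>k. fst (snd (snd (\<theta>s k))))"
  define c where "c = (\<lambda>k. snd (snd (snd (\<theta>s k))))"
  have \<theta>_eq: "\<theta>s k = (K k, b k, W k, c k)" for k
    by (simp add: K_def b_def W_def c_def)
  have le': "En (n k) (K k, b k, W k, c k) \<le> M" for k
    using le[of k] by (simp only: \<theta>_eq)
  obtain B where B: "\<And>n K b W c i. En n (K, b, W, c) \<le> M \<Longrightarrow> i < n \<Longrightarrow> norm (K i) \<le> B"
    "\<And>n K b W c i. En n (K, b, W, c) \<le> M \<Longrightarrow> i < n \<Longrightarrow> norm (b i) \<le> B"
    "\<And>n K b W c. En n (K, b, W, c) \<le> M \<Longrightarrow> norm W \<le> B"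
    "\<And>n K b W c. En n (K, b, W, c) \<le> M \<Longrightarrow> norm c \<le> B"
    "\<And>n K b W c. En n (K, b, W, c) \<le> M \<Longrightarrow> disc_seminorm N\<^sub>K n K \<le> B"
    "\<And>n K b W c. En n (K, b, W, c) \<le> M \<Longrightarrow> disc_seminorm N\<^sub>b n b \<le> B"
    by (rule En_bound[of M]) (blast intro: that)
  note B' = B(1)[OF le'] B(2)[OF le'] B(3)[OF le'] B(4)[OF le'] B(5)[OF le'] B(6)[OF le']
  \<comment> \<open>The last four components do not depend on \<open>t\<close>. Packing them in
    gives the limits of \<open>W\<close>, \<open>c\<close> and of both seminorms from the same
    extraction that treats the step functions.\<close>
  define f where "f = (\<lambda>k t. (step_fun (n k) (K k) t, step_fun (n k) (b k) t, W k, c k,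
      disc_seminorm N\<^sub>K (n k) (K k), disc_seminorm N\<^sub>b (n k) (b k)))"
  obtain q g where q: "strict_mono q" and g: "continuous_on {0..1} g"
    "\<And>t. t \<in> {0..1} \<Longrightarrow> (\<lambda>k. f (q k) t) \<longlonglongrightarrow> g t"
  proof (rule asymptotically_equicontinuous_subseq[of f "6 * B"])
    fix k :: nat and t :: real
    have "norm (f k t) \<le> norm (step_fun (n k) (K k) t) + (norm (step_fun (n k) (b k) t) + (norm (W k) +
        (norm (c k) + (norm (disc_seminorm N\<^sub>K (n k) (K k)) + norm (disc_seminorm N\<^sub>b (n k) (b k))))))"
      unfolding f_def by (intro order_trans[OF norm_Pair_le] add_left_mono order_refl)
    also have "\<dots> \<le> B + (B + (B + (B + (B + B))))"
      unfolding step_fun_def real_norm_def abs_of_nonneg[OF disc_seminorm_nonneg]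
      by (intro add_mono B' grid_index_less n)
    finally show "norm (f k t) \<le> 6 * B" by simp
  next
    fix e :: real assume "e > 0"
    then have "e / 2 > 0" by simp
    obtain \<delta>1 k1 where 1: "\<delta>1 > 0" "\<And>k s t. k \<ge> k1 \<Longrightarrow> s \<in> {0..1} \<Longrightarrow> t \<in> {0..1} \<Longrightarrow> \<bar>s - t\<bar> < \<delta>1
        \<Longrightarrow> norm (step_fun (n k) (K k) s - step_fun (n k) (K k) t) < e / 2"
      using step_fun_asymptotically_equicontinuous[OF norms(1) n B'(5) \<open>e / 2 > 0\<close>] by metis
    obtain \<delta>2 k2 where 2: "\<delta>2 > 0" "\<And>k s t. k \<ge> k2 \<Longrightarrow> s \<in> {0..1} \<Longrightarrow> t \<in> {0..1} \<Longrightarrow> \<bar>s - t\<bar> < \<delta>2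
        \<Longrightarrow> norm (step_fun (n k) (b k) s - step_fun (n k) (b k) t) < e / 2"
      using step_fun_asymptotically_equicontinuous[OF norms(2) n B'(6) \<open>e / 2 > 0\<close>] by metis
    show "\<exists>\<delta>>0. \<exists>k0. \<forall>k\<ge>k0. \<forall>s\<in>{0..1}. \<forall>t\<in>{0..1}. \<bar>s - t\<bar> < \<delta> \<longrightarrow> norm (f k s - f k t) < e"
    proof (intro exI[of _ "min \<delta>1 \<delta>2"] exI[of _ "max k1 k2"] conjI allI ballI impI)
      fix k s t assume *: "k \<ge> max k1 k2" "s \<in> {0..1}" "t \<in> {0..1}" "\<bar>s - t\<bar> < min \<delta>1 \<delta>2"
      have "f k s - f k t = (step_fun (n k) (K k) s - step_fun (n k) (K k) t,
          step_fun (n k) (b k) s - step_fun (n k) (b k) t, 0)"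
        by (simp add: f_def zero_prod_def)
      also have "norm \<dots> \<le> norm (step_fun (n k) (K k) s - step_fun (n k) (K k) t) +
          (norm (step_fun (n k) (b k) s - step_fun (n k) (b k) t) + norm (0 :: (real^'d^'m) \<times> (real^'m) \<times> real \<times> real))"
        by (intro order_trans[OF norm_Pair_le] add_left_mono order_refl)
      also have "\<dots> < e"
        using 1(2)[of k s t] 2(2)[of k s t] * by simp
      finally show "norm (f k s - f k t) < e" .
    qed (use 1 2 in auto)
  qed (rule that)
  define n' where "n' = (\<lambda>k. n (q k))"
  have n': "\<And>k. n' k > 0" "filterlim n' at_top sequentially"
    using n filterlim_compose[OF n(2) filterlim_subseq[OF q]] by (simp_all add: n'_def)
  define K' where "K' = restrict (\<lambda>t. fst (g t)) {0..1}"
  define b' where "b' = restrict (\<lambda>t. fst (snd (g t))) {0..1}"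
  define W' where "W' = fst (snd (snd (g 0)))"
  define c' where "c' = fst (snd (snd (snd (g 0))))"
  define AK where "AK = fst (snd (snd (snd (snd (g 0)))))"
  define Ab where "Ab = snd (snd (snd (snd (snd (g 0)))))"
  have K: "(\<lambda>k. step_fun (n' k) (K (q k)) t) \<longlonglongrightarrow> K' t" if "t \<in> {0..1}" for t
    using tendsto_fst[OF g(2)[OF that]] that by (simp add: f_def n'_def K'_def)
  have b: "(\<lambda>k. step_fun (n' k) (b (q k)) t) \<longlonglongrightarrow> b' t" if "t \<in> {0..1}" for t
    using tendsto_fst[OF tendsto_snd[OF g(2)[OF that]]] that by (simp add: f_def n'_def b'_def)
  have g0: "(\<lambda>k. snd (snd (f (q k) 0))) \<longlonglongrightarrow> snd (snd (g 0))"
    by (intro tendsto_snd g(2)) simp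
  have W: "(\<lambda>k. W (q k)) \<longlonglongrightarrow> W'"
    using tendsto_fst[OF g0] by (simp add: f_def W'_def)
  have c: "(\<lambda>k. c (q k)) \<longlonglongrightarrow> c'"
    using tendsto_fst[OF tendsto_snd[OF g0]] by (simp add: f_def c'_def)
  have AK: "(\<lambda>k. disc_seminorm N\<^sub>K (n' k) (K (q k))) \<longlonglongrightarrow> AK"
    using tendsto_fst[OF tendsto_snd[OF tendsto_snd[OF g0]]] by (simp add: f_def n'_def AK_def)
  have Ab: "(\<lambda>k. disc_seminorm N\<^sub>b (n' k) (b (q k))) \<longlonglongrightarrow> Ab"
    using tendsto_snd[OF tendsto_snd[OF tendsto_snd[OF g0]]] by (simp add: f_def n'_def Ab_def)
  have cK: "continuous_on {0..1} K'" and cb: "continuous_on {0..1} b'"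
    using continuous_on_fst[OF g(1)] continuous_on_fst[OF continuous_on_snd[OF g(1)]]
      continuous_on_cong[of "{0..1}" "{0..1}" K' "\<lambda>t. fst (g t)"]
      continuous_on_cong[of "{0..1}" "{0..1}" b' "\<lambda>t. fst (snd (g t))"]
    unfolding K'_def b'_def by (simp_all only: restrict_apply')
  have ext: "K' \<in> extensional {0..1}" "b' \<in> extensional {0..1}"
    unfolding K'_def b'_def by (rule restrict_extensional)+
  note K'H = disc_seminorm_liminf[OF norms(1) cK ext(1) n' K AK]
    and b'H = disc_seminorm_liminf[OF norms(2) cb ext(2) n' b Ab]
  have BK: "\<And>k i. i < n' k \<Longrightarrow> norm (K (q k) i) \<le> B" and Bb: "\<And>k i. i < n' k \<Longrightarrow> norm (b (q k) i) \<le> B"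
    unfolding n'_def by (intro B' ; assumption)+
  have state: "(\<lambda>k. disc_state \<sigma> (n' k) (K (q k)) (b (q k)) x0 (n' k)) \<longlonglongrightarrow> cont_state \<sigma> K' b' x0 1" for x0
    by (rule disc_state_tendsto_cont_state[OF \<sigma>_lipschitz \<sigma>_0 n' BK Bb K cK b cb])
  have K0: "(\<lambda>k. K (q k) 0) \<longlonglongrightarrow> K' 0" and b0: "(\<lambda>k. b (q k) 0) \<longlonglongrightarrow> b' 0"
    using K[of 0] b[of 0] by (simp_all add: step_fun_0)
  \<comment> \<open>The limit of the energies contains the limits \<open>AK\<close> and
    \<open>Ab\<close> of the seminorms, where \<open>Einf\<close> has the possibly smaller energies
    of \<open>K'\<close> and \<open>b'\<close>.\<close>
  define l where "l = (\<Sum>s=1..S. \<L> (h (W' *v cont_state \<sigma> K' b' (x s) 1 + c')) (y s))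
     + \<alpha> 1 * (AK + \<tau> 1 * (N\<^sub>K (K' 0))\<^sup>2) + \<alpha> 2 * (Ab + \<tau> 2 * (N\<^sub>b (b' 0))\<^sup>2)
     + \<alpha> 3 * (N\<^sub>W W')\<^sup>2 + \<alpha> 4 * (N\<^sub>c c')\<^sup>2"
  have "(\<lambda>k. En (n' k) (\<theta>s (q k))) \<longlonglongrightarrow> l"
    unfolding \<theta>_eq En_eq l_def disc_reg_eq
    by (intro tendsto_add tendsto_mult tendsto_const tendsto_sum tendsto_power loss_tendsto state
        tendsto_is_norm[OF norms(1)] tendsto_is_norm[OF norms(2)] tendsto_is_norm[OF norms(3)]
        tendsto_is_norm[OF norms(4)] AK Ab K0 b0 W c)
  moreover have "Einf (K', b', W', c') \<le> l"
    unfolding Einf_eq l_def cont_reg_def using K'H(2) b'H(2) \<alpha>_pos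
    by (intro add_mono mult_left_mono order_refl) auto
  moreover have "(\<lambda>k. D (n' k) (\<theta>s (q k)) (K', b', W', c')) \<longlonglongrightarrow> 0 + 0 + N\<^sub>W (W' - W') + N\<^sub>c (c' - c')"
    unfolding \<theta>_eq param_dist_def prod.case
    by (intro tendsto_add L2_norm_pw_const_tendsto_0[OF norms(1) cK n'(1) BK K]
        L2_norm_pw_const_tendsto_0[OF norms(2) cb n'(1) Bb b]
        tendsto_is_norm[OF norms(3)] tendsto_is_norm[OF norms(4)] tendsto_diff tendsto_const W c)
  moreover have "(K', b', W', c') \<in> Theta"
    using K'H b'H by (simp add: Theta_def)
  ultimately show thesis
    using that[of q "(K', b', W', c')" l] q
    by (simp add: n'_def is_norm_zero[OF norms(3)] is_norm_zero[OF norms(4)])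
qed

text \<open>\<open>U n\<close> is the energy of the sampled parameters with the discrete
  regularisers replaced by the continuum ones. Thus only the Euler states vary with \<open>n\<close>
  and \<open>U\<close> converges, while \<open>disc_seminorm_sample_le\<close> makes it an upper
  bound; the limit of the sampled seminorms never has to be found.\<close>

lemma recovery_sequence:
  assumes "\<theta> \<in> Theta"
  obtains U where "U \<longlonglongrightarrow> Einf \<theta>" "\<And>n. n > 0 \<Longrightarrow> \<exists>\<eta>\<in>Theta_disc n. En n \<eta> \<le> U n"
proof -
  obtain K b W c where \<theta>: "\<theta> = (K, b, W, c)" by (cases \<theta>)
  then have H: "K \<in> H1" "b \<in> H1"
    using assms by (auto simp: Theta_def)
  note cK = H1_continuous_on[OF H(1)] and cb = H1_continuous_on[OF H(2)]
  define U where "U = (\<lambda>n. (\<Sum>s=1..S. \<L> (h (W *v disc_state \<sigma> n (sample n K) (sample n b) (x s) n + c)) (y s))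
     + \<alpha> 1 * cont_reg N\<^sub>K (\<tau> 1) K + \<alpha> 2 * cont_reg N\<^sub>b (\<tau> 2) b
     + \<alpha> 3 * (N\<^sub>W W)\<^sup>2 + \<alpha> 4 * (N\<^sub>c c)\<^sup>2)"
  have n: "\<And>k. Suc k > 0" "filterlim Suc at_top sequentially"
    by (simp_all add: filterlim_Suc)
  have "bounded (K ` {0..1})" "bounded (b ` {0..1})"
    by (intro compact_imp_bounded compact_continuous_image cK cb compact_Icc)+
  then obtain B1 B2 where B: "\<And>t. t \<in> {0..1} \<Longrightarrow> norm (K t) \<le> B1" "\<And>t. t \<in> {0..1} \<Longrightarrow> norm (b t) \<le> B2"
    by (metis bounded_iff imageI)
  have "norm (sample (Suc k) K i) \<le> max B1 B2" "norm (sample (Suc k) b i) \<le> max B1 B2" if "i < Suc k" for k i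
    using that B(1)[of "real i / real (Suc k)"] B(2)[of "real i / real (Suc k)"]
    by (auto simp: sample_def le_max_iff_disj)
  note state = disc_state_tendsto_cont_state[OF \<sigma>_lipschitz \<sigma>_0 n this
      step_fun_sample_tendsto[OF cK _ n] cK step_fun_sample_tendsto[OF cb _ n] cb]
  have "(\<lambda>k. U (Suc k)) \<longlonglongrightarrow> Einf \<theta>"
    unfolding U_def \<theta> Einf_eq
    by (intro tendsto_add tendsto_const tendsto_sum loss_tendsto state)
  then have "U \<longlonglongrightarrow> Einf \<theta>"
    by (rule LIMSEQ_imp_Suc)
  moreover have "\<exists>\<eta>\<in>Theta_disc n. En n \<eta> \<le> U n" if "n > 0" for n
  proof (rule bexI)
    show "(sample n K, sample n b, W, c) \<in> Theta_disc n"
      by (simp add: Theta_disc_def sample_def)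
    have "sample n K 0 = K 0" "sample n b 0 = b 0"
      using that by (simp_all add: sample_def)
    then show "En n (sample n K, sample n b, W, c) \<le> U n"
      unfolding En_eq U_def disc_reg_eq cont_reg_def
      using \<alpha>_pos \<tau>_pos disc_seminorm_sample_le[OF H(1) norms(1) that] disc_seminorm_sample_le[OF H(2) norms(2) that]
      by (intro add_mono mult_left_mono order_refl) auto
  qed
  ultimately show thesis
    using that by blast
qed

text \<open>With \<open>W = 0\<close> and \<open>c = 0\<close> the output is \<open>h 0\<close>
  whatever the states are, so this competitor has the same energy for every \<open>n\<close> and
  bounds the energies of all minimisers.\<close>

lemma En_zero:
  assumes "n > 0"
  shows "En n (restrict (\<lambda>_. 0) {..<n}, restrict (\<lambda>_. 0) {..<n}, 0, 0) = (\<Sum>s=1..S. \<L> (h 0) (y s))"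
proof -
  have zero: "disc_reg N \<tau>' n (restrict (\<lambda>_. 0) {..<n}) = 0" if "is_norm N" for N :: "'a::real_vector \<Rightarrow> real" and \<tau>'
    using assms by (auto simp: disc_reg_def is_norm_zero[OF that] intro!: sum.neutral)
  show ?thesis
    unfolding En_eq by (simp add: zero norms is_norm_zero)
qed

text \<open>The liminf inequality and recovery sequences give
  \<open>Einf \<theta> \<le> l \<le> Einf \<eta>\<close> for every \<open>\<eta>\<close> in
  \<open>Theta\<close>. This is minimality of \<open>\<theta>\<close>, and taking
  \<open>\<eta> = \<theta>\<close> gives \<open>l = Einf \<theta>\<close>.\<close>

lemma minimiser_subseq:
  assumes min: "\<And>n. n \<ge> 1 \<Longrightarrow> is_arg_min (En n) (\<lambda>\<eta>. \<eta> \<in> Theta_disc n) (\<theta>s n)"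
    and r: "strict_mono (r :: nat \<Rightarrow> nat)"
  obtains q \<theta> where "strict_mono (q :: nat \<Rightarrow> nat)" "\<theta> \<in> Theta"
    "(\<lambda>k. D (r (q k)) (\<theta>s (r (q k))) \<theta>) \<longlonglongrightarrow> 0" "is_arg_min Einf (\<lambda>\<eta>. \<eta> \<in> Theta) \<theta>"
    "(\<lambda>k. En (r (q k)) (\<theta>s (r (q k)))) \<longlonglongrightarrow> Einf \<theta>"
proof -
  have opt: "En n (\<theta>s n) \<le> En n \<eta>" if "n > 0" "\<eta> \<in> Theta_disc n" for n \<eta>
    using min[of n] that unfolding is_arg_min_def by (metis One_nat_def Suc_leI not_less)
  \<comment> \<open>The shift excludes the grid size 0, which \<open>r 0\<close> may be; strict
    monotonicity makes \<open>r (Suc k)\<close> positive. It is undone by returning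
    \<open>Suc (q k)\<close>.\<close>
  define n where "n = (\<lambda>k. r (Suc k))"
  have n: "\<And>k. n k > 0"
    using r by (metis n_def less_nat_zero_code not_gr_zero strict_mono_less zero_less_Suc)
  have n_lim: "filterlim n at_top sequentially"
    unfolding n_def by (rule filterlim_compose[OF filterlim_subseq[OF r] filterlim_Suc])
  have le: "En (n k) (\<theta>s (n k)) \<le> (\<Sum>s=1..S. \<L> (h 0) (y s))" for k
    unfolding En_zero[OF n[of k], symmetric] by (intro opt n) (simp add: Theta_disc_def)
  obtain q \<theta> l where q: "strict_mono (q :: nat \<Rightarrow> nat)" and \<theta>: "\<theta> \<in> Theta"
    and D: "(\<lambda>k. D (n (q k)) (\<theta>s (n (q k))) \<theta>) \<longlonglongrightarrow> 0"
    and En: "(\<lambda>k. En (n (q k)) (\<theta>s (n (q k)))) \<longlonglongrightarrow> l" and l: "Einf \<theta> \<le> l"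
    using compactness_liminf[of n "\<lambda>k. \<theta>s (n k)", OF n n_lim le] by blast
  have l_le: "l \<le> Einf \<eta>" if "\<eta> \<in> Theta" for \<eta>
  proof -
    obtain U where U: "U \<longlonglongrightarrow> Einf \<eta>" "\<And>n. n > 0 \<Longrightarrow> \<exists>\<eta>\<in>Theta_disc n. En n \<eta> \<le> U n"
      using recovery_sequence[OF \<open>\<eta> \<in> Theta\<close>] by blast
    have "(\<lambda>k. U (n (q k))) \<longlonglongrightarrow> Einf \<eta>"
      by (intro filterlim_compose[OF U(1)] filterlim_compose[OF n_lim] filterlim_subseq q)
    moreover have "En (n (q k)) (\<theta>s (n (q k))) \<le> U (n (q k))" for k
      using U(2)[OF n[of "q k"]] opt[OF n[of "q k"]] order_trans by blast
    ultimately show ?thesis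
      using En by (intro LIMSEQ_le[OF En]) auto
  qed
  have "l = Einf \<theta>"
    using l l_le[OF \<theta>] by simp
  moreover have "is_arg_min Einf (\<lambda>\<eta>. \<eta> \<in> Theta) \<theta>"
    using \<theta> l l_le by (fastforce simp: is_arg_min_def not_less)
  moreover have "strict_mono (\<lambda>k. Suc (q k))"
    using q by (simp add: strict_mono_def)
  ultimately show thesis
    using that[of "\<lambda>k. Suc (q k)" \<theta>] \<theta> D En by (simp add: n_def)
qed

text \<open>Identifies a limit point given only through \<open>D\<close> with the limit built by
  \<open>minimiser_subseq\<close> along a further subsequence, so that minimality carries over. The
  four summands of \<open>D\<close> are nonnegative and can be treated separately.\<close>

lemma param_dist_limit_unique:
  assumes \<theta>: "\<theta> \<in> Theta" "\<theta>' \<in> Theta" and r: "filterlim r at_top sequentially"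
    and lim: "(\<lambda>k. D (r k) (\<theta>s k) \<theta>) \<longlonglongrightarrow> 0" "(\<lambda>k. D (r k) (\<theta>s k) \<theta>') \<longlonglongrightarrow> 0"
  shows "\<theta> = \<theta>'"
proof -
  obtain K b W c where eq: "\<theta> = (K, b, W, c)" by (cases \<theta>)
  obtain K' b' W' c' where eq': "\<theta>' = (K', b', W', c')" by (cases \<theta>')
  define Ks where "Ks = (\<lambda>k. fst (\<theta>s k))"
  define bs where "bs = (\<lambda>k. fst (snd (\<theta>s k)))"
  define Ws where "Ws = (\<lambda>k. fst (snd (snd (\<theta>s k))))"
  define cs where "cs = (\<lambda>k. snd (snd (snd (\<theta>s k))))"
  have \<theta>s_eq: "\<theta>s k = (Ks k, bs k, Ws k, cs k)" for k
    by (simp add: Ks_def bs_def Ws_def cs_def)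
  have split: "(\<lambda>k. L2_norm N\<^sub>K (\<lambda>t. pw_const (r k) (Ks k) t - K t)) \<longlonglongrightarrow> 0"
    "(\<lambda>k. L2_norm N\<^sub>b (\<lambda>t. pw_const (r k) (bs k) t - b t)) \<longlonglongrightarrow> 0"
    "(\<lambda>k. N\<^sub>W (Ws k - W)) \<longlonglongrightarrow> 0" "(\<lambda>k. N\<^sub>c (cs k - c)) \<longlonglongrightarrow> 0"
    if "(\<lambda>k. D (r k) (\<theta>s k) (K, b, W, c)) \<longlonglongrightarrow> 0" for K b W c
  proof -
    have D: "(\<lambda>k. L2_norm N\<^sub>K (\<lambda>t. pw_const (r k) (Ks k) t - K t) + L2_norm N\<^sub>b (\<lambda>t. pw_const (r k) (bs k) t - b t)
      + N\<^sub>W (Ws k - W) + N\<^sub>c (cs k - c)) \<longlonglongrightarrow> 0"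
      using that by (simp add: \<theta>s_eq param_dist_def)
    have nonneg: "0 \<le> L2_norm N\<^sub>K (\<lambda>t. pw_const (r k) (Ks k) t - K t)"
      "0 \<le> L2_norm N\<^sub>b (\<lambda>t. pw_const (r k) (bs k) t - b t)" "0 \<le> N\<^sub>W (Ws k - W)" "0 \<le> N\<^sub>c (cs k - c)" for k
      using norms by (auto simp: L2_norm_def is_norm_nonneg)
    show "(\<lambda>k. L2_norm N\<^sub>K (\<lambda>t. pw_const (r k) (Ks k) t - K t)) \<longlonglongrightarrow> 0"
      using nonneg by (intro tendsto_sandwich[OF _ _ tendsto_const D] always_eventually allI) (auto intro!: add_nonneg_nonneg simp: add.assoc)
    show "(\<lambda>k. L2_norm N\<^sub>b (\<lambda>t. pw_const (r k) (bs k) t - b t)) \<longlonglongrightarrow> 0"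
      using nonneg by (intro tendsto_sandwich[OF _ _ tendsto_const D] always_eventually allI) (auto intro!: add_nonneg_nonneg simp: add.assoc add_increasing)
    show "(\<lambda>k. N\<^sub>W (Ws k - W)) \<longlonglongrightarrow> 0"
      using nonneg by (intro tendsto_sandwich[OF _ _ tendsto_const D] always_eventually allI) (auto intro!: add_nonneg_nonneg simp: add.assoc add_increasing)
    show "(\<lambda>k. N\<^sub>c (cs k - c)) \<longlonglongrightarrow> 0"
      using nonneg by (intro tendsto_sandwich[OF _ _ tendsto_const D] always_eventually allI) (auto intro!: add_nonneg_nonneg simp: add.assoc add_increasing)
  qed
  note l = split[OF lim(1)[unfolded eq]] and l' = split[OF lim(2)[unfolded eq']]
  have H: "K \<in> H1" "b \<in> H1" "K' \<in> H1" "b' \<in> H1"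
    using \<theta> by (auto simp: eq eq' Theta_def)
  have r0: "\<forall>\<^sub>F k in sequentially. r k > 0"
  proof -
    have "\<forall>\<^sub>F k in sequentially. 1 \<le> r k"
      using r unfolding filterlim_at_top by blast
    then show ?thesis by (simp add: Suc_le_eq)
  qed
  have "\<forall>\<^sub>F k in sequentially. pw_const (r k) (Ks k) \<in> L2" "\<forall>\<^sub>F k in sequentially. pw_const (r k) (bs k) \<in> L2"
    using r0 by (auto elim!: eventually_mono intro: pw_const_L2)
  then have "K = K'" "b = b'"
    using L2_limit_unique[OF norms(1) _ _ _ _ _ l(1) l'(1)] L2_limit_unique[OF norms(2) _ _ _ _ _ l(2) l'(2)] H
    by (auto simp: H1_def)
  moreover have fin: "v = w" if "is_norm N" "(\<lambda>k. N (f k - v)) \<longlonglongrightarrow> 0" "(\<lambda>k. N (f k - w)) \<longlonglongrightarrow> 0"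
    for N :: "'b::euclidean_space \<Rightarrow> real" and f :: "nat \<Rightarrow> 'b" and v w
  proof -
    have "(\<lambda>k. 2 * (N (f k - v))\<^sup>2 + 2 * (N (f k - w))\<^sup>2) \<longlonglongrightarrow> 2 * 0\<^sup>2 + 2 * 0\<^sup>2"
      by (intro tendsto_intros that)
    then have "(N (v - w))\<^sup>2 \<le> 2 * 0\<^sup>2 + 2 * 0\<^sup>2"
      by (rule LIMSEQ_le_const) (use is_norm_diff_square_le[OF that(1)] in blast)
    then show ?thesis
      by (simp add: is_norm_eq_0_iff[OF that(1)])
  qed
  ultimately show ?thesis
    using fin[OF norms(3) l(3) l'(3)] fin[OF norms(4) l(4) l'(4)] by (simp add: eq eq')
qed

end

theorem theorem2p2:
  fixes \<sigma> :: "real^'d \<Rightarrow> real^'d"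
    and h :: "real^'m \<Rightarrow> real^'m"
    and \<L> :: "real^'m \<Rightarrow> real^'m \<Rightarrow> real"
    and N\<^sub>K :: "real^'d^'d \<Rightarrow> real"
    and N\<^sub>b :: "real^'d \<Rightarrow> real"
    and N\<^sub>W :: "real^'d^'m \<Rightarrow> real"
    and N\<^sub>c :: "real^'m \<Rightarrow> real"
    and \<alpha> \<tau> :: "nat \<Rightarrow> real"
    and S :: nat
    and x :: "nat \<Rightarrow> real^'d"
    and y :: "nat \<Rightarrow> real^'m"
  assumes "is_norm N\<^sub>K" and "is_norm N\<^sub>b" and "is_norm N\<^sub>W" and "is_norm N\<^sub>c"
    and "\<forall>i\<in>{1, 2, 3, 4}. \<alpha> i > 0" and "\<forall>j\<in>{1, 2}. \<tau> j > 0"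
    and "continuous_on UNIV h"
    and "\<exists>C. C-lipschitz_on UNIV \<sigma>" and "acts_componentwise \<sigma>"
    and "\<sigma> 0 = 0"
    and "\<forall>u v. \<L> u v \<ge> 0" and "\<forall>v. continuous_on UNIV (\<lambda>u. \<L> u v)"
    and "S \<ge> 1"
  shows
    "let En = disc_energy \<sigma> h \<L> N\<^sub>K N\<^sub>b N\<^sub>W N\<^sub>c \<alpha> \<tau> S x y;
         Einf = cont_energy \<sigma> h \<L> N\<^sub>K N\<^sub>b N\<^sub>W N\<^sub>c \<alpha> \<tau> S x y;
         D = param_dist N\<^sub>K N\<^sub>b N\<^sub>W N\<^sub>c
     in
       (\<forall>n\<ge>1. \<exists>\<theta>. is_arg_min (En n) (\<lambda>\<eta>. \<eta> \<in> Theta_disc n) \<theta>) \<and>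
       (\<exists>\<theta>. is_arg_min Einf (\<lambda>\<eta>. \<eta> \<in> Theta) \<theta>) \<and>
       (\<forall>\<theta>s. (\<forall>n\<ge>1. is_arg_min (En n) (\<lambda>\<eta>. \<eta> \<in> Theta_disc n) (\<theta>s n)) \<longrightarrow>
          (\<forall>n\<ge>1. En n (\<theta>s n) = (INF \<eta>\<in>Theta_disc n. En n \<eta>)) \<and>
          (\<lambda>n. En n (\<theta>s n)) \<longlonglongrightarrow> (INF \<eta>\<in>Theta. Einf \<eta>) \<and>
          (\<forall>r :: nat \<Rightarrow> nat. strict_mono r \<longrightarrow>
             (\<exists>q :: nat \<Rightarrow> nat. strict_mono q \<and>
                (\<exists>\<theta>\<in>Theta. (\<lambda>k. D (r (q k)) (\<theta>s (r (q k))) \<theta>) \<longlonglongrightarrow> 0))) \<and>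
          (\<forall>(r :: nat \<Rightarrow> nat) \<theta>. strict_mono r \<and> \<theta> \<in> Theta \<and> (\<lambda>k. D (r k) (\<theta>s (r k)) \<theta>) \<longlonglongrightarrow> 0 \<longrightarrow>
             is_arg_min Einf (\<lambda>\<eta>. \<eta> \<in> Theta) \<theta>))"
proof -
  obtain C where C: "C-lipschitz_on UNIV \<sigma>"
    using assms(8) by blast
  interpret training_problem \<sigma> h \<L> N\<^sub>K N\<^sub>b N\<^sub>W N\<^sub>c \<alpha> \<tau> S x y C
    using assms C by unfold_locales auto
  have disc_ex: "\<exists>\<theta>. is_arg_min (En n) (\<lambda>\<eta>. \<eta> \<in> Theta_disc n) \<theta>" if "n \<ge> 1" for n
    using that by (intro disc_minimiser_exists) simp
  then obtain \<theta>0 where \<theta>0: "\<And>n. n \<ge> 1 \<Longrightarrow> is_arg_min (En n) (\<lambda>\<eta>. \<eta> \<in> Theta_disc n) (\<theta>0 n)"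
    by metis
  \<comment> \<open>A family of discrete minimisers is chosen merely to take a limit of it along the
    identity.\<close>
  have cont_ex: "\<exists>\<theta>. is_arg_min Einf (\<lambda>\<eta>. \<eta> \<in> Theta) \<theta>"
    using minimiser_subseq[OF \<theta>0 strict_mono_id] by blast
  have main: "(\<forall>n\<ge>1. En n (\<theta>s n) = (INF \<eta>\<in>Theta_disc n. En n \<eta>)) \<and>
      (\<lambda>n. En n (\<theta>s n)) \<longlonglongrightarrow> (INF \<eta>\<in>Theta. Einf \<eta>) \<and>
      (\<forall>r :: nat \<Rightarrow> nat. strict_mono r \<longrightarrow>
         (\<exists>q :: nat \<Rightarrow> nat. strict_mono q \<and>
            (\<exists>\<theta>\<in>Theta. (\<lambda>k. D (r (q k)) (\<theta>s (r (q k))) \<theta>) \<longlonglongrightarrow> 0))) \<and>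
      (\<forall>(r :: nat \<Rightarrow> nat) \<theta>. strict_mono r \<and> \<theta> \<in> Theta \<and> (\<lambda>k. D (r k) (\<theta>s (r k)) \<theta>) \<longlonglongrightarrow> 0 \<longrightarrow>
         is_arg_min Einf (\<lambda>\<eta>. \<eta> \<in> Theta) \<theta>)"
    if min: "\<And>n. n \<ge> 1 \<Longrightarrow> is_arg_min (En n) (\<lambda>\<eta>. \<eta> \<in> Theta_disc n) (\<theta>s n)" for \<theta>s
  proof (intro conjI allI impI)
    fix n :: nat assume "n \<ge> 1"
    then show "En n (\<theta>s n) = (INF \<eta>\<in>Theta_disc n. En n \<eta>)"
      by (intro is_arg_min_imp_eq_INF min)
  next
    show "(\<lambda>n. En n (\<theta>s n)) \<longlonglongrightarrow> (INF \<eta>\<in>Theta. Einf \<eta>)"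
    \<comment> \<open>Different subsequences may lead to different minimisers, but all of them have
      the same value, the infimum.\<close>
    proof (rule LIMSEQ_subsubseq)
      fix r :: "nat \<Rightarrow> nat" assume "strict_mono r"
      from minimiser_subseq[OF min this] obtain q \<theta> where q: "strict_mono (q :: nat \<Rightarrow> nat)"
        and opt: "is_arg_min Einf (\<lambda>\<eta>. \<eta> \<in> Theta) \<theta>"
        and lim: "(\<lambda>k. En (r (q k)) (\<theta>s (r (q k)))) \<longlonglongrightarrow> Einf \<theta>"
        by blast
      show "\<exists>q. strict_mono q \<and> (\<lambda>k. En (r (q k)) (\<theta>s (r (q k)))) \<longlonglongrightarrow> (INF \<eta>\<in>Theta. Einf \<eta>)"
        using q lim unfolding is_arg_min_imp_eq_INF[OF opt] by blast
    qed
  next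
    fix r :: "nat \<Rightarrow> nat" assume "strict_mono r"
    from minimiser_subseq[OF min this]
    show "\<exists>q :: nat \<Rightarrow> nat. strict_mono q \<and> (\<exists>\<theta>\<in>Theta. (\<lambda>k. D (r (q k)) (\<theta>s (r (q k))) \<theta>) \<longlonglongrightarrow> 0)"
      by blast
  next
    fix r :: "nat \<Rightarrow> nat" and \<theta>
    assume "strict_mono r \<and> \<theta> \<in> Theta \<and> (\<lambda>k. D (r k) (\<theta>s (r k)) \<theta>) \<longlonglongrightarrow> 0"
    then have r: "strict_mono r" and \<theta>: "\<theta> \<in> Theta" and lim: "(\<lambda>k. D (r k) (\<theta>s (r k)) \<theta>) \<longlonglongrightarrow> 0"
      by auto
    \<comment> \<open>Inside the given convergent subsequence a further one tends to a minimiser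
      \<open>\<theta>'\<close>; it still tends to \<open>\<theta>\<close>, so the two
      coincide.\<close>
    obtain q \<theta>' where q: "strict_mono (q :: nat \<Rightarrow> nat)" and \<theta>': "\<theta>' \<in> Theta"
      and lim': "(\<lambda>k. D (r (q k)) (\<theta>s (r (q k))) \<theta>') \<longlonglongrightarrow> 0"
      and opt: "is_arg_min Einf (\<lambda>\<eta>. \<eta> \<in> Theta) \<theta>'"
      using minimiser_subseq[OF min r] by blast
    have "filterlim (\<lambda>k. r (q k)) at_top sequentially"
      by (rule filterlim_compose[OF filterlim_subseq[OF r] filterlim_subseq[OF q]])
    moreover have "(\<lambda>k. D (r (q k)) (\<theta>s (r (q k))) \<theta>) \<longlonglongrightarrow> 0"
      by (rule filterlim_compose[OF lim filterlim_subseq[OF q]])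
    ultimately have "\<theta> = \<theta>'"
      by (intro param_dist_limit_unique[OF \<theta> \<theta>' _ _ lim'])
    with opt show "is_arg_min Einf (\<lambda>\<eta>. \<eta> \<in> Theta) \<theta>"
      by simp
  qed
  show ?thesis
    unfolding Let_def
    by (rule conjI[OF allI[OF impI[OF disc_ex]] conjI[OF cont_ex allI[OF impI[OF main]]]]) blast+
qed

end
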